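(* Let $(M,g)$ be a compact Riemannian manifold without boundary of dimension $n\ge 2$. (a) Suppose that $n\le 3$ and $2<p\le\infty$, or $n=4$ and $2<p<\infty$, or $n\ge 5$ and $2<p\le \frac{2n}{n-4}$. Then the following two conditions are equivalent: (i) $\|\chi_{[\lambda,\lambda+o(1)]}\|_{L^2(M)\to L^p(M)}=o(\lambda^{\sigma(p,n)})$, i.e. for every $\varepsilon>0$ there are $0<\delta<1$ and $\Lambda<\infty$ (both depending on $\varepsilon$) such that $$\|\chi_{[\lambda,\lambda+\delta]}\|_{L^2(M)\to L^p(M)}\le \varepsilon\,\lambda^{\sigma(p,n)}\quad\text{for all }\lambda>\Lambda;$$ (ii) whenever $\lambda$ ranges over a sequence $\mu_k\to\infty$ and $\{\psi_\lambda\}$ (with $\lambda=\mu_k$) are functions satisfying $$\int_M|\psi_\lambda|^2\,dV=1\quad\text{and}\quad \|(\Delta+\lambda^2)\psi_\lambda\|_{L^2(M)}=o(\lambda),$$ one has $\|\psi_\lambda\|_{L^p(M)}=o(\lambda^{\sigma(p,n)})$. (b) Suppose that $n=4$ and $p=\infty$, or $n\ge 5$ and $\frac{2n}{n-4}<p\le\infty$. Then condition (i) is equivalent to the following condition: (ii$'$) whenever $\lambda$ ranges over a sequence $\mu_k\to\infty$ and $\{\psi_\lambda\}$ (with $\lambda=\mu_k$) are functions satisfying $$\int_M|\psi_\lambda|^2\,dV=1\quad\text{and}\quad \|(\Delta+\lambda^2)\psi_\lambda\|_{L^2(M)}+\lambda^{2-n(\frac12-\frac1p)}\|\chi_{[2\lambda,\infty)}\psi_\lambda\|_{L^p(M)}=o(\lambda),$$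 one has $\|\psi_\lambda\|_{L^p(M)}=o(\lambda^{\sigma(p,n)})$. All $o(\cdot)$ statements in (ii) and (ii$'$) are as $\lambda=\mu_k\to\infty$.
   Context: $dV=dV_g$ and $\Delta=\Delta_g$ are the volume element and the Laplace-Beltrami operator (with the sign convention that $\Delta\le 0$) of $(M,g)$. Let $0=\lambda_0<\lambda_1\le\lambda_2\le\cdots$ be the frequencies of $\Delta$, counted with multiplicity, and let $\{e_j\}$ be an orthonormal basis of $L^2(M,dV)$ consisting of eigenfunctions: $(\Delta+\lambda_j^2)e_j=0$, $\int_M|e_j|^2\,dV=1$. Let $E_jf=\langle f,e_j\rangle e_j$, with $\langle\cdot,\cdot\rangle$ the $L^2(dV)$ inner product. For an interval $I\subset[0,\infty)$ (such as $[\lambda,\lambda+\delta]$ or $[2\lambda,\infty)$) let $\chi_I f=\sum_{\lambda_j\in I}E_jf$. $\|\chi_I\|_{L^2(M)\to L^p(M)}$ denotes the operator norm from $L^2(M)$ to $L^p(M)$. The exponent $\sigma(p,n)$ is $$\sigma(p,n)=\begin{cases} n(\frac12-\frac1p)-\frac12, & \frac{2(n+1)}{n-1}\le p\le\infty,\\ \frac{n-1}{2}(\frac12-\frac1p), & 2\le p\le \frac{2(n+1)}{n-1},\end{cases}$$ with $1/p=0$ when $p=\infty$. Functions $\psi_\lambda$ are understood to be in $L^2(M)$ with $\Delta\psi_\lambda\in L^2(M)$. *)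

theory Defs
  imports "HOL-Analysis.Analysis" "HOL-Probability.Essential_Supremum"
begin

section \<open>Smooth maps on open subsets of Euclidean space\<close>

definition partial_deriv :: "'n::finite \<Rightarrow> (real^'n \<Rightarrow> 'b::real_normed_vector) \<Rightarrow> real^'n \<Rightarrow> 'b" where
  "partial_deriv i f x = frechet_derivative f (at x) (axis i 1)"

primrec Ck_on :: "nat \<Rightarrow> (real^'n::finite \<Rightarrow> 'b::real_normed_vector) \<Rightarrow> (real^'n) set \<Rightarrow> bool" where
  "Ck_on 0 f S \<longleftrightarrow> continuous_on S f"
| "Ck_on (Suc k) f S \<longleftrightarrow>
     (\<forall>x\<in>S. f differentiable (at x)) \<and> (\<forall>i. Ck_on k (partial_deriv i f) S)"

text \<open>Only meaningful for open \<open>S\<close>; the values of \<open>f\<close> outside \<open>S\<close> are then irrelevant.\<close>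

definition smooth_on :: "(real^'n::finite \<Rightarrow> 'b::real_normed_vector) \<Rightarrow> (real^'n) set \<Rightarrow> bool" where
  "smooth_on f S \<longleftrightarrow> (\<forall>k. Ck_on k f S)"

section \<open>Compact Riemannian manifolds without boundary\<close>

text \<open>
  The manifold is the whole type \<open>'m\<close>, and its dimension is \<open>CARD('n)\<close>. A chart is a pair of
  an open domain and a coordinate map; a smooth structure is given by any (not necessarily
  maximal) smooth atlas. Charts are onto open subsets of Euclidean space, so there is no boundary.
\<close>

type_synonym ('m, 'n) chart = "'m set \<times> ('m \<Rightarrow> real^'n)"

definition chart_inv :: "('m, 'n::finite) chart \<Rightarrow> real^'n \<Rightarrow> 'm" where
  "chart_inv c = inv_into (fst c) (snd c)"

definition is_chart :: "('m::topological_space, 'n::finite) chart \<Rightarrow> bool" where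
  "is_chart c \<longleftrightarrow> open (fst c) \<and> open (snd c ` fst c) \<and>
     homeomorphism (fst c) (snd c ` fst c) (snd c) (chart_inv c)"

definition smooth_atlas :: "('m::topological_space, 'n::finite) chart set \<Rightarrow> bool" where
  "smooth_atlas A \<longleftrightarrow>
     (\<forall>c\<in>A. is_chart c) \<and> (\<Union>c\<in>A. fst c) = UNIV \<and>
     (\<forall>c\<in>A. \<forall>d\<in>A. smooth_on (snd d \<circ> chart_inv c) (snd c ` (fst c \<inter> fst d)))"

text \<open>
  A Riemannian metric, given by its coefficient matrices \<open>g\<^sub>i\<^sub>j\<close> as functions of the
  coordinates in every chart of the atlas, transforming as a covariant 2-tensor.
\<close>

type_synonym ('m, 'n) metric = "('m, 'n) chart \<Rightarrow> real^'n \<Rightarrow> real^'n^'n"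

definition riemannian_metric ::
    "('m::topological_space, 'n::finite) chart set \<Rightarrow> ('m, 'n) metric \<Rightarrow> bool" where
  "riemannian_metric A g \<longleftrightarrow>
     (\<forall>c\<in>A. smooth_on (g c) (snd c ` fst c) \<and>
       (\<forall>y \<in> snd c ` fst c. transpose (g c y) = g c y \<and> (\<forall>v. v \<noteq> 0 \<longrightarrow> v \<bullet> (g c y *v v) > 0))) \<and>
     (\<forall>c\<in>A. \<forall>d\<in>A. \<forall>x \<in> fst c \<inter> fst d.
       let J = jacobian (snd d \<circ> chart_inv c) (at (snd c x))
       in g c (snd c x) = transpose J ** g d (snd d x) ** J)"

definition compact_riemannian_manifold ::
    "('m::t2_space, 'n::finite) chart set \<Rightarrow> ('m, 'n) metric \<Rightarrow> bool" where
  "compact_riemannian_manifold A g \<longleftrightarrow>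
     compact (UNIV :: 'm set) \<and> smooth_atlas A \<and> riemannian_metric A g"

text \<open>
  \<open>V\<close> is the measure with \<open>dV = \<surd>(det g\<^sub>i\<^sub>j) dy\<close> in every chart. These
  conditions determine \<open>V\<close>, since finitely many charts cover a compact manifold.
\<close>

definition riemannian_volume ::
    "('m::topological_space, 'n::finite) chart set \<Rightarrow> ('m, 'n) metric \<Rightarrow> 'm measure \<Rightarrow> bool" where
  "riemannian_volume A g V \<longleftrightarrow> sets V = sets borel \<and>
     (\<forall>c\<in>A. \<forall>B \<in> sets borel. B \<subseteq> fst c \<longrightarrow>
        emeasure V B = (\<integral>\<^sup>+y\<in>snd c ` B. ennreal (sqrt (det (g c y))) \<partial>lborel))"

section \<open>The Laplace--Beltrami operator\<close>

definition smooth_fun :: "('m, 'n::finite) chart set \<Rightarrow> ('m \<Rightarrow> complex) \<Rightarrow> bool" where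
  "smooth_fun A f \<longleftrightarrow> (\<forall>c\<in>A. smooth_on (f \<circ> chart_inv c) (snd c ` fst c))"

text \<open>\<open>\<Delta>F = |g|\<^sup>-\<^sup>1\<^sup>/\<^sup>2 \<Sum>\<^sub>i \<partial>\<^sub>i (\<Sum>\<^sub>j |g|\<^sup>1\<^sup>/\<^sup>2 g\<^sup>i\<^sup>j \<partial>\<^sub>j F)\<close> for a function \<open>F\<close> of the coordinates\<close>

definition chart_laplacian ::
    "(real^'n::finite \<Rightarrow> real^'n^'n) \<Rightarrow> (real^'n \<Rightarrow> complex) \<Rightarrow> real^'n \<Rightarrow> complex" where
  "chart_laplacian h F y =
     (1 / sqrt (det (h y))) *\<^sub>R
       (\<Sum>i\<in>UNIV. partial_deriv i
          (\<lambda>z. \<Sum>j\<in>UNIV. (sqrt (det (h z)) * matrix_inv (h z) $ i $ j) *\<^sub>R partial_deriv j F z) y)"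

text \<open>On smooth functions the value does not depend on the chosen chart around the point.\<close>

definition laplacian ::
    "('m, 'n::finite) chart set \<Rightarrow> ('m, 'n) metric \<Rightarrow> ('m \<Rightarrow> complex) \<Rightarrow> 'm \<Rightarrow> complex" where
  "laplacian A g f x =
     (let c = (SOME c. c \<in> A \<and> x \<in> fst c)
      in chart_laplacian (g c) (f \<circ> chart_inv c) (snd c x))"

section \<open>Lebesgue spaces\<close>

definition inv_exponent :: "ereal \<Rightarrow> real" where
  "inv_exponent p = real_of_ereal (inverse p)"

definition Lp_norm :: "'m measure \<Rightarrow> ereal \<Rightarrow> ('m \<Rightarrow> complex) \<Rightarrow> ennreal" where
  "Lp_norm V p f =
     (if p = \<infinity> then esssup V (\<lambda>x. ennreal (norm (f x)))
      else let q = real_of_ereal p; I = (\<integral>\<^sup>+x. ennreal (norm (f x) powr q) \<partial>V)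
           in if I = \<infinity> then \<infinity> else ennreal (enn2real I powr (1 / q)))"

definition L2_space :: "'m measure \<Rightarrow> ('m \<Rightarrow> complex) set" where
  "L2_space V = {f \<in> borel_measurable V. integrable V (\<lambda>x. (norm (f x))\<^sup>2)}"

definition L2_inner :: "'m measure \<Rightarrow> ('m \<Rightarrow> complex) \<Rightarrow> ('m \<Rightarrow> complex) \<Rightarrow> complex" where
  "L2_inner V f h = (\<integral>x. f x * cnj (h x) \<partial>V)"

definition L2_Lp_opnorm ::
    "'m measure \<Rightarrow> ereal \<Rightarrow> (('m \<Rightarrow> complex) \<Rightarrow> ('m \<Rightarrow> complex)) \<Rightarrow> ennreal" where
  "L2_Lp_opnorm V p T = (SUP f \<in> {f \<in> L2_space V. Lp_norm V 2 f \<le> 1}. Lp_norm V p (T f))"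

text \<open>\<open>\<Delta>\<psi> = h\<close> with \<open>\<psi>, h \<in> L\<^sup>2\<close>, in the sense of distributions\<close>

definition has_L2_laplacian ::
    "('m, 'n::finite) chart set \<Rightarrow> ('m, 'n) metric \<Rightarrow> 'm measure \<Rightarrow>
     ('m \<Rightarrow> complex) \<Rightarrow> ('m \<Rightarrow> complex) \<Rightarrow> bool" where
  "has_L2_laplacian A g V \<psi> h \<longleftrightarrow> \<psi> \<in> L2_space V \<and> h \<in> L2_space V \<and>
     (\<forall>\<phi>. smooth_fun A \<phi> \<longrightarrow>
        (\<integral>x. \<psi> x * laplacian A g \<phi> x \<partial>V) = (\<integral>x. h x * \<phi> x \<partial>V))"

section \<open>Spectral data\<close>

text \<open>Eigenfunctions are the smooth representatives; completeness of the orthonormal system is the last clause.\<close>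

definition laplace_eigenbasis ::
    "('m, 'n::finite) chart set \<Rightarrow> ('m, 'n) metric \<Rightarrow> 'm measure \<Rightarrow>
     (nat \<Rightarrow> real) \<Rightarrow> (nat \<Rightarrow> 'm \<Rightarrow> complex) \<Rightarrow> bool" where
  "laplace_eigenbasis A g V lam e \<longleftrightarrow>
     lam 0 = 0 \<and> lam 0 < lam 1 \<and> mono lam \<and>
     (\<forall>j. smooth_fun A (e j) \<and> (\<forall>x. laplacian A g (e j) x + of_real ((lam j)\<^sup>2) * e j x = 0)) \<and>
     (\<forall>j. e j \<in> L2_space V) \<and>
     (\<forall>j k. L2_inner V (e j) (e k) = (if j = k then 1 else 0)) \<and>
     (\<forall>f \<in> L2_space V.
        (\<lambda>N. Lp_norm V 2 (\<lambda>x. f x - (\<Sum>j<N. L2_inner V f (e j) * e j x))) \<longlonglongrightarrow> 0)"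

text \<open>\<open>\<chi>\<^sub>I f = \<Sum>\<^bsub>lam j \<in> I\<^esub> E\<^sub>j f\<close>, a representative of the limit in \<open>L\<^sup>2\<close>\<close>

definition spectral_proj ::
    "'m measure \<Rightarrow> (nat \<Rightarrow> real) \<Rightarrow> (nat \<Rightarrow> 'm \<Rightarrow> complex) \<Rightarrow> real set \<Rightarrow>
     ('m \<Rightarrow> complex) \<Rightarrow> ('m \<Rightarrow> complex)" where
  "spectral_proj V lam e I f =
     (SOME h. h \<in> L2_space V \<and>
        (\<lambda>N. Lp_norm V 2 (\<lambda>x. h x - (\<Sum>j | j < N \<and> lam j \<in> I. L2_inner V f (e j) * e j x))) \<longlonglongrightarrow> 0)"

definition sogge_exponent :: "ereal \<Rightarrow> nat \<Rightarrow> real" where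
  "sogge_exponent p n =
     (if ereal (2 * (real n + 1) / (real n - 1)) \<le> p
      then real n * (1/2 - inv_exponent p) - 1/2
      else (real n - 1) / 2 * (1/2 - inv_exponent p))"

section \<open>Spectral windows and quasimodes\<close>

definition is_smallo :: "(nat \<Rightarrow> ennreal) \<Rightarrow> (nat \<Rightarrow> real) \<Rightarrow> bool" where
  "is_smallo a b \<longleftrightarrow> (\<forall>\<epsilon>>0. \<forall>\<^sub>F k in sequentially. a k \<le> ennreal (\<epsilon> * b k))"

definition shrinking_window_bound ::
    "'m measure \<Rightarrow> (nat \<Rightarrow> real) \<Rightarrow> (nat \<Rightarrow> 'm \<Rightarrow> complex) \<Rightarrow> nat \<Rightarrow> ereal \<Rightarrow> bool" where
  "shrinking_window_bound V lam e n p \<longleftrightarrow>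
     (\<forall>\<epsilon>>0. \<exists>\<delta> \<Lambda> :: real. 0 < \<delta> \<and> \<delta> < 1 \<and>
        (\<forall>s>\<Lambda>. L2_Lp_opnorm V p (spectral_proj V lam e {s..s+\<delta>})
                 \<le> ennreal (\<epsilon> * s powr sogge_exponent p n)))"

definition quasimode_bound ::
    "('m, 'n::finite) chart set \<Rightarrow> ('m, 'n) metric \<Rightarrow> 'm measure \<Rightarrow> ereal \<Rightarrow> bool" where
  "quasimode_bound A g V p \<longleftrightarrow>
     (\<forall>(\<mu> :: nat \<Rightarrow> real) \<psi> D\<psi>.
        filterlim \<mu> at_top sequentially \<longrightarrow>
        (\<forall>k. has_L2_laplacian A g V (\<psi> k) (D\<psi> k)) \<longrightarrow>
        (\<forall>k. (\<integral>x. (norm (\<psi> k x))\<^sup>2 \<partial>V) = 1) \<longrightarrow>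
        is_smallo (\<lambda>k. Lp_norm V 2 (\<lambda>x. D\<psi> k x + of_real ((\<mu> k)\<^sup>2) * \<psi> k x)) \<mu> \<longrightarrow>
        is_smallo (\<lambda>k. Lp_norm V p (\<psi> k)) (\<lambda>k. \<mu> k powr sogge_exponent p CARD('n)))"

definition strong_quasimode_bound ::
    "('m, 'n::finite) chart set \<Rightarrow> ('m, 'n) metric \<Rightarrow> 'm measure \<Rightarrow>
     (nat \<Rightarrow> real) \<Rightarrow> (nat \<Rightarrow> 'm \<Rightarrow> complex) \<Rightarrow> ereal \<Rightarrow> bool" where
  "strong_quasimode_bound A g V lam e p \<longleftrightarrow>
     (\<forall>(\<mu> :: nat \<Rightarrow> real) \<psi> D\<psi>.
        filterlim \<mu> at_top sequentially \<longrightarrow>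
        (\<forall>k. has_L2_laplacian A g V (\<psi> k) (D\<psi> k)) \<longrightarrow>
        (\<forall>k. (\<integral>x. (norm (\<psi> k x))\<^sup>2 \<partial>V) = 1) \<longrightarrow>
        is_smallo
          (\<lambda>k. Lp_norm V 2 (\<lambda>x. D\<psi> k x + of_real ((\<mu> k)\<^sup>2) * \<psi> k x)
             + ennreal (\<mu> k powr (2 - real CARD('n) * (1/2 - inv_exponent p)))
               * Lp_norm V p (spectral_proj V lam e {2 * \<mu> k ..} (\<psi> k))) \<mu> \<longrightarrow>
        is_smallo (\<lambda>k. Lp_norm V p (\<psi> k)) (\<lambda>k. \<mu> k powr sogge_exponent p CARD('n)))"

end

theory Submission
  imports Defs
begin

text \<open>
  Expand a function into eigenfunctions, \<open>\<psi> \<sim> \<Sum> c\<^sub>j e\<^sub>j\<close>. A normalised quasimode of parameter \<open>\<mu>\<close> and residual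
  \<open>r = o(\<mu>)\<close> is one whose coefficients satisfy \<open>\<Sum> |c\<^sub>j|\<^sup>2 = 1\<close> and
  \<open>\<Sum> (\<mu>\<^sup>2 - \<lambda>\<^sub>j\<^sup>2)\<^sup>2 |c\<^sub>j|\<^sup>2 = r\<^sup>2\<close>.

  Quasimodes control windows (lemma \<open>window_of_strong_quasimode_bound\<close>): a normalised function with
  frequencies in \<open>[s, s + \<delta>]\<close> has residual at most \<open>3 \<delta> s\<close> and no frequencies above \<open>2 s\<close>. If the window bound
  failed, such functions with \<open>\<delta> \<rightarrow> 0\<close> and \<open>s \<rightarrow> \<infinity>\<close> would form a family of quasimodes violating (ii') and a fortiori (ii).

  Windows control the frequencies below \<open>2 \<mu>\<close> (\<open>low_frequencies_smallo\<close>): finitely many eigenfunctions have a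
  frequency below the threshold of the window bound, and their total contribution is bounded while
  \<open>\<mu>\<^bsup>\<sigma>\<^esup> \<rightarrow> \<infinity>\<close>. The rest is cut into
  cells \<open>[\<mu> + k \<delta>, \<mu> + (k + 1) \<delta>)\<close>, to each of which the window bound applies. The cells are summed by
  Cauchy-Schwarz with the weights \<open>1 + k\<^sup>2\<close>: the residual controls the weighted mass, because
  \<open>|\<mu>\<^sup>2 - \<lambda>\<^sub>j\<^sup>2|\<close> is at least \<open>\<mu> |\<lambda>\<^sub>j - \<mu>|\<close>, and \<open>\<Sum> 1 / (1 + k\<^sup>2)\<close> converges.

  The frequencies above \<open>2 \<mu>\<close> decide between (ii) and (ii'). Put \<open>\<theta> = n (1/2 - 1/p)\<close>; always
  \<open>\<theta> - 1/2 \<le> \<sigma>(p, n)\<close>. Condition (ii') assumes a bound \<open>o(\<mu>\<^bsup>\<theta> - 1\<^esup>)\<close> for this part, which is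
  stronger than \<open>o(\<mu>\<^bsup>\<sigma>\<^esup>)\<close>. For (ii) the bound has to be proved. If \<open>\<theta> < 2\<close>, then \<open>\<sigma> < 3/2\<close>, and summing
  over cells as before now leads to the convergent series \<open>\<Sum> k\<^bsup>2 \<sigma> - 4\<^esup>\<close>
  (\<open>high_frequencies_smallo_subcritical\<close>).

  At the critical exponent \<open>p = 2n/(n-4)\<close> that series diverges logarithmically, and one needs the endpoint Sobolev
  inequality \<open>\<parallel>w\<parallel>\<^sub>p \<le> C (\<parallel>\<Delta> w\<parallel>\<^sub>2 + \<parallel>w\<parallel>\<^sub>2)\<close> (\<open>critical_sobolev\<close>). It is deduced from the window bound itself. Summing
  windows up to frequency \<open>N\<close> gives the Bernstein inequality \<open>\<parallel>w\<parallel>\<^sub>p \<le> C N\<^sup>2 \<parallel>w\<parallel>\<^sub>2\<close>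
  (\<open>bernstein_of_window_bound\<close>); its dual, together with \<open>\<Sum> \<lambda>\<^sub>j\<^sup>2 |c\<^sub>j|\<^sup>2 \<le> \<integral> |\<nabla> v|\<^sup>2\<close> for the
  frequencies above \<open>N\<close>, is an inequality of Nash type (\<open>nash\<close>). Applied to the dyadic truncations of a
  function it self-improves to the first order Sobolev inequality with exponent \<open>2n/(n-2)\<close>
  (\<open>sobolev_positive_part\<close>). Finally one tests \<open>\<Delta> u\<close> against \<open>u |u|\<^bsup>2\<gamma>\<^esup>\<close>, \<open>\<gamma> = 2/(n-4)\<close>, and applies that
  inequality to \<open>u |u|\<^bsup>\<gamma>\<^esup>\<close>: this is Moser's way to pass to the second order inequality without estimating second derivatives
  (\<open>critical_sobolev_real\<close>).

  The geometry enters only through Green's formula \<open>\<integral> f \<Delta> \<phi> dV = - \<integral> \<langle>\<nabla> f, \<nabla> \<phi>\<rangle> dV\<close>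
  (theorem \<open>green\<close>), for which \<open>f\<close> need only be continuously differentiable; that is what truncations and powers
  require. The frequencies are either bounded, in which case all conditions hold trivially
  (\<open>bounded_frequencies\<close>), or tend to infinity, in which case every window meets finitely many of them and all projections are
  finite sums.
\<close>

section \<open>Lebesgue norms\<close>

text \<open>Minkowski, scaling, Fatou and Hoelder are all used to prove upper bounds by real numbers, so it suffices to know when
  the norm is at most \<open>a\<close>; this avoids roots of integrals that may be infinite.\<close>

lemma Lp_norm_le_iff:
  assumes "0 < q" "0 \<le> a"
  shows "Lp_norm M (ereal q) f \<le> ennreal a \<longleftrightarrow>
    (\<integral>\<^sup>+x. ennreal (norm (f x) powr q) \<partial>M) \<le> ennreal (a powr q)"
proof (cases "(\<integral>\<^sup>+x. ennreal (norm (f x) powr q) \<partial>M)")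
  case (real r)
  have "r powr (1 / q) \<le> a \<longleftrightarrow> r \<le> a powr q"
  proof
    assume "r powr (1/q) \<le> a"
    then have "(r powr (1/q)) powr q \<le> a powr q" using assms by (intro powr_mono2) auto
    then show "r \<le> a powr q" using assms real by (simp add: powr_powr)
  next
    assume "r \<le> a powr q"
    then have "r powr (1/q) \<le> (a powr q) powr (1/q)" using assms real by (intro powr_mono2) auto
    then show "r powr (1/q) \<le> a" using assms by (simp add: powr_powr)
  qed
  then show ?thesis using assms real by (simp add: Lp_norm_def Let_def ennreal_le_iff)
next
  case top
  then show ?thesis by (simp add: Lp_norm_def Let_def top_unique)
qed

lemma Lp_norm_infinity_le_iff:
  assumes "f \<in> borel_measurable M"
  shows "Lp_norm M \<infinity> f \<le> c \<longleftrightarrow> (AE x in M. ennreal (norm (f x)) \<le> c)"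
proof
  have m: "(\<lambda>x. ennreal (norm (f x))) \<in> borel_measurable M" using assms by measurable
  show "AE x in M. ennreal (norm (f x)) \<le> c" if "Lp_norm M \<infinity> f \<le> c"
    using esssup_AE[where M = M and f = "\<lambda>x. ennreal (norm (f x))"] that
    unfolding Lp_norm_def by (auto elim: eventually_mono)
  show "Lp_norm M \<infinity> f \<le> c" if "AE x in M. ennreal (norm (f x)) \<le> c"
    unfolding Lp_norm_def using esssup_I[OF m that] by simp
qed

lemma Lp_norm_cong_AE:
  assumes "f \<in> borel_measurable M" "h \<in> borel_measurable M" "AE x in M. f x = h x"
  shows "Lp_norm M p f = Lp_norm M p h"
proof -
  have "esssup M (\<lambda>x. ennreal (norm (f x))) = esssup M (\<lambda>x. ennreal (norm (h x)))"
    using assms by (intro esssup_AE_cong) auto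
  moreover have "(\<integral>\<^sup>+x. ennreal (norm (f x) powr q) \<partial>M) = (\<integral>\<^sup>+x. ennreal (norm (h x) powr q) \<partial>M)" for q
    using assms(3) by (intro nn_integral_cong_AE) auto
  ultimately show ?thesis by (simp add: Lp_norm_def)
qed

lemma ereal_exponent_cases:
  assumes "(1::ereal) \<le> p"
  obtains (real) q where "p = ereal q" "1 \<le> q" | (infinite) "p = \<infinity>"
  using assms by (cases p) (auto simp: one_ereal_def)

text \<open>Convexity of \<open>t powr q\<close>, in the form in which it yields the triangle inequality: \<open>(x + y) / (a + b)\<close> is a
  convex combination of \<open>x / a\<close> and \<open>y / b\<close>.\<close>

lemma powr_mean_le:
  fixes x y a b q :: real
  assumes "0 \<le> x" "0 \<le> y" "0 < a" "0 < b" "1 \<le> q"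
  shows "((x + y) / (a + b)) powr q \<le> a / (a + b) * (x / a) powr q + b / (a + b) * (y / b) powr q"
proof -
  have shrink: "(t * z) powr q \<le> t * z powr q" if "0 \<le> t" "t \<le> 1" "0 \<le> z" for t z :: real
  proof -
    have "t powr q \<le> t powr 1"
      using that assms by (cases "t = 0") (auto intro: powr_mono'[of 1 q t, simplified])
    then show ?thesis using that by (auto simp: powr_mult intro: mult_right_mono)
  qed
  consider "x = 0" | "y = 0" | "0 < x" "0 < y" using assms by fastforce
  then show ?thesis
  proof cases
    case 1
    then show ?thesis using shrink[of "b/(a+b)" "y/b"] assms by (simp add: field_simps)
  next
    case 2
    then show ?thesis using shrink[of "a/(a+b)" "x/a"] assms by (simp add: field_simps)
  next
    case 3
    have "(a/(a+b)) *\<^sub>R (x/a) + (b/(a+b)) *\<^sub>R (y/b) = (x+y)/(a+b)"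
      using assms by (simp add: add_divide_distrib)
    moreover have "a/(a+b) + b/(a+b) = 1" using assms by (simp flip: add_divide_distrib)
    ultimately show ?thesis
      using powr_convex[OF assms(5)] 3 assms unfolding convex_on_def
      by (metis divide_nonneg_nonneg divide_pos_pos greaterThan_iff less_eq_real_def add_nonneg_nonneg)
  qed
qed

text \<open>Dividing by the bounds \<open>a\<close> and \<open>b\<close> makes both summands unit vectors, and \<open>powr_mean_le\<close> expresses that the unit
  ball is convex. The bounds are positive so that one can divide; norms that vanish are reached by letting
  the bounds decrease.\<close>

lemma Lp_norm_add_le:
  assumes "1 \<le> p" and [measurable]: "f \<in> borel_measurable M" "h \<in> borel_measurable M"
    and "Lp_norm M p f \<le> ennreal a" "Lp_norm M p h \<le> ennreal b" "0 < a" "0 < b"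
  shows "Lp_norm M p (\<lambda>x. f x + h x) \<le> ennreal (a + b)"
  using assms(1)
proof (cases rule: ereal_exponent_cases)
  case (real q)
  have F: "(\<integral>\<^sup>+x. ennreal (norm (f x) powr q) \<partial>M) \<le> ennreal (a powr q)"
    and G: "(\<integral>\<^sup>+x. ennreal (norm (h x) powr q) \<partial>M) \<le> ennreal (b powr q)"
    using assms real by (simp_all add: Lp_norm_le_iff)
  define \<alpha> \<beta> where "\<alpha> = (a+b) powr q * (a/(a+b)) / a powr q"
    and "\<beta> = (a+b) powr q * (b/(a+b)) / b powr q"
  have pos: "0 \<le> \<alpha>" "0 \<le> \<beta>" using assms by (auto simp: \<alpha>_def \<beta>_def)
  have pt: "norm (f x + h x) powr q \<le> \<alpha> * norm (f x) powr q + \<beta> * norm (h x) powr q" for x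
  proof -
    have "norm (f x + h x) powr q \<le> (norm (f x) + norm (h x)) powr q"
      using real by (intro powr_mono2 norm_triangle_ineq) auto
    also have "\<dots> = (a+b) powr q * ((norm (f x) + norm (h x)) / (a + b)) powr q"
      using assms by (simp add: powr_divide)
    also have "\<dots> \<le> (a+b) powr q * (a / (a + b) * (norm (f x) / a) powr q + b / (a + b) * (norm (h x) / b) powr q)"
      using assms real by (intro mult_left_mono powr_mean_le) auto
    also have "\<dots> = \<alpha> * norm (f x) powr q + \<beta> * norm (h x) powr q"
      using assms by (simp add: powr_divide \<alpha>_def \<beta>_def algebra_simps)
    finally show ?thesis .
  qed
  have "(\<integral>\<^sup>+x. ennreal (norm (f x + h x) powr q) \<partial>M)
      \<le> (\<integral>\<^sup>+x. ennreal \<alpha> * ennreal (norm (f x) powr q) + ennreal \<beta> * ennreal (norm (h x) powr q) \<partial>M)"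
    using pt pos by (intro nn_integral_mono) (simp flip: ennreal_mult ennreal_plus)
  also have "\<dots> = ennreal \<alpha> * (\<integral>\<^sup>+x. ennreal (norm (f x) powr q) \<partial>M)
      + ennreal \<beta> * (\<integral>\<^sup>+x. ennreal (norm (h x) powr q) \<partial>M)"
    by (simp add: nn_integral_add nn_integral_cmult)
  also have "\<dots> \<le> ennreal \<alpha> * ennreal (a powr q) + ennreal \<beta> * ennreal (b powr q)"
    using F G by (intro add_mono mult_left_mono) auto
  also have "\<dots> = ennreal (\<alpha> * a powr q + \<beta> * b powr q)"
    using pos by (simp flip: ennreal_mult ennreal_plus)
  also have "\<alpha> * a powr q + \<beta> * b powr q = (a+b) powr q"
  proof -
    have "\<alpha> * a powr q = (a+b) powr q * (a/(a+b))" "\<beta> * b powr q = (a+b) powr q * (b/(a+b))"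
      using assms by (simp_all add: \<alpha>_def \<beta>_def)
    moreover have "a/(a+b) + b/(a+b) = 1" using assms by (simp flip: add_divide_distrib)
    ultimately show ?thesis by (metis distrib_left mult.right_neutral)
  qed
  finally show ?thesis using assms real by (simp add: Lp_norm_le_iff del: ennreal_plus)
next
  case infinite
  then have "AE x in M. ennreal (norm (f x)) \<le> ennreal a" "AE x in M. ennreal (norm (h x)) \<le> ennreal b"
    using assms by (auto simp: Lp_norm_infinity_le_iff)
  then have "AE x in M. ennreal (norm (f x + h x)) \<le> ennreal (a + b)"
  proof eventually_elim
    case (elim x)
    then have "norm (f x) \<le> a" "norm (h x) \<le> b" using assms by auto
    then show ?case by (intro ennreal_leI norm_triangle_le) auto
  qed
  then show ?thesis using infinite by (simp add: Lp_norm_infinity_le_iff)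
qed

lemma Lp_norm_triangle:
  assumes "1 \<le> p" "f \<in> borel_measurable M" "h \<in> borel_measurable M"
  shows "Lp_norm M p (\<lambda>x. f x + h x) \<le> Lp_norm M p f + Lp_norm M p h"
proof (rule ennreal_le_epsilon)
  fix \<epsilon> :: real assume fin: "Lp_norm M p f + Lp_norm M p h < top" and "0 < \<epsilon>"
  then obtain a b where ab: "Lp_norm M p f = ennreal a" "0 \<le> a" "Lp_norm M p h = ennreal b" "0 \<le> b"
    by (metis ennreal_cases ennreal_add_eq_top less_top)
  have "Lp_norm M p (\<lambda>x. f x + h x) \<le> ennreal ((a + \<epsilon>/2) + (b + \<epsilon>/2))"
    using ab \<open>0 < \<epsilon>\<close> assms by (intro Lp_norm_add_le) (auto intro: ennreal_leI)
  also have "\<dots> = Lp_norm M p f + Lp_norm M p h + ennreal \<epsilon>"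
    using ab \<open>0 < \<epsilon>\<close> by (simp flip: ennreal_plus add: add_ac)
  finally show "Lp_norm M p (\<lambda>x. f x + h x) \<le> Lp_norm M p f + Lp_norm M p h + ennreal \<epsilon>" .
qed

lemma Lp_norm_zero [simp]: "1 \<le> p \<Longrightarrow> Lp_norm M p (\<lambda>x. 0) = 0"
  using Lp_norm_le_iff[of _ 0 M "\<lambda>x. 0"] Lp_norm_infinity_le_iff[of "\<lambda>x. 0" M 0]
  by (auto elim!: ereal_exponent_cases)

lemma Lp_norm_sum_le:
  assumes "1 \<le> p" "finite K" "\<And>k. k \<in> K \<Longrightarrow> f k \<in> borel_measurable M"
  shows "Lp_norm M p (\<lambda>x. \<Sum>k\<in>K. f k x) \<le> (\<Sum>k\<in>K. Lp_norm M p (f k))"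
  using assms(2,3)
proof (induction K)
  case (insert k K)
  have "Lp_norm M p (\<lambda>x. f k x + (\<Sum>k\<in>K. f k x)) \<le> Lp_norm M p (f k) + Lp_norm M p (\<lambda>x. \<Sum>k\<in>K. f k x)"
    using insert assms(1) by (intro Lp_norm_triangle borel_measurable_sum) auto
  also have "\<dots> \<le> Lp_norm M p (f k) + (\<Sum>k\<in>K. Lp_norm M p (f k))"
    using insert by (intro add_left_mono) auto
  finally show ?case using insert by simp
qed (use assms(1) in simp)

lemma Lp_norm_cmult_le:
  assumes "1 \<le> p" and f[measurable]: "f \<in> borel_measurable M"
    and a: "Lp_norm M p f \<le> ennreal a" "0 \<le> a"
  shows "Lp_norm M p (\<lambda>x. c * f x) \<le> ennreal (norm c * a)"
  using assms(1)
proof (cases rule: ereal_exponent_cases)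
  case (real q)
  have "(\<integral>\<^sup>+x. ennreal (norm (c * f x) powr q) \<partial>M) =
      (\<integral>\<^sup>+x. ennreal (norm c powr q) * ennreal (norm (f x) powr q) \<partial>M)"
    by (simp add: norm_mult powr_mult flip: ennreal_mult)
  also have "\<dots> = ennreal (norm c powr q) * (\<integral>\<^sup>+x. ennreal (norm (f x) powr q) \<partial>M)"
    by (simp add: nn_integral_cmult)
  also have "\<dots> \<le> ennreal (norm c powr q) * ennreal (a powr q)"
    using a real by (intro mult_left_mono) (simp_all add: Lp_norm_le_iff)
  also have "\<dots> = ennreal ((norm c * a) powr q)"
    using a by (simp add: powr_mult flip: ennreal_mult)
  finally show ?thesis using a real by (simp add: Lp_norm_le_iff)
next
  case infinite
  have "AE x in M. ennreal (norm (f x)) \<le> ennreal a"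
    using a infinite by (simp add: Lp_norm_infinity_le_iff)
  then have "AE x in M. ennreal (norm (c * f x)) \<le> ennreal (norm c * a)"
    by eventually_elim (use a in \<open>auto simp: norm_mult intro!: mult_left_mono\<close>)
  then show ?thesis using infinite by (simp add: Lp_norm_infinity_le_iff)
qed

lemma Lp_norm_bounded:
  assumes "finite_measure M" "1 \<le> p" and f: "f \<in> borel_measurable M" and "\<And>x. norm (f x) \<le> C"
  shows "Lp_norm M p f < \<infinity>"
  using assms(2)
proof (cases rule: ereal_exponent_cases)
  case (real q)
  interpret finite_measure M by fact
  have "(\<integral>\<^sup>+x. ennreal (norm (f x) powr q) \<partial>M) \<le> (\<integral>\<^sup>+x. ennreal (C powr q) \<partial>M)"
    using assms(4) real by (intro nn_integral_mono ennreal_leI powr_mono2) auto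
  also have "\<dots> < \<infinity>" by (simp add: ennreal_mult_less_top emeasure_eq_measure)
  finally show ?thesis using real by (auto simp: Lp_norm_def Let_def)
next
  case infinite
  have "Lp_norm M p f \<le> ennreal C"
    using assms(4) infinite f by (auto simp: Lp_norm_infinity_le_iff intro!: ennreal_leI)
  then show ?thesis by (simp add: order_le_less_trans)
qed

text \<open>For finite exponents this is Fatou's lemma; for the essential supremum the countably many exceptional null sets are
  discarded together.\<close>

lemma Lp_norm_le_of_AE_limit:
  assumes "1 \<le> p" and [measurable]: "\<And>k. f k \<in> borel_measurable M" "h \<in> borel_measurable M"
    and lim: "AE x in M. (\<lambda>k. f k x) \<longlonglongrightarrow> h x"
    and bd: "\<And>k. Lp_norm M p (f k) \<le> ennreal a" and "0 \<le> a"
  shows "Lp_norm M p h \<le> ennreal a"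
  using assms(1)
proof (cases rule: ereal_exponent_cases)
  case (real q)
  have "(\<integral>\<^sup>+x. ennreal (norm (h x) powr q) \<partial>M) = (\<integral>\<^sup>+x. liminf (\<lambda>k. ennreal (norm (f k x) powr q)) \<partial>M)"
  proof (rule nn_integral_cong_AE)
    show "AE x in M. ennreal (norm (h x) powr q) = liminf (\<lambda>k. ennreal (norm (f k x) powr q))"
      using lim
    proof eventually_elim
      case (elim x)
      have "(\<lambda>k. ennreal (norm (f k x) powr q)) \<longlonglongrightarrow> ennreal (norm (h x) powr q)"
        using real elim by (intro tendsto_ennrealI tendsto_powr2 tendsto_norm tendsto_const) auto
      then show ?case by (metis lim_imp_Liminf sequentially_bot)
    qed
  qed
  also have "\<dots> \<le> liminf (\<lambda>k. \<integral>\<^sup>+x. ennreal (norm (f k x) powr q) \<partial>M)"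
    by (rule nn_integral_liminf) auto
  also have "\<dots> \<le> limsup (\<lambda>k. \<integral>\<^sup>+x. ennreal (norm (f k x) powr q) \<partial>M)"
    by (rule Liminf_le_Limsup) auto
  also have "\<dots> \<le> ennreal (a powr q)"
    using bd \<open>0 \<le> a\<close> real by (intro Limsup_bounded) (auto simp: Lp_norm_le_iff)
  finally show ?thesis using \<open>0 \<le> a\<close> real by (simp add: Lp_norm_le_iff)
next
  case infinite
  have "AE x in M. \<forall>k. ennreal (norm (f k x)) \<le> ennreal a"
    unfolding AE_all_countable using bd infinite by (simp add: Lp_norm_infinity_le_iff)
  then have "AE x in M. ennreal (norm (h x)) \<le> ennreal a"
    using lim
  proof eventually_elim
    case (elim x)
    then have "norm (h x) \<le> a"
      using \<open>0 \<le> a\<close> by (intro Lim_norm_ubound[OF _ elim(2)]) auto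
    then show ?case by (rule ennreal_leI)
  qed
  then show ?thesis using infinite by (simp add: Lp_norm_infinity_le_iff)
qed

text \<open>Hoelder's inequality against the indicator of \<open>S\<close>. With \<open>s\<close> the level at which a constant function on \<open>S\<close> has norm
  \<open>a\<close>, Young's inequality bounds \<open>|f| / s\<close> by \<open>1 / q' + (|f| / s)\<^bsup>q\<^esup> / q\<close>, whose integral over \<open>S\<close> is at most the volume of \<open>S\<close>.\<close>

lemma set_nn_integral_le_Lp_norm:
  assumes "finite_measure M" "1 < q" and [measurable]: "f \<in> borel_measurable M" "S \<in> sets M"
    and f: "Lp_norm M (ereal q) f \<le> ennreal a" and "0 < a"
  shows "(\<integral>\<^sup>+x\<in>S. ennreal (norm (f x)) \<partial>M) \<le> ennreal (a * measure M S powr (1 - 1/q))"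
proof -
  interpret finite_measure M by fact
  define m where "m = measure M S"
  show ?thesis
  proof (cases "m = 0")
    case True
    then have "AE x in M. x \<notin> S" by (auto simp: m_def emeasure_eq_measure AE_iff_null null_setsI Int_def[symmetric] intro!: AE_not_in)
    then have "(\<integral>\<^sup>+x\<in>S. ennreal (norm (f x)) \<partial>M) = (\<integral>\<^sup>+x. 0 \<partial>M)"
      by (intro nn_integral_cong_AE) (auto simp: indicator_def elim: eventually_mono)
    then show ?thesis by simp
  next
    case False
    then have "0 < m" by (simp add: m_def zero_less_measure_iff order_less_le)
    define s where "s = a * m powr (- (1/q))"
    have s: "0 < s" using \<open>0 < m\<close> \<open>0 < a\<close> by (simp add: s_def)
    define q' where "q' = q / (q - 1)"
    have q': "1 < q'" "1/q + 1/q' = 1" using \<open>1 < q\<close> by (auto simp: q'_def field_simps)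
    have pt: "norm z \<le> s / q' + s / (q * s powr q) * norm z powr q" for z :: complex
    proof -
      have "norm z / s * 1 \<le> (norm z / s) powr q / q + 1 powr q' / q'"
        using q' s \<open>1 < q\<close> by (intro Youngs_inequality) auto
      then have "norm z \<le> s * ((norm z / s) powr q / q + 1 / q')"
        using s by (simp add: field_simps)
      then show ?thesis using s by (simp add: powr_divide field_simps)
    qed
    have "(\<integral>\<^sup>+x\<in>S. ennreal (norm (f x)) \<partial>M) \<le>
       (\<integral>\<^sup>+x. ennreal (s / q') * indicator S x + ennreal (s / (q * s powr q)) * ennreal (norm (f x) powr q) \<partial>M)"
      using pt s q' \<open>1 < q\<close>
      by (intro nn_integral_mono) (auto simp: indicator_def simp flip: ennreal_mult ennreal_plus)
    also have "\<dots> = ennreal (s / q') * emeasure M S + ennreal (s / (q * s powr q)) * (\<integral>\<^sup>+x. ennreal (norm (f x) powr q) \<partial>M)"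
      by (simp add: nn_integral_add nn_integral_cmult)
    also have "\<dots> \<le> ennreal (s / q') * ennreal m + ennreal (s / (q * s powr q)) * ennreal (a powr q)"
      using f \<open>0 < a\<close> \<open>1 < q\<close>
      by (intro add_mono mult_left_mono) (auto simp: Lp_norm_le_iff m_def emeasure_eq_measure)
    also have "\<dots> = ennreal (s / q' * m + s / (q * s powr q) * a powr q)"
      using s q' \<open>1 < q\<close> \<open>0 < m\<close> by (simp flip: ennreal_mult ennreal_plus)
    also have "s / q' * m + s / (q * s powr q) * a powr q = a * m powr (1 - 1/q)"
    proof -
      have "(m powr (- (1/q))) powr q = m powr (- 1)"
        using \<open>1 < q\<close> by (simp add: powr_powr)
      moreover have "s powr q = a powr q * (m powr (- (1/q))) powr q"
        unfolding s_def using \<open>0 < m\<close> \<open>0 < a\<close> by (intro powr_mult)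
      ultimately have "s powr q = a powr q / m"
        using \<open>0 < m\<close> by (simp only: powr_minus_divide) simp
      then have "s / (q * s powr q) * a powr q = s * m / q"
        using \<open>0 < a\<close> \<open>0 < m\<close> by simp
      moreover have "s / q' * m + s * m / q = s * m * (1/q + 1/q')"
        by (simp add: field_simps)
      moreover have "s * m = a * m powr (1 - 1/q)"
        using \<open>0 < m\<close> by (simp add: s_def powr_diff powr_minus field_simps)
      ultimately show ?thesis using q' by simp
    qed
    finally show ?thesis by (simp add: m_def)
  qed
qed

section \<open>Square integrable functions\<close>

lemma Lp_norm_2:
  assumes "f \<in> L2_space M"
  shows "Lp_norm M 2 f = ennreal (sqrt (\<integral>x. (norm (f x))\<^sup>2 \<partial>M))"
proof -
  have "(2::ereal) = ereal 2" by simp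
  have "(\<integral>\<^sup>+x. ennreal (norm (f x) powr 2) \<partial>M) = ennreal (\<integral>x. (norm (f x))\<^sup>2 \<partial>M)"
    using assms by (simp add: L2_space_def nn_integral_eq_integral)
  then show ?thesis
    unfolding Lp_norm_def by (simp add: Let_def powr_half_sqrt)
qed

lemma L2_borel [measurable_dest]: "f \<in> L2_space M \<Longrightarrow> f \<in> borel_measurable M"
  by (simp add: L2_space_def)

lemma L2_integrable_power2: "f \<in> L2_space M \<Longrightarrow> integrable M (\<lambda>x. (norm (f x))\<^sup>2)"
  by (simp add: L2_space_def)

lemma L2_spaceI_bound:
  assumes "f \<in> borel_measurable M" "integrable M k" "\<And>x. (norm (f x))\<^sup>2 \<le> k x"
  shows "f \<in> L2_space M"
  unfolding L2_space_def
proof (intro CollectI conjI assms(1))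
  show "integrable M (\<lambda>x. (norm (f x))\<^sup>2)"
    using assms by (intro Bochner_Integration.integrable_bound[OF assms(2)])
      (auto intro!: AE_I2 order_trans[OF _ abs_ge_self])
qed

lemma L2_add: "f \<in> L2_space M \<Longrightarrow> h \<in> L2_space M \<Longrightarrow> (\<lambda>x. f x + h x) \<in> L2_space M"
proof (rule L2_spaceI_bound[where k = "\<lambda>x. 2 * (norm (f x))\<^sup>2 + 2 * (norm (h x))\<^sup>2"])
  fix x
  have "(norm (f x + h x))\<^sup>2 \<le> (norm (f x) + norm (h x))\<^sup>2"
    by (intro power_mono norm_triangle_ineq) auto
  also have "\<dots> \<le> 2 * (norm (f x))\<^sup>2 + 2 * (norm (h x))\<^sup>2"
    using sum_squares_bound[of "norm (f x)" "norm (h x)"] by (simp add: power2_sum)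
  finally show "(norm (f x + h x))\<^sup>2 \<le> 2 * (norm (f x))\<^sup>2 + 2 * (norm (h x))\<^sup>2" .
qed (auto simp: L2_space_def)

lemma L2_cmult: "f \<in> L2_space M \<Longrightarrow> (\<lambda>x. c * f x) \<in> L2_space M"
  by (rule L2_spaceI_bound[where k = "\<lambda>x. (norm c)\<^sup>2 * (norm (f x))\<^sup>2"])
     (auto simp: L2_space_def norm_mult power_mult_distrib)

lemma L2_cnj: "f \<in> L2_space M \<Longrightarrow> (\<lambda>x. cnj (f x)) \<in> L2_space M"
  by (rule L2_spaceI_bound[where k = "\<lambda>x. (norm (f x))\<^sup>2"])
     (auto simp: L2_space_def intro: borel_measurable_continuous_on[where f = cnj] continuous_intros)

lemma L2_diff: "f \<in> L2_space M \<Longrightarrow> h \<in> L2_space M \<Longrightarrow> (\<lambda>x. f x - h x) \<in> L2_space M"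
  using L2_add[OF _ L2_cmult[of h M "-1"], of f] by simp

lemma L2_zero [simp]: "(\<lambda>x. 0) \<in> L2_space M" by (simp add: L2_space_def)

lemma L2_sum: "(\<And>k. k \<in> K \<Longrightarrow> f k \<in> L2_space M) \<Longrightarrow> (\<lambda>x. \<Sum>k\<in>K. f k x) \<in> L2_space M"
  by (induction K rule: infinite_finite_induct) (auto intro: L2_add)

lemma L2_mult_integrable:
  assumes "f \<in> L2_space M" "h \<in> L2_space M"
  shows "integrable M (\<lambda>x. f x * h x)"
proof (rule Bochner_Integration.integrable_bound[where f = "\<lambda>x. (norm (f x))\<^sup>2 + (norm (h x))\<^sup>2"])
  show "AE x in M. norm (f x * h x) \<le> norm ((norm (f x))\<^sup>2 + (norm (h x))\<^sup>2)"
  proof (intro AE_I2)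
    fix x
    have "2 * (norm (f x) * norm (h x)) \<le> (norm (f x))\<^sup>2 + (norm (h x))\<^sup>2"
      using sum_squares_bound[of "norm (f x)" "norm (h x)"] by (simp add: mult.assoc)
    moreover have "0 \<le> norm (f x) * norm (h x)" by simp
    ultimately show "norm (f x * h x) \<le> norm ((norm (f x))\<^sup>2 + (norm (h x))\<^sup>2)"
      unfolding norm_mult real_norm_def by linarith
  qed
  show "integrable M (\<lambda>x. (norm (f x))\<^sup>2 + (norm (h x))\<^sup>2)"
    using assms by (auto simp: L2_space_def)
  show "(\<lambda>x. f x * h x) \<in> borel_measurable M" using assms by (auto simp: L2_space_def)
qed

lemma L2_inner_add_left:
  "f \<in> L2_space M \<Longrightarrow> h \<in> L2_space M \<Longrightarrow> k \<in> L2_space M \<Longrightarrow>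
   L2_inner M (\<lambda>x. f x + h x) k = L2_inner M f k + L2_inner M h k"
  unfolding L2_inner_def
  by (simp add: distrib_right Bochner_Integration.integral_add L2_mult_integrable L2_cnj)

lemma L2_inner_cmult_left: "L2_inner M (\<lambda>x. c * f x) k = c * L2_inner M f k"
  unfolding L2_inner_def by (simp add: mult.assoc)

lemma L2_inner_commute: "L2_inner M f h = cnj (L2_inner M h f)"
  unfolding L2_inner_def by (simp add: mult.commute flip: Bochner_Integration.integral_cnj)

lemma L2_inner_zero_left [simp]: "L2_inner M (\<lambda>x. 0) k = 0" by (simp add: L2_inner_def)

lemma L2_inner_sum_left:
  assumes "\<And>j. j \<in> K \<Longrightarrow> f j \<in> L2_space M" "k \<in> L2_space M"
  shows "L2_inner M (\<lambda>x. \<Sum>j\<in>K. f j x) k = (\<Sum>j\<in>K. L2_inner M (f j) k)"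
  using assms(1)
  by (induction K rule: infinite_finite_induct) (auto simp: L2_inner_add_left L2_sum assms(2))

lemma L2_inner_diff_left:
  assumes "f \<in> L2_space M" "h \<in> L2_space M" "k \<in> L2_space M"
  shows "L2_inner M (\<lambda>x. f x - h x) k = L2_inner M f k - L2_inner M h k"
  using L2_inner_add_left[OF assms(1) L2_cmult[OF assms(2), of "-1"] assms(3)] L2_inner_cmult_left[of M "-1" h k]
  by simp

lemma L2_inner_self: "L2_inner M f f = of_real (\<integral>x. (norm (f x))\<^sup>2 \<partial>M)"
  unfolding L2_inner_def by (simp add: complex_norm_square[symmetric] del: of_real_power)

lemma Lp_norm_2_tendsto_0_iff:
  assumes "\<And>k. f k \<in> L2_space M"
  shows "(\<lambda>k. Lp_norm M 2 (f k)) \<longlonglongrightarrow> 0 \<longleftrightarrow> (\<lambda>k. \<integral>x. (norm (f k x))\<^sup>2 \<partial>M) \<longlonglongrightarrow> 0"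
proof -
  have "(\<lambda>k. Lp_norm M 2 (f k)) \<longlonglongrightarrow> 0 \<longleftrightarrow> (\<lambda>k. sqrt (\<integral>x. (norm (f k x))\<^sup>2 \<partial>M)) \<longlonglongrightarrow> 0"
    unfolding Lp_norm_2[OF assms]
    using tendsto_ennreal_iff[of "\<lambda>k. sqrt (\<integral>x. (norm (f k x))\<^sup>2 \<partial>M)" sequentially 0]
    by simp
  also have "\<dots> \<longleftrightarrow> (\<lambda>k. \<integral>x. (norm (f k x))\<^sup>2 \<partial>M) \<longlonglongrightarrow> 0"
  proof
    assume "(\<lambda>k. sqrt (\<integral>x. (norm (f k x))\<^sup>2 \<partial>M)) \<longlonglongrightarrow> 0"
    from tendsto_power[OF this, of 2] show "(\<lambda>k. \<integral>x. (norm (f k x))\<^sup>2 \<partial>M) \<longlonglongrightarrow> 0" by simp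
  qed (use tendsto_real_sqrt in force)
  finally show ?thesis .
qed

text \<open>A bound for partial sums of an eigenfunction expansion passes to the function, since a subsequence converges
  almost everywhere.\<close>

lemma Lp_norm_le_of_L2_limit:
  assumes "1 \<le> p" "\<And>k. f k \<in> L2_space M" "h \<in> L2_space M"
    and "(\<lambda>k. Lp_norm M 2 (\<lambda>x. h x - f k x)) \<longlonglongrightarrow> 0"
    and "\<And>k. Lp_norm M p (f k) \<le> ennreal a" "0 \<le> a"
  shows "Lp_norm M p h \<le> ennreal a"
proof -
  have "(\<lambda>k. \<integral>x. norm ((norm (h x - f k x))\<^sup>2) \<partial>M) \<longlonglongrightarrow> 0"
    using iffD1[OF Lp_norm_2_tendsto_0_iff assms(4)] assms(2,3) by (simp add: L2_diff)
  then obtain r :: "nat \<Rightarrow> nat" where "AE x in M. (\<lambda>k. (norm (h x - f (r k) x))\<^sup>2) \<longlonglongrightarrow> 0"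
    using tendsto_L1_AE_subseq[of M "\<lambda>k x. (norm (h x - f k x))\<^sup>2",
        OF L2_integrable_power2[OF L2_diff[OF assms(3,2)]]] by blast
  then have "AE x in M. (\<lambda>k. f (r k) x) \<longlonglongrightarrow> h x"
  proof eventually_elim
    case (elim x)
    have "(\<lambda>k. norm (h x - f (r k) x)) \<longlonglongrightarrow> 0"
      using tendsto_real_sqrt[OF elim] by simp
    then have "(\<lambda>k. h x - f (r k) x) \<longlonglongrightarrow> 0" by (rule tendsto_norm_zero_cancel)
    then have "(\<lambda>k. h x - (h x - f (r k) x)) \<longlonglongrightarrow> h x - 0" by (intro tendsto_diff tendsto_const)
    then show ?case by simp
  qed
  then show ?thesis
    by (rule Lp_norm_le_of_AE_limit[OF assms(1) L2_borel[OF assms(2)] L2_borel[OF assms(3)] _ assms(5,6)])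
qed

section \<open>Continuously differentiable functions\<close>

text \<open>Unlike \<open>Ck_on (Suc 0)\<close> this is not tied to coordinates, so the closure properties and the chain rule can be proved
  for arbitrary normed spaces; \<open>Ck_on_1_imp_C1_on\<close> connects the two on open subsets of \<open>real^'n\<close>.\<close>

definition C1_on :: "('a::real_normed_vector \<Rightarrow> 'b::real_normed_vector) \<Rightarrow> 'a set \<Rightarrow> bool" where
  "C1_on f S \<longleftrightarrow>
     (\<exists>f'. (\<forall>x\<in>S. (f has_derivative f' x) (at x)) \<and> (\<forall>h. continuous_on S (\<lambda>x. f' x h)))"

lemma C1_onI:
  "(\<And>x. x \<in> S \<Longrightarrow> (f has_derivative f' x) (at x)) \<Longrightarrow> (\<And>h. continuous_on S (\<lambda>x. f' x h)) \<Longrightarrow> C1_on f S"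
  unfolding C1_on_def by blast

lemma C1_on_has_derivative:
  "C1_on f S \<Longrightarrow> x \<in> S \<Longrightarrow> (f has_derivative frechet_derivative f (at x)) (at x)"
  unfolding C1_on_def using differentiableI frechet_derivative_works by blast

lemma C1_on_differentiable: "C1_on f S \<Longrightarrow> x \<in> S \<Longrightarrow> f differentiable (at x)"
  using C1_on_has_derivative differentiableI by blast

lemma C1_on_continuous_derivative:
  "C1_on f S \<Longrightarrow> continuous_on S (\<lambda>x. frechet_derivative f (at x) h)"
proof -
  assume "C1_on f S"
  then obtain f' where f': "\<And>x. x \<in> S \<Longrightarrow> (f has_derivative f' x) (at x)" "\<And>h. continuous_on S (\<lambda>x. f' x h)"
    unfolding C1_on_def by blast
  have "continuous_on S (\<lambda>x. frechet_derivative f (at x) h) \<longleftrightarrow> continuous_on S (\<lambda>x. f' x h)"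
    by (rule continuous_on_cong[OF refl]) (simp add: frechet_derivative_at[OF f'(1), symmetric])
  then show ?thesis using f'(2) by simp
qed

lemma C1_on_continuous: "C1_on f S \<Longrightarrow> continuous_on S f"
  by (rule has_derivative_continuous_on[of _ _ "\<lambda>x. frechet_derivative f (at x)"])
     (blast intro: has_derivative_at_withinI C1_on_has_derivative)

lemma C1_on_cong:
  assumes "C1_on f S" "open S" "\<And>x. x \<in> S \<Longrightarrow> f x = k x"
  shows "C1_on k S"
  using has_derivative_transform_within_open[OF C1_on_has_derivative[OF assms(1)] assms(2)] assms(3)
  by (intro C1_onI[of S k "\<lambda>x. frechet_derivative f (at x)"] C1_on_continuous_derivative[OF assms(1)]) blast

lemma C1_on_Un:
  assumes "C1_on f S" "C1_on f T" "open S" "open T"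
  shows "C1_on f (S \<union> T)"
  by (rule C1_onI[of _ _ "\<lambda>x. frechet_derivative f (at x)"])
     (use assms in \<open>blast intro: continuous_on_open_Un C1_on_has_derivative C1_on_continuous_derivative\<close>)+

lemma C1_on_const [simp]: "C1_on (\<lambda>x. c) S"
  by (rule C1_onI[of _ _ "\<lambda>x h. 0"]) auto

lemma C1_on_bounded_linear:
  assumes "bounded_linear L" "C1_on f S"
  shows "C1_on (\<lambda>x. L (f x)) S"
proof (rule C1_onI)
  show "((\<lambda>x. L (f x)) has_derivative (\<lambda>h. L (frechet_derivative f (at x) h))) (at x)" if "x \<in> S" for x
    by (rule bounded_linear.has_derivative[OF assms(1) C1_on_has_derivative[OF assms(2) that]])
  show "continuous_on S (\<lambda>x. L (frechet_derivative f (at x) h))" for h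
    by (rule bounded_linear.continuous_on[OF assms(1) C1_on_continuous_derivative[OF assms(2)]])
qed

lemma C1_on_bilinear:
  assumes "bounded_bilinear B" "C1_on f S" "C1_on k S"
  shows "C1_on (\<lambda>x. B (f x) (k x)) S"
proof (rule C1_onI)
  interpret bounded_bilinear B by fact
  show "((\<lambda>x. B (f x) (k x)) has_derivative
      (\<lambda>h. B (f x) (frechet_derivative k (at x) h) + B (frechet_derivative f (at x) h) (k x))) (at x)"
    if "x \<in> S" for x
    by (rule FDERIV) (use that assms C1_on_has_derivative in blast)+
  show "continuous_on S (\<lambda>x. B (f x) (frechet_derivative k (at x) h) + B (frechet_derivative f (at x) h) (k x))" for h
    by (intro continuous_on_add continuous_on)
       (use assms C1_on_continuous C1_on_continuous_derivative in blast)+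
qed

lemmas C1_on_mult = C1_on_bilinear[OF bounded_bilinear_mult]
  and C1_on_scaleR = C1_on_bilinear[OF bounded_bilinear_scaleR]

lemma C1_on_add: "C1_on f S \<Longrightarrow> C1_on k S \<Longrightarrow> C1_on (\<lambda>x. f x + k x) S"
  by (rule C1_onI[of _ _ "\<lambda>x h. frechet_derivative f (at x) h + frechet_derivative k (at x) h"])
     (auto intro!: has_derivative_add continuous_intros C1_on_has_derivative C1_on_continuous_derivative)

lemma C1_on_sum: "(\<And>i. i \<in> I \<Longrightarrow> C1_on (f i) S) \<Longrightarrow> C1_on (\<lambda>x. \<Sum>i\<in>I. f i x) S"
  by (induction I rule: infinite_finite_induct) (auto intro: C1_on_add)

lemma C1_on_prod:
  fixes f :: "'i \<Rightarrow> 'a::real_normed_vector \<Rightarrow> 'b::real_normed_field"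
  shows "(\<And>i. i \<in> I \<Longrightarrow> C1_on (f i) S) \<Longrightarrow> C1_on (\<lambda>x. \<Prod>i\<in>I. f i x) S"
  by (induction I rule: infinite_finite_induct) (auto intro: C1_on_mult)

lemma C1_on_compose:
  fixes f :: "'a::real_normed_vector \<Rightarrow> 'b::euclidean_space"
  assumes "C1_on f S" "C1_on k T" "f ` S \<subseteq> T"
  shows "C1_on (\<lambda>x. k (f x)) S"
proof (rule C1_onI)
  let ?f' = "\<lambda>x. frechet_derivative f (at x)" and ?k' = "\<lambda>y. frechet_derivative k (at y)"
  show *: "((\<lambda>x. k (f x)) has_derivative (\<lambda>h. ?k' (f x) (?f' x h))) (at x)" if "x \<in> S" for x
    using diff_chain_at[OF C1_on_has_derivative[OF assms(1) that] C1_on_has_derivative[OF assms(2)]] assms(3) that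
    by (auto simp: o_def)
  have "?k' (f x) (?f' x h) = (\<Sum>b\<in>Basis. (?f' x h \<bullet> b) *\<^sub>R ?k' (f x) b)" if "x \<in> S" for x h
  proof -
    have lin: "linear (?k' (f x))"
      using C1_on_has_derivative[OF assms(2)] assms(3) that has_derivative_linear by blast
    have "?k' (f x) (?f' x h) = ?k' (f x) (\<Sum>b\<in>Basis. (?f' x h \<bullet> b) *\<^sub>R b)"
      by (simp add: euclidean_representation)
    also have "\<dots> = (\<Sum>b\<in>Basis. (?f' x h \<bullet> b) *\<^sub>R ?k' (f x) b)"
      by (simp add: linear_sum[OF lin] linear_cmul[OF lin])
    finally show ?thesis .
  qed
  moreover have "continuous_on S (\<lambda>x. \<Sum>b\<in>Basis. (?f' x h \<bullet> b) *\<^sub>R ?k' (f x) b)" for h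
  proof (intro continuous_intros C1_on_continuous_derivative[OF assms(1)])
    fix b :: 'b
    show "continuous_on S (\<lambda>x. ?k' (f x) b)"
      using continuous_on_compose2[OF C1_on_continuous_derivative[OF assms(2)] C1_on_continuous[OF assms(1)] assms(3)] .
  qed
  ultimately show "continuous_on S (\<lambda>x. ?k' (f x) (?f' x h))" for h
    by (simp cong: continuous_on_cong)
qed

lemma C1_on_real_compose:
  assumes "C1_on f S" "\<And>x. x \<in> S \<Longrightarrow> (\<phi> has_real_derivative \<phi>' (f x)) (at (f x))"
    "continuous_on (f ` S) \<phi>'"
  shows "C1_on (\<lambda>x. \<phi> (f x)) S"
proof (rule C1_on_compose[OF assms(1) C1_onI[of "f ` S" _ "\<lambda>y h. \<phi>' y * h"] order_refl])
  show "(\<phi> has_derivative (*) (\<phi>' y)) (at y)" if "y \<in> f ` S" for y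
    using that assms(2) unfolding has_field_derivative_def by blast
qed (intro continuous_intros assms(3))

text \<open>The simplest functions of class C1 that vanish on a half line; bumps and truncations are built from them.\<close>

lemma has_real_derivative_positive_part_square:
  "((\<lambda>t. (max 0 t)\<^sup>2) has_real_derivative 2 * max 0 t) (at (t :: real))"
proof -
  consider "t < 0" | "t > 0" | "t = 0" by linarith
  then show ?thesis
  proof cases
    case 1
    have "((\<lambda>t. 0) has_real_derivative 2 * max 0 t) (at t)" using 1 by simp
    then show ?thesis
      by (rule has_field_derivative_transform_within_open[of _ _ _ "{..<0}"]) (use 1 in auto)
  next
    case 2
    have "((\<lambda>t. t\<^sup>2) has_real_derivative 2 * max 0 t) (at t)"
      using 2 by (auto intro!: derivative_eq_intros)
    then show ?thesis
      by (rule has_field_derivative_transform_within_open[of _ _ _ "{0<..}"]) (use 2 in auto)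
  next
    case 3
    have "(\<lambda>h. (max 0 h)\<^sup>2 / h :: real) \<midarrow>0\<rightarrow> 0"
      by (rule Lim_null_comparison[where g = "\<lambda>h. \<bar>h\<bar>"])
         (auto simp: max_def power2_eq_square eventually_at_filter intro!: tendsto_eq_intros)
    then show ?thesis using 3 by (simp add: DERIV_def)
  qed
qed

lemma C1_on_vec_nth:
  assumes "C1_on f S" shows "C1_on (\<lambda>x. f x $ i) S"
  using C1_on_bounded_linear[OF bounded_linear_vec_nth assms] .

lemma linear_axis_expansion:
  fixes L :: "real^'n::finite \<Rightarrow> 'b::real_vector"
  assumes "linear L" shows "L h = (\<Sum>i\<in>UNIV. (h $ i) *\<^sub>R L (axis i 1))"
proof -
  have "L h = L (\<Sum>i\<in>UNIV. (h $ i) *\<^sub>R axis i 1)"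
    using basis_expansion[of h] by (simp add: scalar_mult_eq_scaleR)
  also have "\<dots> = (\<Sum>i\<in>UNIV. (h $ i) *\<^sub>R L (axis i 1))"
    by (simp add: linear_sum[OF assms] linear_cmul[OF assms])
  finally show ?thesis .
qed

lemma Ck_on_1_imp_C1_on:
  assumes "Ck_on (Suc 0) f S"
  shows "C1_on f S"
proof (rule C1_onI)
  show d: "(f has_derivative frechet_derivative f (at x)) (at x)" if "x \<in> S" for x
    using assms that frechet_derivative_works by auto
  have "frechet_derivative f (at x) h = (\<Sum>i\<in>UNIV. (h $ i) *\<^sub>R partial_deriv i f x)" if "x \<in> S" for x h
    unfolding partial_deriv_def
    by (rule linear_axis_expansion) (use d that has_derivative_linear in blast)
  moreover have "continuous_on S (\<lambda>x. \<Sum>i\<in>UNIV. (h $ i) *\<^sub>R partial_deriv i f x)" for h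
    using assms by (intro continuous_intros) auto
  ultimately show "continuous_on S (\<lambda>x. frechet_derivative f (at x) h)" for h
    by (simp cong: continuous_on_cong)
qed

lemma smooth_on_imp_C1_on: "smooth_on f S \<Longrightarrow> C1_on f S"
  unfolding smooth_on_def using Ck_on_1_imp_C1_on by blast

lemma smooth_on_partial_deriv: "smooth_on f S \<Longrightarrow> smooth_on (partial_deriv i f) S"
  unfolding smooth_on_def by (metis Ck_on.simps(2))

lemma C1_on_continuous_partial_deriv: "C1_on f S \<Longrightarrow> continuous_on S (partial_deriv i f)"
  unfolding partial_deriv_def using C1_on_continuous_derivative by blast

lemma partial_deriv_eqI: "(f has_derivative f') (at x) \<Longrightarrow> partial_deriv i f x = f' (axis i 1)"
  unfolding partial_deriv_def by (metis frechet_derivative_at)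

lemma partial_deriv_cong_open:
  assumes "open S" "x \<in> S" "\<And>y. y \<in> S \<Longrightarrow> f y = k y"
  shows "partial_deriv i f x = partial_deriv i k x"
proof -
  have "(f has_derivative D) (at x) \<longleftrightarrow> (k has_derivative D) (at x)" for D
    by (rule iffI; erule has_derivative_transform_within_open[OF _ assms(1,2)]) (simp_all add: assms(3))
  then show ?thesis unfolding partial_deriv_def frechet_derivative_def by simp
qed

lemma partial_deriv_mult:
  fixes f k :: "real^'n::finite \<Rightarrow> 'b::real_normed_algebra"
  assumes "f differentiable (at x)" "k differentiable (at x)"
  shows "partial_deriv i (\<lambda>x. f x * k x) x = f x * partial_deriv i k x + partial_deriv i f x * k x"
  using partial_deriv_eqI[OF has_derivative_mult[OF assms[unfolded frechet_derivative_works]]]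
  by (simp add: partial_deriv_def)

lemma partial_deriv_add:
  assumes "f differentiable (at x)" "k differentiable (at x)"
  shows "partial_deriv i (\<lambda>x. f x + k x) x = partial_deriv i f x + partial_deriv i k x"
  using partial_deriv_eqI[OF has_derivative_add[OF assms[unfolded frechet_derivative_works]]]
  by (simp add: partial_deriv_def)

lemma partial_deriv_bounded_linear:
  assumes "bounded_linear L" "f differentiable (at x)"
  shows "partial_deriv i (\<lambda>x. L (f x)) x = L (partial_deriv i f x)"
  using partial_deriv_eqI[OF bounded_linear.has_derivative[OF assms(1) assms(2)[unfolded frechet_derivative_works]]]
  by (simp add: partial_deriv_def)

lemma partial_deriv_compose:
  fixes \<tau> :: "real^'n::finite \<Rightarrow> real^'m::finite"
  assumes "\<tau> differentiable (at x)" "f differentiable (at (\<tau> x))"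
  shows "partial_deriv i (\<lambda>x. f (\<tau> x)) x = (\<Sum>k\<in>UNIV. (jacobian \<tau> (at x) $ k $ i) *\<^sub>R partial_deriv k f (\<tau> x))"
proof -
  let ?D = "frechet_derivative f (at (\<tau> x))" and ?J = "jacobian \<tau> (at x)"
  have "((\<lambda>x. f (\<tau> x)) has_derivative (\<lambda>h. ?D (?J *v h))) (at x)"
    using diff_chain_at[OF assms(1)[unfolded jacobian_works] assms(2)[unfolded frechet_derivative_works]]
    by (simp add: o_def)
  then have "partial_deriv i (\<lambda>x. f (\<tau> x)) x = ?D (?J *v axis i 1)"
    by (rule partial_deriv_eqI)
  also have "\<dots> = (\<Sum>k\<in>UNIV. ((?J *v axis i 1) $ k) *\<^sub>R ?D (axis k 1))"
    using assms(2) by (intro linear_axis_expansion linear_frechet_derivative)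
  finally show ?thesis
    by (simp add: partial_deriv_def matrix_vector_mul_component inner_axis)
qed

lemma partial_deriv_real_compose:
  assumes "f differentiable (at x)" "(\<phi> has_real_derivative d) (at (f x))"
  shows "partial_deriv i (\<lambda>x. \<phi> (f x)) x = d * partial_deriv i f x"
  using partial_deriv_eqI[OF has_derivative_compose[OF assms(1)[unfolded frechet_derivative_works] assms(2)[unfolded has_field_derivative_def]]]
  by (simp add: partial_deriv_def)

lemma C1_on_det:
  fixes M :: "'a::real_normed_vector \<Rightarrow> real^'n::finite^'n"
  assumes "\<And>i j. C1_on (\<lambda>x. M x $ i $ j) S"
  shows "C1_on (\<lambda>x. det (M x)) S"
  unfolding det_def by (intro C1_on_sum C1_on_mult C1_on_const C1_on_prod assms)

lemma C1_on_inverse: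
  fixes f :: "'a::real_normed_vector \<Rightarrow> real"
  assumes "C1_on f S" "\<And>x. x \<in> S \<Longrightarrow> f x \<noteq> 0"
  shows "C1_on (\<lambda>x. inverse (f x)) S"
proof (rule C1_on_real_compose[OF assms(1), where \<phi>' = "\<lambda>y. - inverse (y\<^sup>2)"])
  show "(inverse has_real_derivative - inverse ((f x)\<^sup>2)) (at (f x))" if "x \<in> S" for x
    using DERIV_inverse[of "f x"] assms(2)[OF that] by (simp add: numeral_2_eq_2 power_inverse)
qed (use assms(2) in \<open>auto intro!: continuous_intros\<close>)

lemma C1_on_sqrt:
  assumes "C1_on f S" "\<And>x. x \<in> S \<Longrightarrow> 0 < f x"
  shows "C1_on (\<lambda>x. sqrt (f x)) S"
proof (rule C1_on_real_compose[OF assms(1), where \<phi>' = "\<lambda>y. inverse (sqrt y) / 2"])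
  show "(sqrt has_real_derivative inverse (sqrt (f x)) / 2) (at (f x))" if "x \<in> S" for x
    using DERIV_real_sqrt[OF assms(2)[OF that]] .
qed (use assms(2) in \<open>force intro!: continuous_intros\<close>)

lemma matrix_inv_cancel:
  fixes M :: "'a::field^'n::finite^'n"
  assumes "det M \<noteq> 0"
  shows "M ** matrix_inv M = mat 1" "matrix_inv M ** M = mat 1"
proof -
  have "\<exists>M'. M ** M' = mat 1 \<and> M' ** M = mat 1"
    using assms by (simp add: invertible_det_nz[symmetric] invertible_def)
  then have "M ** matrix_inv M = mat 1 \<and> matrix_inv M ** M = mat 1"
    unfolding matrix_inv_def by (rule someI_ex)
  then show "M ** matrix_inv M = mat 1" "matrix_inv M ** M = mat 1" by auto
qed

text \<open>Cramer's rule writes the entries of the inverse as quotients of determinants.\<close>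

lemma C1_on_matrix_inv:
  fixes M :: "'a::real_normed_vector \<Rightarrow> real^'n::finite^'n"
  assumes "\<And>i j. C1_on (\<lambda>x. M x $ i $ j) S" "open S" "\<And>x. x \<in> S \<Longrightarrow> det (M x) \<noteq> 0"
  shows "C1_on (\<lambda>x. matrix_inv (M x) $ i $ j) S"
proof -
  define R :: "'a \<Rightarrow> real^'n^'n"
    where "R x = (\<chi> r c. if c = i then axis j 1 $ r else M x $ r $ c)" for x
  have "matrix_inv (M x) $ i $ j = det (R x) * inverse (det (M x))" if "x \<in> S" for x
  proof -
    have inv: "M x ** matrix_inv (M x) = mat 1"
      using assms(3)[OF that] by (rule matrix_inv_cancel)
    have "M x *v (matrix_inv (M x) *v axis j 1) = axis j 1"
      by (simp add: matrix_vector_mul_assoc inv)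
    then have "matrix_inv (M x) *v axis j 1 =
        (\<chi> k. det (\<chi> r c. if c = k then axis j 1 $ r else M x $ r $ c) / det (M x))"
      using cramer[OF assms(3)[OF that]] by blast
    then have "(matrix_inv (M x) *v axis j 1) $ i = det (R x) / det (M x)"
      unfolding R_def by simp
    then show ?thesis by (simp add: matrix_vector_mul_component inner_axis divide_inverse)
  qed
  moreover have "C1_on (\<lambda>x. det (R x) * inverse (det (M x))) S"
  proof (intro C1_on_mult C1_on_inverse C1_on_det assms)
    show "C1_on (\<lambda>x. R x $ r $ c) S" for r c
      unfolding R_def by (cases "c = i") (simp_all add: assms(1))
  qed
  ultimately show ?thesis using assms(2) by (auto intro: C1_on_cong)
qed

section \<open>The integral of a derivative with compact support\<close>

lemma integrable_continuous_compact_support: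
  fixes f :: "'a::euclidean_space \<Rightarrow> 'b::{banach, second_countable_topology}"
  assumes "compact K" "continuous_on UNIV f" "\<And>x. x \<notin> K \<Longrightarrow> f x = 0"
  shows "integrable lborel f"
proof -
  have "(\<lambda>x. indicator K x *\<^sub>R f x) = f" using assms(3) by (auto simp: indicator_def)
  then show ?thesis
    using borel_integrable_compact[of K f] assms continuous_on_subset by (metis subset_UNIV)
qed

text \<open>Translation invariance makes the integral of every difference quotient vanish, and the
  quotients converge boundedly to the derivative.\<close>

lemma integral_derivative_eq_0:
  fixes f :: "'a::euclidean_space \<Rightarrow> complex"
  assumes K: "compact K" and f: "C1_on f UNIV" and off: "\<And>x. x \<notin> K \<Longrightarrow> f x = 0"
  shows "integrable lborel (\<lambda>x. frechet_derivative f (at x) h)"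
    and "(\<integral>x. frechet_derivative f (at x) h \<partial>lborel) = 0"
proof -
  define D where "D x = frechet_derivative f (at x) h" for x
  have der: "(f has_derivative frechet_derivative f (at x)) (at x)" for x
    using C1_on_has_derivative[OF f] by simp
  have Dcont: "continuous_on UNIV D"
    unfolding D_def by (rule C1_on_continuous_derivative[OF f])
  have Doff: "D x = 0" if "x \<notin> K" for x
  proof -
    have "((\<lambda>x. 0) has_derivative frechet_derivative f (at x)) (at x)"
      by (rule has_derivative_transform_within_open[OF der, of "- K"])
         (use that off K in \<open>auto simp: compact_imp_closed open_Compl\<close>)
    then have "frechet_derivative f (at x) = (\<lambda>h. 0)"
      using has_derivative_unique has_derivative_const by blast
    then show ?thesis by (simp add: D_def)
  qed
  show "integrable lborel (\<lambda>x. frechet_derivative f (at x) h)"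
    using integrable_continuous_compact_support[OF K Dcont Doff] by (simp add: D_def)
  obtain B where B: "\<And>x. norm (D x) \<le> B" "0 \<le> B"
  proof -
    have "bounded (D ` K)"
      by (intro compact_imp_bounded compact_continuous_image[OF continuous_on_subset[OF Dcont subset_UNIV] K])
    then obtain B where "\<And>x. x \<in> K \<Longrightarrow> norm (D x) \<le> B" by (auto simp: bounded_iff)
    then have "norm (D x) \<le> max B 0" for x
      using Doff[of x] by (cases "x \<in> K") (auto simp: le_max_iff_disj)
    then show ?thesis using that[of "max B 0"] by auto
  qed
  obtain r where "\<forall>x\<in>K. norm x \<le> r"
    using compact_imp_bounded[OF K] unfolding bounded_iff by (elim exE)
  then have r: "K \<subseteq> cball 0 r" by auto
  define K' where "K' = cball (0::'a) (r + norm h)"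
  define t :: "nat \<Rightarrow> real" where "t n = inverse (real (Suc n))" for n
  have t: "0 < t n" "t n \<le> 1" for n by (auto simp: t_def inverse_le_1_iff)
  \<comment> \<open>the difference quotients along \<open>h\<close>, which all have integral zero\<close>
  define s where "s n x = (f (x + t n *\<^sub>R h) - f x) /\<^sub>R t n" for n x
  have fint: "integrable lborel f"
    by (rule integrable_continuous_compact_support[OF K C1_on_continuous[OF f] off])
  have shift: "integrable lborel (\<lambda>x. f (x + c)) \<and> (\<integral>x. f (x + c) \<partial>lborel) = (\<integral>x. f x \<partial>lborel)" for c
  proof -
    have [measurable]: "f \<in> borel_measurable borel" using fint by auto
    have "integrable (distr lborel borel ((+) c)) f" using fint by (simp add: lborel_distr_plus)
    then have "integrable lborel (\<lambda>x. f (c + x))" by (subst (asm) integrable_distr_eq) auto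
    moreover have "(\<integral>x. f x \<partial>lborel) = (\<integral>x. f x \<partial>distr lborel borel ((+) c))"
      by (simp add: lborel_distr_plus)
    then have "(\<integral>x. f x \<partial>lborel) = (\<integral>x. f (c + x) \<partial>lborel)" by (simp add: integral_distr)
    ultimately show ?thesis by (simp add: add.commute)
  qed
  have s0: "(\<integral>x. s n x \<partial>lborel) = 0" for n
    using shift[of "t n *\<^sub>R h"] fint by (simp add: s_def)
  have bound: "norm (s n x) \<le> indicator K' x * B" for n x
  proof (cases "x \<in> K'")
    case True
    have "\<exists>c\<in>{0<..<t n}. norm (f (x + t n *\<^sub>R h) - f (x + 0 *\<^sub>R h)) \<le>
        norm (frechet_derivative f (at (x + c *\<^sub>R h)) ((t n - 0) *\<^sub>R h))"
    proof (rule mvt_general[OF t(1), of n "\<lambda>c. f (x + c *\<^sub>R h)" "\<lambda>c d. frechet_derivative f (at (x + c *\<^sub>R h)) (d *\<^sub>R h)"])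
      show d: "((\<lambda>c. f (x + c *\<^sub>R h)) has_derivative (\<lambda>d. frechet_derivative f (at (x + c *\<^sub>R h)) (d *\<^sub>R h))) (at c)" for c
        by (rule has_derivative_compose[OF _ der]) (auto intro!: derivative_eq_intros)
      show "continuous_on {0..t n} (\<lambda>c. f (x + c *\<^sub>R h))"
        by (rule has_derivative_continuous_on) (use d has_derivative_at_withinI in blast)
    qed
    then obtain c where "norm (f (x + t n *\<^sub>R h) - f x) \<le> norm (frechet_derivative f (at (x + c *\<^sub>R h)) (t n *\<^sub>R h))"
      by auto
    also have "\<dots> = t n * norm (D (x + c *\<^sub>R h))"
      using t[of n] linear_cmul[OF has_derivative_linear[OF der]] by (simp add: D_def)
    also have "\<dots> \<le> t n * B" using B t[of n] by (intro mult_left_mono) auto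
    finally have "norm (f (x + t n *\<^sub>R h) - f x) / t n \<le> B"
      using t[of n] by (simp add: pos_divide_le_eq mult.commute)
    moreover have "norm (s n x) = norm (f (x + t n *\<^sub>R h) - f x) / t n"
      using t[of n] by (simp add: s_def divide_inverse mult.commute)
    ultimately show ?thesis using True by simp
  next
    case False
    then have x: "r + norm h < norm x" by (simp add: K'_def)
    have "r < norm (x + t n *\<^sub>R h)"
    proof -
      have "norm x - norm (t n *\<^sub>R h) \<le> norm (x + t n *\<^sub>R h)" by (rule norm_diff_ineq)
      moreover have "norm (t n *\<^sub>R h) \<le> norm h" using t[of n] by (simp add: mult_left_le_one_le)
      ultimately show ?thesis using x by linarith
    qed
    moreover have "r < norm x" using x norm_ge_zero[of h] by linarith
    ultimately have "x + t n *\<^sub>R h \<notin> K" "x \<notin> K"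
      using r by (meson linorder_not_le mem_cball_0 subsetD)+
    then show ?thesis using B(2) by (simp add: s_def off)
  qed
  have "(\<lambda>n. \<integral>x. s n x \<partial>lborel) \<longlonglongrightarrow> (\<integral>x. D x \<partial>lborel)"
  proof (rule integral_dominated_convergence[where w = "\<lambda>x. indicator K' x * B"])
    have [measurable]: "f \<in> borel_measurable borel" using fint by auto
    show "s n \<in> borel_measurable lborel" for n unfolding s_def by measurable
    show "D \<in> borel_measurable lborel"
      using Dcont by (simp add: borel_measurable_continuous_onI)
    show "integrable lborel (\<lambda>x. indicator K' x * B)"
      unfolding K'_def by (intro integrable_mult_left integrable_real_indicator emeasure_compact_finite) auto
    show "AE x in lborel. (\<lambda>n. s n x) \<longlonglongrightarrow> D x"
    proof (intro AE_I2)
      fix x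
      have "((\<lambda>c. f (x + c *\<^sub>R h)) has_derivative (\<lambda>d. frechet_derivative f (at (x + 0 *\<^sub>R h)) (d *\<^sub>R h))) (at 0)"
        by (rule has_derivative_compose[OF _ der]) (auto intro!: derivative_eq_intros)
      moreover have "(\<lambda>d. frechet_derivative f (at (x + 0 *\<^sub>R h)) (d *\<^sub>R h)) = (\<lambda>d. d *\<^sub>R D x)"
        using linear_cmul[OF has_derivative_linear[OF der]] by (auto simp: D_def)
      ultimately have "((\<lambda>c. f (x + c *\<^sub>R h)) has_derivative (\<lambda>d. d *\<^sub>R D x)) (at 0)"
        by (simp only:)
      then have "(\<lambda>c. norm (f (x + c *\<^sub>R h) - f x - c *\<^sub>R D x) / norm c) \<midarrow>0\<rightarrow> 0"
        by (simp add: has_derivative_at)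
      then have "(\<lambda>c. norm ((f (x + c *\<^sub>R h) - f x) /\<^sub>R c - D x)) \<midarrow>0\<rightarrow> 0"
      proof (rule Lim_transform_eventually)
        have "norm (f (x + c *\<^sub>R h) - f x - c *\<^sub>R D x) / norm c = norm ((f (x + c *\<^sub>R h) - f x) /\<^sub>R c - D x)"
          if "c \<noteq> 0" for c
        proof -
          have "(f (x + c *\<^sub>R h) - f x) /\<^sub>R c - D x = (f (x + c *\<^sub>R h) - f x - c *\<^sub>R D x) /\<^sub>R c"
            using that by (simp add: scaleR_diff_right)
          then show ?thesis by (simp only: norm_scaleR) (simp add: divide_inverse mult.commute)
        qed
        then show "\<forall>\<^sub>F c in at 0. norm (f (x + c *\<^sub>R h) - f x - c *\<^sub>R D x) / norm c =
            norm ((f (x + c *\<^sub>R h) - f x) /\<^sub>R c - D x)"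
          by (simp add: eventually_at_filter)
      qed
      then have "((\<lambda>c. (f (x + c *\<^sub>R h) - f x) /\<^sub>R c) \<longlongrightarrow> D x) (at 0)"
        by (rule LIM_zero_cancel[OF tendsto_norm_zero_cancel])
      moreover have "filterlim t (at 0) sequentially"
        unfolding filterlim_at t_def using t
        by (auto intro: LIMSEQ_inverse_real_of_nat simp del: of_nat_Suc)
      ultimately show "(\<lambda>n. s n x) \<longlonglongrightarrow> D x"
        unfolding s_def by (rule filterlim_compose)
    qed
  qed (use bound in auto)
  then have "(\<integral>x. D x \<partial>lborel) = 0"
    unfolding s0 by (simp add: LIMSEQ_const_iff)
  then show "(\<integral>x. frechet_derivative f (at x) h \<partial>lborel) = 0" by (simp add: D_def)
qed

section \<open>Positive definite matrices\<close>

text \<open>A positive definite matrix is joined to the identity by a segment of invertible matrices, so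
  its determinant has the sign of \<open>det 1\<close>.\<close>

lemma det_pos_of_positive_definite:
  fixes M :: "real^'n::finite^'n"
  assumes pd: "\<And>v. v \<noteq> 0 \<Longrightarrow> v \<bullet> (M *v v) > 0"
  shows "det M > 0"
proof (rule ccontr)
  assume "\<not> det M > 0"
  define P where "P t = (1 - t) *\<^sub>R mat 1 + t *\<^sub>R M" for t :: real
  have "continuous_on {0..1} (\<lambda>t. det (P t))"
    unfolding det_def P_def by (auto intro!: continuous_intros)
  moreover have "det (P 0) = 1" "det (P 1) \<le> 0"
    using \<open>\<not> det M > 0\<close> by (auto simp: P_def)
  ultimately obtain t where t: "0 \<le> t" "t \<le> 1" "det (P t) = 0"
    using IVT2'[of "\<lambda>t. det (P t)" 1 0 0] by auto
  have "v = 0" if "P t *v v = 0" for v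
  proof (rule ccontr)
    assume "v \<noteq> 0"
    have "v \<bullet> (P t *v v) = (1 - t) * (v \<bullet> v) + t * (v \<bullet> (M *v v))"
      by (simp add: P_def matrix_vector_mult_add_rdistrib scaleR_matrix_vector_assoc[symmetric] inner_add_right)
    moreover have "(1 - t) * (v \<bullet> v) + t * (v \<bullet> (M *v v)) > 0"
    proof (cases "t = 0")
      case False
      then have "t * (v \<bullet> (M *v v)) > 0" using t pd[OF \<open>v \<noteq> 0\<close>] by simp
      moreover have "(1 - t) * (v \<bullet> v) \<ge> 0" using t by simp
      ultimately show ?thesis by linarith
    qed (use \<open>v \<noteq> 0\<close> in simp)
    ultimately show False using that by simp
  qed
  then have "inj ((*v) (P t))"
    by (simp add: linear_injective_0 matrix_vector_mul_linear)
  then have "det (P t) \<noteq> 0"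
    by (simp flip: invertible_det_nz add: invertible_left_inverse matrix_left_invertible_injective)
  with t show False by simp
qed

section \<open>The closed manifold and its charts\<close>

locale closed_riemannian_manifold =
  fixes A :: "('m::t2_space, 'n::finite) chart set" and g :: "('m, 'n) metric" and V :: "'m measure"
  assumes mfd: "compact_riemannian_manifold A g" and vol: "riemannian_volume A g V"
begin

lemma compact_UNIV: "compact (UNIV :: 'm set)"
  using mfd by (simp add: compact_riemannian_manifold_def)

lemma
  assumes "c \<in> A"
  shows open_dom: "open (fst c)" and open_img: "open (snd c ` fst c)"
    and hom: "homeomorphism (fst c) (snd c ` fst c) (snd c) (chart_inv c)"
  using mfd assms unfolding compact_riemannian_manifold_def smooth_atlas_def is_chart_def by blast+

lemma cover: obtains c where "c \<in> A" "x \<in> fst c"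
  using mfd unfolding compact_riemannian_manifold_def smooth_atlas_def by blast

lemma chart_inv_coord: "c \<in> A \<Longrightarrow> x \<in> fst c \<Longrightarrow> chart_inv c (snd c x) = x"
  using hom homeomorphism_apply1 by blast

lemma coord_chart_inv: "c \<in> A \<Longrightarrow> y \<in> snd c ` fst c \<Longrightarrow> snd c (chart_inv c y) = y"
  using hom homeomorphism_apply2 by blast

lemma chart_inv_in: "c \<in> A \<Longrightarrow> y \<in> snd c ` fst c \<Longrightarrow> chart_inv c y \<in> fst c"
  using hom homeomorphism_image2 by blast

lemma continuous_coord: "c \<in> A \<Longrightarrow> continuous_on (fst c) (snd c)"
  using hom homeomorphism_cont1 by blast

lemma continuous_chart_inv: "c \<in> A \<Longrightarrow> continuous_on (snd c ` fst c) (chart_inv c)"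
  using hom homeomorphism_cont2 by blast

lemma open_coord_image:
  assumes "c \<in> A" "open O'" "O' \<subseteq> fst c" shows "open (snd c ` O')"
  using homeomorphism_imp_open_map[OF hom[OF assms(1)], of O'] assms open_img[OF assms(1)]
  by (metis open_openin_trans openin_open_eq open_dom)

lemma compact_chart_inv_image:
  "c \<in> A \<Longrightarrow> compact K \<Longrightarrow> K \<subseteq> snd c ` fst c \<Longrightarrow> compact (chart_inv c ` K)"
  by (rule compact_continuous_image[OF continuous_on_subset[OF continuous_chart_inv]])

lemma C1_transition:
  assumes "c \<in> A" "d \<in> A"
  shows "C1_on (\<lambda>y. snd d (chart_inv c y)) (snd c ` (fst c \<inter> fst d))"
proof -
  have "smooth_on (snd d \<circ> chart_inv c) (snd c ` (fst c \<inter> fst d))"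
    using mfd assms unfolding compact_riemannian_manifold_def smooth_atlas_def by blast
  then show ?thesis using smooth_on_imp_C1_on by (simp add: o_def)
qed

lemma metric_pos: "c \<in> A \<Longrightarrow> y \<in> snd c ` fst c \<Longrightarrow> v \<noteq> 0 \<Longrightarrow> v \<bullet> (g c y *v v) > 0"
  and metric_sym: "c \<in> A \<Longrightarrow> y \<in> snd c ` fst c \<Longrightarrow> transpose (g c y) = g c y"
  and metric_smooth: "c \<in> A \<Longrightarrow> smooth_on (g c) (snd c ` fst c)"
  using mfd unfolding compact_riemannian_manifold_def riemannian_metric_def by blast+

lemma metric_transform:
  assumes "c \<in> A" "d \<in> A" "x \<in> fst c \<inter> fst d" "J = jacobian (\<lambda>y. snd d (chart_inv c y)) (at (snd c x))"
  shows "g c (snd c x) = transpose J ** g d (snd d x) ** J"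
proof -
  have "\<forall>c\<in>A. \<forall>d\<in>A. \<forall>x \<in> fst c \<inter> fst d.
       let J = jacobian (snd d \<circ> chart_inv c) (at (snd c x))
       in g c (snd c x) = transpose J ** g d (snd d x) ** J"
    using mfd unfolding compact_riemannian_manifold_def riemannian_metric_def by (elim conjE)
  from this[THEN bspec, OF assms(1), THEN bspec, OF assms(2), THEN bspec, OF assms(3)]
  show ?thesis unfolding Let_def o_def assms(4) .
qed

lemma det_metric_pos: "c \<in> A \<Longrightarrow> y \<in> snd c ` fst c \<Longrightarrow> det (g c y) > 0"
  by (rule det_pos_of_positive_definite) (rule metric_pos)

definition cometric :: "('m, 'n) chart \<Rightarrow> real^'n \<Rightarrow> real^'n^'n" where
  "cometric c y = matrix_inv (g c y)"

definition density_coeff :: "('m, 'n) chart \<Rightarrow> real^'n \<Rightarrow> real" where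
  "density_coeff c y = sqrt (det (g c y))"

lemma metric_cometric:
  assumes "c \<in> A" "y \<in> snd c ` fst c"
  shows "g c y ** cometric c y = mat 1" "cometric c y ** g c y = mat 1"
  using det_metric_pos[OF assms] unfolding cometric_def by (auto intro: matrix_inv_cancel)

lemma cometric_sym:
  assumes "c \<in> A" "y \<in> snd c ` fst c"
  shows "cometric c y $ i $ j = cometric c y $ j $ i"
proof -
  let ?G = "g c y" and ?H = "cometric c y"
  have "transpose ?H ** ?G = mat 1"
    using arg_cong[OF metric_cometric(1)[OF assms], of transpose] metric_sym[OF assms]
    by (simp add: matrix_transpose_mul transpose_mat)
  then have "transpose ?H ** ?G ** ?H = ?H" by (simp add: matrix_mul_lid)
  then have "transpose ?H = ?H"
    by (simp add: matrix_mul_assoc[symmetric] metric_cometric[OF assms] matrix_mul_rid)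
  moreover have "transpose ?H $ j $ i = ?H $ i $ j" by (simp add: transpose_def)
  ultimately show ?thesis by simp
qed

lemma cometric_nonneg:
  assumes "c \<in> A" "y \<in> snd c ` fst c"
  shows "0 \<le> (\<Sum>i\<in>UNIV. \<Sum>j\<in>UNIV. cometric c y $ i $ j * (v $ i * v $ j))"
proof -
  define w where "w = cometric c y *v v"
  have "g c y *v w = v"
    by (simp add: w_def matrix_vector_mul_assoc metric_cometric[OF assms])
  then have "v \<bullet> w = w \<bullet> (g c y *v w)" by (simp add: inner_commute)
  also have "\<dots> \<ge> 0" using metric_pos[OF assms, of w] by (cases "w = 0") auto
  finally show ?thesis
    by (simp add: w_def inner_vec_def matrix_vector_mult_def sum_distrib_left mult_ac)
qed

lemma
  assumes "c \<in> A"
  shows C1_density: "C1_on (density_coeff c) (snd c ` fst c)"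
  and C1_cometric: "C1_on (\<lambda>y. cometric c y $ i $ j) (snd c ` fst c)"
proof -
  have "C1_on (\<lambda>y. g c y $ i $ j) (snd c ` fst c)" for i j
    by (intro C1_on_vec_nth C1_on_bounded_linear[OF bounded_linear_vec_nth] smooth_on_imp_C1_on metric_smooth assms)
  moreover note det_metric_pos[OF assms]
  ultimately show "C1_on (density_coeff c) (snd c ` fst c)"
    "C1_on (\<lambda>y. cometric c y $ i $ j) (snd c ` fst c)"
    unfolding density_coeff_def cometric_def
    by (auto intro!: C1_on_sqrt C1_on_det C1_on_matrix_inv open_img[OF assms] simp: less_imp_neq[symmetric])
qed

lemma density_pos: "c \<in> A \<Longrightarrow> y \<in> snd c ` fst c \<Longrightarrow> 0 < density_coeff c y"
  by (simp add: density_coeff_def det_metric_pos)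

section \<open>Functions of class C1 on the manifold\<close>

definition C1M :: "('m \<Rightarrow> 'b::real_normed_vector) \<Rightarrow> bool" where
  "C1M f \<longleftrightarrow> (\<forall>c\<in>A. C1_on (\<lambda>y. f (chart_inv c y)) (snd c ` fst c))"

lemma C1M_chart: "C1M f \<Longrightarrow> c \<in> A \<Longrightarrow> C1_on (\<lambda>y. f (chart_inv c y)) (snd c ` fst c)"
  by (simp add: C1M_def)

lemma C1M_const [simp]: "C1M (\<lambda>x. k)" by (simp add: C1M_def)

lemma C1M_add: "C1M f \<Longrightarrow> C1M h \<Longrightarrow> C1M (\<lambda>x. f x + h x)"
  by (simp add: C1M_def C1_on_add)

lemma C1M_mult: "C1M f \<Longrightarrow> C1M h \<Longrightarrow> C1M (\<lambda>x. f x * h x :: 'b::real_normed_algebra)"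
  by (simp add: C1M_def C1_on_mult)

lemma C1M_sum: "(\<And>i. i \<in> I \<Longrightarrow> C1M (f i)) \<Longrightarrow> C1M (\<lambda>x. \<Sum>i\<in>I. f i x)"
  by (simp add: C1M_def C1_on_sum)

lemma C1M_bounded_linear: "bounded_linear L \<Longrightarrow> C1M f \<Longrightarrow> C1M (\<lambda>x. L (f x))"
  unfolding C1M_def by (intro ballI) (erule C1_on_bounded_linear, erule bspec)

lemma C1M_inverse: "C1M f \<Longrightarrow> (\<And>x. f x \<noteq> 0) \<Longrightarrow> C1M (\<lambda>x. inverse (f x :: real))"
  by (simp add: C1M_def C1_on_inverse)

lemma C1M_real_compose:
  assumes "C1M u" "\<And>t. (\<phi> has_real_derivative \<phi>' t) (at t)" "continuous_on UNIV \<phi>'"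
  shows "C1M (\<lambda>x. \<phi> (u x))"
  unfolding C1M_def
  by (intro ballI C1_on_real_compose[where \<phi> = \<phi> and \<phi>' = \<phi>'] C1M_chart assms
      continuous_on_subset[OF assms(3) subset_UNIV])

lemma C1M_of_real: "C1M u \<Longrightarrow> C1M (\<lambda>x. complex_of_real (u x))"
  by (rule C1M_bounded_linear[OF bounded_linear_of_real])

lemma C1M_smooth: "smooth_fun A f \<Longrightarrow> C1M f"
  unfolding smooth_fun_def C1M_def by (metis (no_types, lifting) comp_def continuous_on_cong smooth_on_imp_C1_on ext)

lemma C1M_continuous:
  assumes "C1M f" shows "continuous_on UNIV f"
proof -
  have "continuous_on (\<Union>c\<in>A. fst c) f"
  proof (rule continuous_on_open_UN)
    fix c assume c: "c \<in> A"
    show "open (fst c)" by (rule open_dom[OF c])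
    have "continuous_on (fst c) (\<lambda>x. f (chart_inv c (snd c x)))"
      by (rule continuous_on_compose2[OF C1_on_continuous[OF C1M_chart[OF assms c]] continuous_coord[OF c]]) auto
    then show "continuous_on (fst c) f"
      by (simp add: chart_inv_coord[OF c] cong: continuous_on_cong)
  qed
  moreover have "(\<Union>c\<in>A. fst c) = UNIV" using cover by blast
  ultimately show ?thesis by simp
qed

text \<open>Transport the square of the positive part of \<open>r\<^sup>2 - |y|\<^sup>2\<close> from the chart. It is continuously differentiable in every other chart because its
  support is compact, hence closed in the manifold: near a point outside the support it vanishes, and near a point of the
  support both charts are defined. Class C1 suffices for integrating by parts once.\<close>

lemma bump_function:
  assumes c: "c \<in> A" and O': "open O'" "O' \<subseteq> fst c" and x: "x \<in> O'"
  obtains b :: "'m \<Rightarrow> real" and K where "C1M b" "\<And>z. 0 \<le> b z" "0 < b x"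
    "compact K" "K \<subseteq> snd c ` O'" "\<And>z. z \<notin> chart_inv c ` K \<Longrightarrow> b z = 0"
proof -
  have "open (snd c ` O')" by (rule open_coord_image[OF c O'])
  then obtain r where r: "0 < r" "cball (snd c x) r \<subseteq> snd c ` O'"
    using x open_contains_cball by blast
  define K where "K = cball (snd c x) r"
  define \<beta> where "\<beta> y = (max 0 (r\<^sup>2 - (y - snd c x) \<bullet> (y - snd c x)))\<^sup>2" for y
  have KU: "K \<subseteq> snd c ` fst c" using r O' unfolding K_def by blast
  have \<beta>off: "\<beta> y = 0" if "y \<notin> K" for y
  proof -
    have "r < norm (y - snd c x)" using that by (simp add: K_def dist_norm norm_minus_commute)
    then have "r\<^sup>2 \<le> (norm (y - snd c x))\<^sup>2" using r by (intro power_mono) auto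
    then show ?thesis by (simp add: \<beta>_def power2_norm_eq_inner)
  qed
  have \<beta>C1: "C1_on \<beta> UNIV"
    unfolding \<beta>_def
  proof (rule C1_on_real_compose[where \<phi> = "\<lambda>t. (max 0 t)\<^sup>2" and \<phi>' = "\<lambda>t. 2 * max 0 t"])
    show "C1_on (\<lambda>y. r\<^sup>2 - (y - snd c x) \<bullet> (y - snd c x)) UNIV"
      by (rule C1_onI[of _ _ "\<lambda>y h. - (2 * ((y - snd c x) \<bullet> h))"])
         (auto intro!: derivative_eq_intros continuous_intros simp: inner_commute)
    show "((\<lambda>t. (max 0 t)\<^sup>2) has_real_derivative 2 * max 0 (r\<^sup>2 - (y - snd c x) \<bullet> (y - snd c x)))
        (at (r\<^sup>2 - (y - snd c x) \<bullet> (y - snd c x)))" for y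
      by (rule has_real_derivative_positive_part_square)
  qed (intro continuous_intros)
  define b where "b z = (if z \<in> fst c then \<beta> (snd c z) else 0)" for z
  have boff: "b z = 0" if "z \<notin> chart_inv c ` K" for z
    using that \<beta>off chart_inv_coord[OF c] unfolding b_def by (metis imageI)
  have "C1M b"
    unfolding C1M_def
  proof
    fix d assume d: "d \<in> A"
    \<comment> \<open>the overlap with the chart and the complement of the support cover the domain of \<open>d\<close>\<close>
    let ?O1 = "snd d ` (fst d \<inter> fst c)" and ?O2 = "snd d ` (fst d - chart_inv c ` K)"
    have cl: "closed (chart_inv c ` K)"
      using compact_chart_inv_image[OF c _ KU] compact_imp_closed by (auto simp: K_def)
    have o1: "open ?O1"
      by (intro open_coord_image[OF d] open_Int open_dom[OF c] open_dom[OF d]) simp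
    have o2: "open ?O2"
      by (intro open_coord_image[OF d] open_Diff open_dom[OF d] cl) simp
    have "C1_on (\<lambda>y. \<beta> (snd c (chart_inv d y))) ?O1"
      by (rule C1_on_compose[OF C1_transition[OF d c] \<beta>C1]) auto
    then have 1: "C1_on (\<lambda>y. b (chart_inv d y)) ?O1"
      by (rule C1_on_cong[OF _ o1]) (auto simp: b_def chart_inv_coord[OF d])
    have 2: "C1_on (\<lambda>y. b (chart_inv d y)) ?O2"
      by (rule C1_on_cong[OF C1_on_const[of 0] o2]) (auto simp: boff chart_inv_coord[OF d])
    have "chart_inv c ` K \<subseteq> fst c" using chart_inv_in[OF c] KU by blast
    then have "?O1 \<union> ?O2 = snd d ` fst d" by blast
    then show "C1_on (\<lambda>y. b (chart_inv d y)) (snd d ` fst d)"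
      using C1_on_Un[OF 1 2 o1 o2] by simp
  qed
  moreover have "0 \<le> b z" for z by (simp add: b_def \<beta>_def)
  moreover have "0 < b x" using x O' r by (auto simp: b_def \<beta>_def)
  ultimately show ?thesis
    using that[of b K] boff r by (auto simp: K_def)
qed

section \<open>The gradient form\<close>

definition grad_chart :: "('m, 'n) chart \<Rightarrow> ('m \<Rightarrow> complex) \<Rightarrow> ('m \<Rightarrow> complex) \<Rightarrow> real^'n \<Rightarrow> complex" where
  "grad_chart c f h y = (\<Sum>i\<in>UNIV. \<Sum>j\<in>UNIV. (cometric c y $ i $ j) *\<^sub>R
     (partial_deriv i (\<lambda>y. f (chart_inv c y)) y * partial_deriv j (\<lambda>y. h (chart_inv c y)) y))"

text \<open>The complex bilinear extension of \<open>\<langle>\<nabla> f, \<nabla> h\<rangle>\<close>, without conjugation. The chart chosen at \<open>x\<close> is irrelevant by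
  \<open>grad_form_chart\<close>.\<close>

definition grad_form :: "('m \<Rightarrow> complex) \<Rightarrow> ('m \<Rightarrow> complex) \<Rightarrow> 'm \<Rightarrow> complex" where
  "grad_form f h x = (let c = (SOME c. c \<in> A \<and> x \<in> fst c) in grad_chart c f h (snd c x))"

text \<open>The metric transforms by \<open>g\<^sub>c = J\<^sup>T g\<^sub>d J\<close>; multiplying \<open>g\<^sub>c\<^sup>-\<^sup>1 J\<^sup>T g\<^sub>d J = 1\<close> by \<open>J\<close> from the left and cancelling \<open>J\<close> on
  the right gives the law for the inverse.\<close>

lemma cometric_transform:
  assumes c: "c \<in> A" and d: "d \<in> A" and x: "x \<in> fst c \<inter> fst d"
    and J: "J = jacobian (\<lambda>y. snd d (chart_inv c y)) (at (snd c x))"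
  shows "J ** cometric c (snd c x) ** transpose J = cometric d (snd d x)"
proof -
  let ?G = "g c (snd c x)" and ?H = "g d (snd d x)"
  have xc: "snd c x \<in> snd c ` fst c" and xd: "snd d x \<in> snd d ` fst d" using x by auto
  have G: "?G = transpose J ** ?H ** J" by (rule metric_transform[OF c d x J])
  have "det J \<noteq> 0"
    using det_metric_pos[OF c xc] unfolding G by (auto simp: det_mul)
  then have inv: "J ** matrix_inv J = mat 1" by (rule matrix_inv_cancel)
  have "cometric c (snd c x) ** (transpose J ** ?H ** J) = mat 1"
    using metric_cometric(2)[OF c xc] unfolding G .
  then have "J ** (cometric c (snd c x) ** (transpose J ** ?H ** J)) ** matrix_inv J = J ** mat 1 ** matrix_inv J"
    by simp
  then have "(J ** cometric c (snd c x) ** transpose J) ** ?H ** (J ** matrix_inv J) = J ** matrix_inv J"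
    by (simp add: matrix_mul_assoc matrix_mul_rid)
  then have "(J ** cometric c (snd c x) ** transpose J) ** ?H = mat 1"
    by (simp add: inv matrix_mul_rid)
  then have "(J ** cometric c (snd c x) ** transpose J) ** ?H ** cometric d (snd d x) = cometric d (snd d x)"
    by (simp add: matrix_mul_lid)
  then show ?thesis
    by (simp add: matrix_mul_assoc[symmetric] metric_cometric[OF d xd] matrix_mul_rid)
qed

text \<open>By the chain rule both gradients in the chart \<open>c\<close> are those in the chart \<open>d\<close> multiplied by the transposed Jacobian \<open>J\<close>, and
  \<open>J g\<^sub>c\<^sup>-\<^sup>1 J\<^sup>T = g\<^sub>d\<^sup>-\<^sup>1\<close>. The computation only reorders the fourfold sum over the indices.\<close>

lemma grad_chart_indep:
  assumes f: "C1M f" and h: "C1M h" and c: "c \<in> A" and d: "d \<in> A" and x: "x \<in> fst c \<inter> fst d"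
  shows "grad_chart c f h (snd c x) = grad_chart d f h (snd d x)"
proof -
  define \<tau> where "\<tau> y = snd d (chart_inv c y)" for y
  define J where "J = jacobian \<tau> (at (snd c x))"
  define U where "U = snd c ` (fst c \<inter> fst d)"
  have U: "open U" "snd c x \<in> U"
    unfolding U_def using x
    by (simp_all add: open_coord_image[OF c] open_Int open_dom[OF c] open_dom[OF d])
  have \<tau>x: "\<tau> (snd c x) = snd d x" using x by (simp add: \<tau>_def chart_inv_coord[OF c])
  have der: "partial_deriv i (\<lambda>y. k (chart_inv c y)) (snd c x) =
      (\<Sum>l\<in>UNIV. (J $ l $ i) *\<^sub>R partial_deriv l (\<lambda>y. k (chart_inv d y)) (snd d x))"
    if "C1M k" for k :: "'m \<Rightarrow> complex" and i
  proof -
    have "partial_deriv i (\<lambda>y. k (chart_inv c y)) (snd c x) = partial_deriv i (\<lambda>y. k (chart_inv d (\<tau> y))) (snd c x)"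
      by (rule partial_deriv_cong_open[OF U]) (auto simp: \<tau>_def U_def chart_inv_coord[OF c] chart_inv_coord[OF d])
    also have "\<dots> = (\<Sum>l\<in>UNIV. (J $ l $ i) *\<^sub>R partial_deriv l (\<lambda>y. k (chart_inv d y)) (\<tau> (snd c x)))"
      unfolding J_def
    proof (rule partial_deriv_compose)
      show "\<tau> differentiable at (snd c x)"
        unfolding \<tau>_def[abs_def] using U unfolding U_def
        by (intro C1_on_differentiable[OF C1_transition[OF c d]])
      show "(\<lambda>y. k (chart_inv d y)) differentiable at (\<tau> (snd c x))"
        using C1_on_differentiable[OF C1M_chart[OF that d]] x by (simp add: \<tau>x)
    qed
    finally show ?thesis by (simp add: \<tau>x)
  qed
  define p q where "p l = partial_deriv l (\<lambda>y. f (chart_inv d y)) (snd d x)"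
    and "q l = partial_deriv l (\<lambda>y. h (chart_inv d y)) (snd d x)" for l
  have ct: "cometric d (snd d x) $ k $ l = (\<Sum>j\<in>UNIV. \<Sum>i\<in>UNIV. J $ k $ i * cometric c (snd c x) $ i $ j * J $ l $ j)" for k l
    unfolding cometric_transform[OF c d x J_def[unfolded \<tau>_def], symmetric]
    by (simp add: matrix_matrix_mult_def transpose_def sum_distrib_right)
  have "grad_chart c f h (snd c x) = (\<Sum>i\<in>UNIV. \<Sum>j\<in>UNIV. (cometric c (snd c x) $ i $ j) *\<^sub>R
     ((\<Sum>k\<in>UNIV. (J $ k $ i) *\<^sub>R p k) * (\<Sum>l\<in>UNIV. (J $ l $ j) *\<^sub>R q l)))"
    unfolding grad_chart_def der[OF f] der[OF h] p_def q_def ..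
  also have "\<dots> = (\<Sum>i\<in>UNIV. \<Sum>j\<in>UNIV. \<Sum>k\<in>UNIV. \<Sum>l\<in>UNIV.
      (J $ k $ i * cometric c (snd c x) $ i $ j * J $ l $ j) *\<^sub>R (p k * q l))"
    by (simp add: sum_product scaleR_sum_right mult_ac)
  also have "\<dots> = (\<Sum>i\<in>UNIV. \<Sum>k\<in>UNIV. \<Sum>j\<in>UNIV. \<Sum>l\<in>UNIV.
      (J $ k $ i * cometric c (snd c x) $ i $ j * J $ l $ j) *\<^sub>R (p k * q l))"
    by (rule sum.cong[OF refl]) (rule sum.swap)
  also have "\<dots> = (\<Sum>k\<in>UNIV. \<Sum>i\<in>UNIV. \<Sum>l\<in>UNIV. \<Sum>j\<in>UNIV.
      (J $ k $ i * cometric c (snd c x) $ i $ j * J $ l $ j) *\<^sub>R (p k * q l))"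
    by (subst sum.swap) (intro sum.cong[OF refl] sum.swap)
  also have "\<dots> = (\<Sum>k\<in>UNIV. \<Sum>l\<in>UNIV. \<Sum>i\<in>UNIV. \<Sum>j\<in>UNIV.
      (J $ k $ i * cometric c (snd c x) $ i $ j * J $ l $ j) *\<^sub>R (p k * q l))"
    by (intro sum.cong[OF refl] sum.swap)
  also have "\<dots> = (\<Sum>k\<in>UNIV. \<Sum>l\<in>UNIV. \<Sum>j\<in>UNIV. \<Sum>i\<in>UNIV.
      (J $ k $ i * cometric c (snd c x) $ i $ j * J $ l $ j) *\<^sub>R (p k * q l))"
    by (intro sum.cong[OF refl] sum.swap)
  also have "\<dots> = grad_chart d f h (snd d x)"
    unfolding grad_chart_def p_def[symmetric] q_def[symmetric] ct by (simp add: scaleR_sum_left)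
  finally show ?thesis .
qed

lemma grad_form_chart:
  assumes "C1M f" "C1M h" "c \<in> A" "x \<in> fst c"
  shows "grad_form f h x = grad_chart c f h (snd c x)"
proof -
  define d where "d = (SOME c. c \<in> A \<and> x \<in> fst c)"
  have "d \<in> A \<and> x \<in> fst d" unfolding d_def by (rule someI[of _ c]) (use assms in auto)
  then show ?thesis
    unfolding grad_form_def d_def[symmetric] Let_def using assms by (intro grad_chart_indep) auto
qed

lemma grad_form_commute:
  assumes "C1M f" "C1M h"
  shows "grad_form f h x = grad_form h f x"
proof -
  obtain c where c: "c \<in> A" "x \<in> fst c" by (rule cover)
  have "grad_chart c f h (snd c x) = grad_chart c h f (snd c x)"
    unfolding grad_chart_def using c
    by (subst sum.swap) (simp add: cometric_sym[of c "snd c x"] mult.commute)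
  then show ?thesis using grad_form_chart assms c by simp
qed

lemma differentiable_chart:
  "C1M f \<Longrightarrow> c \<in> A \<Longrightarrow> x \<in> fst c \<Longrightarrow> (\<lambda>y. f (chart_inv c y)) differentiable (at (snd c x))"
  by (rule C1_on_differentiable[OF C1M_chart]) auto

lemma grad_form_add_left:
  assumes "C1M f" "C1M k" "C1M h"
  shows "grad_form (\<lambda>x. f x + k x) h x = grad_form f h x + grad_form k h x"
proof -
  obtain c where c: "c \<in> A" "x \<in> fst c" by (rule cover)
  show ?thesis
    using assms c
    by (simp add: grad_form_chart[OF _ _ c] C1M_add grad_chart_def partial_deriv_add differentiable_chart
        distrib_right scaleR_add_right sum.distrib)
qed

lemma grad_form_mult_left:
  assumes "C1M f" "C1M k" "C1M h"
  shows "grad_form (\<lambda>x. f x * k x) h x = f x * grad_form k h x + k x * grad_form f h x"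
proof -
  obtain c where c: "c \<in> A" "x \<in> fst c" by (rule cover)
  show ?thesis
    using assms c
    by (simp add: grad_form_chart[OF _ _ c] C1M_mult grad_chart_def partial_deriv_mult differentiable_chart
        chart_inv_coord distrib_left distrib_right scaleR_add_right sum.distrib sum_distrib_left mult_ac)
qed

lemma partial_deriv_const [simp]: "partial_deriv i (\<lambda>x. k) = (\<lambda>x. 0)"
  by (auto simp: partial_deriv_def)

lemma grad_form_const_left [simp]: "grad_form (\<lambda>x. k) h x = 0"
  by (simp add: grad_form_def grad_chart_def Let_def)

lemma grad_form_cmult_left:
  assumes "C1M f" "C1M h"
  shows "grad_form (\<lambda>x. k * f x) h x = k * grad_form f h x"
  using grad_form_mult_left[OF C1M_const assms] by simp

lemma grad_form_sum_left:
  assumes "\<And>i. i \<in> I \<Longrightarrow> C1M (f i)" "C1M h"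
  shows "grad_form (\<lambda>x. \<Sum>i\<in>I. f i x) h x = (\<Sum>i\<in>I. grad_form (f i) h x)"
  using assms(1)
  by (induction I rule: infinite_finite_induct) (auto simp: grad_form_add_left C1M_sum assms(2))

lemma grad_form_real_compose_left:
  assumes u: "C1M u" and h: "C1M h" and d: "\<And>t. (\<phi> has_real_derivative \<phi>' t) (at t)" "continuous_on UNIV \<phi>'"
  shows "grad_form (\<lambda>x. of_real (\<phi> (u x))) h x = of_real (\<phi>' (u x)) * grad_form (\<lambda>x. of_real (u x)) h x"
proof -
  obtain c where c: "c \<in> A" "x \<in> fst c" by (rule cover)
  have "partial_deriv i (\<lambda>y. complex_of_real (\<phi> (u (chart_inv c y)))) (snd c x) =
      of_real (\<phi>' (u x)) * partial_deriv i (\<lambda>y. complex_of_real (u (chart_inv c y))) (snd c x)" for i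
  proof -
    have du: "(\<lambda>y. u (chart_inv c y)) differentiable (at (snd c x))"
      by (rule differentiable_chart[OF u c])
    have d\<phi>: "(\<lambda>y. \<phi> (u (chart_inv c y))) differentiable (at (snd c x))"
      by (rule differentiable_chart[OF C1M_real_compose[OF u d] c])
    show ?thesis
      using partial_deriv_real_compose[OF du d(1)]
      by (simp add: partial_deriv_bounded_linear[OF bounded_linear_of_real du]
          partial_deriv_bounded_linear[OF bounded_linear_of_real d\<phi>] chart_inv_coord[OF c])
  qed
  then show ?thesis
    by (simp add: grad_form_chart[OF _ h c] C1M_of_real C1M_real_compose[OF u d] u grad_chart_def
        sum_distrib_left mult_ac)
qed

lemma grad_form_local:
  assumes "C1M f" "C1M h" "open O'" "x \<in> O'" "\<And>z. z \<in> O' \<Longrightarrow> f z = 0"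
  shows "grad_form f h x = 0"
proof -
  obtain c where c: "c \<in> A" "x \<in> fst c" by (rule cover)
  have "partial_deriv i (\<lambda>y. f (chart_inv c y)) (snd c x) = 0" for i
  proof -
    have "partial_deriv i (\<lambda>y. f (chart_inv c y)) (snd c x) = partial_deriv i (\<lambda>y. 0) (snd c x)"
      by (rule partial_deriv_cong_open[OF open_coord_image[OF c(1) open_Int[OF assms(3) open_dom[OF c(1)]]]])
         (use assms c in \<open>auto simp: chart_inv_coord[OF c(1)]\<close>)
    then show ?thesis by simp
  qed
  then show ?thesis by (simp add: grad_form_chart[OF assms(1,2) c] grad_chart_def)
qed

lemma grad_form_cnj_nonneg:
  assumes "C1M f"
  shows "0 \<le> Re (grad_form f (\<lambda>x. cnj (f x)) x)"
proof -
  obtain c where c: "c \<in> A" "x \<in> fst c" by (rule cover)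
  define p where "p i = partial_deriv i (\<lambda>y. f (chart_inv c y)) (snd c x)" for i
  have cn: "partial_deriv i (\<lambda>y. cnj (f (chart_inv c y))) (snd c x) = cnj (p i)" for i
    unfolding p_def by (rule partial_deriv_bounded_linear[OF bounded_linear_cnj differentiable_chart[OF assms c]])
  have "Re (grad_form f (\<lambda>x. cnj (f x)) x) =
     (\<Sum>i\<in>UNIV. \<Sum>j\<in>UNIV. cometric c (snd c x) $ i $ j * ((\<chi> i. Re (p i)) $ i * (\<chi> i. Re (p i)) $ j)) +
     (\<Sum>i\<in>UNIV. \<Sum>j\<in>UNIV. cometric c (snd c x) $ i $ j * ((\<chi> i. Im (p i)) $ i * (\<chi> i. Im (p i)) $ j))"
    using assms c
    by (simp add: grad_form_chart[OF _ _ c] C1M_bounded_linear[OF bounded_linear_cnj] grad_chart_def cn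
        p_def[symmetric] distrib_left sum.distrib)
  also have "\<dots> \<ge> 0" using c by (intro add_nonneg_nonneg cometric_nonneg) auto
  finally show ?thesis .
qed

lemma continuous_grad_form:
  assumes "C1M f" "C1M h"
  shows "continuous_on UNIV (grad_form f h)"
proof -
  have "continuous_on (\<Union>c\<in>A. fst c) (grad_form f h)"
  proof (rule continuous_on_open_UN)
    fix c assume c: "c \<in> A"
    show "open (fst c)" by (rule open_dom[OF c])
    have "continuous_on (snd c ` fst c) (grad_chart c f h)"
      unfolding grad_chart_def
      by (intro continuous_intros C1_on_continuous[OF C1_cometric[OF c]]
          C1_on_continuous_partial_deriv[OF C1M_chart] assms c)
    then have "continuous_on (fst c) (\<lambda>x. grad_chart c f h (snd c x))"
      by (rule continuous_on_compose2[OF _ continuous_coord[OF c]]) auto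
    then show "continuous_on (fst c) (grad_form f h)"
      using grad_form_chart[OF assms c] by (simp cong: continuous_on_cong)
  qed
  moreover have "(\<Union>c\<in>A. fst c) = UNIV" using cover by blast
  ultimately show ?thesis by simp
qed

end

section \<open>The Riemannian volume\<close>

context closed_riemannian_manifold
begin

lemma sets_V [measurable_cong, simp]: "sets V = sets borel"
  using vol by (simp add: riemannian_volume_def)

lemma space_V [simp]: "space V = UNIV"
  using sets_eq_imp_space_eq[OF sets_V] by simp

lemma emeasure_V_chart:
  assumes "c \<in> A" "B \<in> sets borel" "B \<subseteq> fst c"
  shows "emeasure V B = (\<integral>\<^sup>+y\<in>snd c ` B. ennreal (density_coeff c y) \<partial>lborel)"
  using vol assms by (simp add: riemannian_volume_def density_coeff_def)

text \<open>The restriction of \<open>V\<close> to the domain of the chart and the image under the inverse chart of the weighted Lebesgue measure agree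
  on Borel sets by the definition of the volume, so they are equal as measures.\<close>

lemma chart_integral:
  fixes k :: "'m \<Rightarrow> complex"
  assumes c: "c \<in> A" and k: "k \<in> borel_measurable borel" and off: "\<And>x. x \<notin> fst c \<Longrightarrow> k x = 0"
  shows "(\<integral>x. k x \<partial>V) = (\<integral>y. (if y \<in> snd c ` fst c then density_coeff c y *\<^sub>R k (chart_inv c y) else 0) \<partial>lborel)"
proof -
  let ?U = "snd c ` fst c"
  define W where "W y = (if y \<in> ?U then density_coeff c y else 0)" for y
  define inv' where "inv' y = (if y \<in> ?U then chart_inv c y else undefined)" for y
  have U: "?U \<in> sets borel" using open_img[OF c] by simp
  have dom: "fst c \<in> sets borel" using open_dom[OF c] by simp
  have W[measurable]: "W \<in> borel_measurable borel" unfolding W_def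
    by (rule borel_measurable_continuous_on_if[OF U C1_on_continuous[OF C1_density[OF c]]]) simp
  have inv'[measurable]: "inv' \<in> borel_measurable borel" unfolding inv'_def
    by (rule borel_measurable_continuous_on_if[OF U continuous_chart_inv[OF c]]) simp
  have Wnn: "0 \<le> W y" for y using density_pos[OF c, of y] by (auto simp: W_def)
  have eq: "density V (\<lambda>x. ennreal (indicator (fst c) x)) = distr (density lborel (\<lambda>y. ennreal (W y))) borel inv'"
  proof (rule measure_eqI)
    fix B assume "B \<in> sets (density V (\<lambda>x. ennreal (indicator (fst c) x)))"
    then have B[measurable]: "B \<in> sets borel" by simp
    have "emeasure (density V (\<lambda>x. ennreal (indicator (fst c) x))) B = emeasure V (B \<inter> fst c)"
      using dom by (simp add: emeasure_density ennreal_indicator indicator_inter_arith[symmetric] Int_commute)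
    also have "\<dots> = (\<integral>\<^sup>+y\<in>snd c ` (B \<inter> fst c). ennreal (density_coeff c y) \<partial>lborel)"
      using dom by (intro emeasure_V_chart[OF c]) auto
    also have "\<dots> = (\<integral>\<^sup>+y. ennreal (W y) * indicator (inv' -` B \<inter> space borel) y \<partial>lborel)"
    proof (rule nn_integral_cong)
      fix y
      have "y \<in> snd c ` (B \<inter> fst c) \<longleftrightarrow> y \<in> ?U \<and> chart_inv c y \<in> B"
      proof
        assume "y \<in> snd c ` (B \<inter> fst c)"
        then show "y \<in> ?U \<and> chart_inv c y \<in> B" using chart_inv_coord[OF c] by auto
      next
        assume y: "y \<in> ?U \<and> chart_inv c y \<in> B"
        then have "snd c (chart_inv c y) \<in> snd c ` (B \<inter> fst c)" using chart_inv_in[OF c] by (intro imageI) auto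
        then show "y \<in> snd c ` (B \<inter> fst c)" using y coord_chart_inv[OF c] by simp
      qed
      then show "ennreal (density_coeff c y) * indicator (snd c ` (B \<inter> fst c)) y =
          ennreal (W y) * indicator (inv' -` B \<inter> space borel) y"
        by (auto simp: W_def inv'_def indicator_def)
    qed
    also have "\<dots> = emeasure (distr (density lborel (\<lambda>y. ennreal (W y))) borel inv') B"
    proof -
      have "inv' -` B \<inter> space borel \<in> sets borel" by (rule measurable_sets[OF inv' B])
      then show ?thesis using W inv' B by (simp add: emeasure_distr emeasure_density)
    qed
    finally show "emeasure (density V (\<lambda>x. ennreal (indicator (fst c) x))) B =
        emeasure (distr (density lborel (\<lambda>y. ennreal (W y))) borel inv') B" .
  qed simp
  have "(\<integral>x. k x \<partial>V) = (\<integral>x. indicator (fst c) x *\<^sub>R k x \<partial>V)"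
    by (rule Bochner_Integration.integral_cong) (auto simp: indicator_def off)
  also have "\<dots> = (\<integral>x. k x \<partial>density V (\<lambda>x. ennreal (indicator (fst c) x)))"
    using k dom by (intro integral_density[symmetric]) auto
  also have "\<dots> = (\<integral>y. k (inv' y) \<partial>density lborel (\<lambda>y. ennreal (W y)))"
    unfolding eq using k by (intro integral_distr) auto
  also have "\<dots> = (\<integral>y. W y *\<^sub>R k (inv' y) \<partial>lborel)"
    using k Wnn by (intro integral_density) auto
  also have "\<dots> = (\<integral>y. (if y \<in> ?U then density_coeff c y *\<^sub>R k (chart_inv c y) else 0) \<partial>lborel)"
    by (rule Bochner_Integration.integral_cong) (auto simp: W_def inv'_def)
  finally show ?thesis .
qed

text \<open>A small coordinate ball has finite volume because the density is bounded on its closure, and finitely many such balls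
  cover the manifold.\<close>

lemma finite_V: "finite_measure V"
proof -
  have "\<exists>O'. open O' \<and> x \<in> O' \<and> emeasure V O' < \<infinity>" for x
  proof -
    obtain c where c: "c \<in> A" "x \<in> fst c" by (rule cover)
    obtain r where r: "0 < r" "cball (snd c x) r \<subseteq> snd c ` fst c"
      using open_img[OF c(1)] c open_contains_cball by blast
    define B where "B = ball (snd c x) r"
    have BU: "B \<subseteq> snd c ` fst c" using r ball_subset_cball unfolding B_def by blast
    define O' where "O' = fst c \<inter> snd c -` B"
    have O'open: "open O'"
      unfolding O'_def B_def
      by (rule continuous_open_preimage[OF continuous_coord[OF c(1)] open_dom[OF c(1)] open_ball])
    have xO: "x \<in> O'" using c r by (simp add: O'_def B_def)
    have img: "snd c ` O' = B" using BU unfolding O'_def by blast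
    have "compact (density_coeff c ` cball (snd c x) r)"
      by (rule compact_continuous_image[OF continuous_on_subset[OF C1_on_continuous[OF C1_density[OF c(1)]] r(2)] compact_cball])
    from compact_imp_bounded[OF this] have "\<exists>K. \<forall>y\<in>cball (snd c x) r. norm (density_coeff c y) \<le> K"
      unfolding bounded_iff by simp
    then obtain K where K: "\<forall>y\<in>cball (snd c x) r. norm (density_coeff c y) \<le> K" by (elim exE)
    have "emeasure V O' = (\<integral>\<^sup>+y\<in>B. ennreal (density_coeff c y) \<partial>lborel)"
      unfolding img[symmetric] using O'open by (intro emeasure_V_chart[OF c(1)]) (auto simp: O'_def)
    also have "\<dots> \<le> (\<integral>\<^sup>+y. ennreal K * indicator (cball (snd c x) r) y \<partial>lborel)"
    proof (rule nn_integral_mono)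
      fix y
      have "density_coeff c y \<le> K" if "y \<in> cball (snd c x) r"
        using bspec[OF K that] by simp
      then show "ennreal (density_coeff c y) * indicator B y \<le> ennreal K * indicator (cball (snd c x) r) y"
        using ball_subset_cball[of "snd c x" r] by (auto simp: indicator_def B_def intro!: ennreal_leI)
    qed
    also have "\<dots> = ennreal K * emeasure lborel (cball (snd c x) r)"
      by (rule nn_integral_cmult_indicator) simp
    also have "\<dots> < \<infinity>"
      using emeasure_compact_finite[OF compact_cball, of "snd c x" r] by (simp add: ennreal_mult_less_top)
    finally show ?thesis using O'open xO by blast
  qed
  then obtain N where N: "\<And>x. open (N x)" "\<And>x. x \<in> N x" "\<And>x. emeasure V (N x) < \<infinity>" by metis
  obtain X where X: "finite X" "UNIV \<subseteq> (\<Union>x\<in>X. N x)"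
    by (rule compactE_image[OF compact_UNIV, of UNIV N]) (use N in auto)
  have "emeasure V UNIV \<le> emeasure V (\<Union>x\<in>X. N x)"
    using X N by (intro emeasure_mono) auto
  also have "\<dots> \<le> (\<Sum>x\<in>X. emeasure V (N x))"
    using X N by (intro emeasure_subadditive_finite) auto
  also have "\<dots> < \<infinity>" using N by (simp add: ennreal_sum_less_top X)
  finally show ?thesis by (intro finite_measureI) simp
qed

sublocale finite_measure V by (rule finite_V)

lemma integrable_continuous:
  fixes k :: "'m \<Rightarrow> 'b::{banach, second_countable_topology}"
  assumes "continuous_on UNIV k"
  shows "integrable V k"
proof -
  have "bounded (range k)"
    by (rule compact_imp_bounded[OF compact_continuous_image[OF assms compact_UNIV]])
  then obtain K where "\<And>x. norm (k x) \<le> K" unfolding bounded_iff by auto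
  then show ?thesis
    using borel_measurable_continuous_onI[OF assms]
    by (intro integrable_const_bound[where B = K]) (auto simp: measurable_cong_sets[OF sets_V refl])
qed

lemma borel_measurable_C1M: "C1M f \<Longrightarrow> f \<in> borel_measurable V"
  using borel_measurable_continuous_onI[OF C1M_continuous] by (simp add: measurable_cong_sets[OF sets_V refl])

lemma emeasure_open_pos:
  assumes "open O'" "O' \<noteq> {}"
  shows "emeasure V O' > 0"
proof -
  obtain x where x: "x \<in> O'" using assms by blast
  obtain c where c: "c \<in> A" "x \<in> fst c" by (rule cover)
  let ?B = "snd c ` (O' \<inter> fst c)"
  have B: "open ?B" by (rule open_coord_image[OF c(1) open_Int[OF assms(1) open_dom[OF c(1)]]]) simp
  have m: "(\<lambda>y. ennreal (density_coeff c y) * indicator ?B y) \<in> borel_measurable lborel"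
  proof -
    have "(\<lambda>y. if y \<in> ?B then ennreal (density_coeff c y) else 0) \<in> borel_measurable borel"
      using B continuous_on_subset[OF C1_on_continuous[OF C1_density[OF c(1)]] image_mono[OF Int_lower2]]
      by (intro borel_measurable_continuous_on_if continuous_on_ennreal) auto
    moreover have "(\<lambda>y. ennreal (density_coeff c y) * indicator ?B y) = (\<lambda>y. if y \<in> ?B then ennreal (density_coeff c y) else 0)"
      by (auto simp: indicator_def)
    ultimately show ?thesis by simp
  qed
  have "emeasure V (O' \<inter> fst c) \<noteq> 0"
  proof
    assume "emeasure V (O' \<inter> fst c) = 0"
    then have "(\<integral>\<^sup>+y\<in>?B. ennreal (density_coeff c y) \<partial>lborel) = 0"
      using emeasure_V_chart[OF c(1), of "O' \<inter> fst c"] assms(1) open_dom[OF c(1)] by auto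
    then have "AE y in lborel. ennreal (density_coeff c y) * indicator ?B y = 0"
      using nn_integral_0_iff_AE[OF m] by simp
    then have "AE y in lborel. y \<notin> ?B"
    proof eventually_elim
      case (elim y)
      have "ennreal (density_coeff c y) \<noteq> 0" if "y \<in> ?B"
        using density_pos[OF c(1), of y] that by (auto simp: ennreal_eq_0_iff not_le)
      then show ?case using elim by (auto simp: indicator_def)
    qed
    moreover have "?B \<in> sets lborel" using B by simp
    ultimately have "?B \<in> null_sets lborel"
      using AE_iff_null_sets[of ?B lborel] by blast
    then have "negligible ?B"
      unfolding negligible_iff_null_sets by (rule null_sets_completionI)
    moreover have "?B \<noteq> {}" using x c by blast
    ultimately show False using open_not_negligible[OF B] by blast
  qed
  moreover have "emeasure V (O' \<inter> fst c) \<le> emeasure V O'"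
    using assms by (intro emeasure_mono) auto
  ultimately show ?thesis by (auto simp: zero_less_iff_neq_zero)
qed

section \<open>Green's formula\<close>

definition chart_lap :: "('m, 'n) chart \<Rightarrow> ('m \<Rightarrow> complex) \<Rightarrow> 'm \<Rightarrow> complex" where
  "chart_lap c \<phi> x = chart_laplacian (g c) (\<phi> \<circ> chart_inv c) (snd c x)"

text \<open>The vector field \<open>|g|\<^sup>1\<^sup>/\<^sup>2 g\<^sup>i\<^sup>j \<partial>\<^sub>j \<phi>\<close>, whose Euclidean divergence is \<open>|g|\<^sup>1\<^sup>/\<^sup>2 \<Delta> \<phi>\<close>.\<close>

definition flux :: "('m, 'n) chart \<Rightarrow> ('m \<Rightarrow> complex) \<Rightarrow> 'n \<Rightarrow> real^'n \<Rightarrow> complex" where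
  "flux c \<phi> i y = (\<Sum>j\<in>UNIV. (density_coeff c y * cometric c y $ i $ j) *\<^sub>R partial_deriv j (\<lambda>y. \<phi> (chart_inv c y)) y)"

lemma chart_lap_flux:
  "chart_lap c \<phi> x = (1 / density_coeff c (snd c x)) *\<^sub>R (\<Sum>i\<in>UNIV. partial_deriv i (flux c \<phi> i) (snd c x))"
  unfolding chart_lap_def chart_laplacian_def flux_def[abs_def] density_coeff_def cometric_def o_def ..

lemma C1_flux:
  assumes "c \<in> A" "smooth_fun A \<phi>"
  shows "C1_on (flux c \<phi> i) (snd c ` fst c)"
proof -
  have "smooth_on (\<lambda>y. \<phi> (chart_inv c y)) (snd c ` fst c)"
    using assms by (auto simp: smooth_fun_def o_def)
  then show ?thesis
    unfolding flux_def[abs_def]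
    by (intro C1_on_sum C1_on_scaleR C1_on_mult C1_density C1_cometric assms smooth_on_imp_C1_on
        smooth_on_partial_deriv)
qed

lemma continuous_chart_lap:
  assumes c: "c \<in> A" and \<phi>: "smooth_fun A \<phi>"
  shows "continuous_on (fst c) (chart_lap c \<phi>)"
proof -
  have "continuous_on (snd c ` fst c) (\<lambda>y. (1 / density_coeff c y) *\<^sub>R (\<Sum>i\<in>UNIV. partial_deriv i (flux c \<phi> i) y))"
    using density_pos[OF c]
    by (intro continuous_intros C1_on_continuous[OF C1_density[OF c]] C1_on_continuous_partial_deriv[OF C1_flux[OF c \<phi>]]) force
  from continuous_on_compose2[OF this continuous_coord[OF c]] show ?thesis
    unfolding chart_lap_flux by auto
qed

lemma continuous_cutoff_mult:
  fixes f k :: "'m \<Rightarrow> complex"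
  assumes "C1M f" "open O'" "continuous_on O' k" "closed K" "K \<subseteq> O'" "\<And>x. x \<notin> K \<Longrightarrow> f x = 0"
  shows "continuous_on UNIV (\<lambda>x. if x \<in> O' then f x * k x else 0)"
proof -
  have "continuous_on (O' \<union> - K) (\<lambda>x. if x \<in> O' then f x * k x else 0)"
  proof (rule continuous_on_open_Un)
    have "continuous_on O' (\<lambda>x. f x * k x)"
      by (intro continuous_intros assms continuous_on_subset[OF C1M_continuous[OF assms(1)]]) auto
    then show "continuous_on O' (\<lambda>x. if x \<in> O' then f x * k x else 0)"
      by (simp cong: continuous_on_cong)
    have "continuous_on (-K) (\<lambda>x. if x \<in> O' then f x * k x else 0) \<longleftrightarrow> continuous_on (-K) (\<lambda>x. 0 :: complex)"
      by (rule continuous_on_cong) (auto simp: assms(6))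
    then show "continuous_on (-K) (\<lambda>x. if x \<in> O' then f x * k x else 0)" by simp
  qed (use assms in auto)
  moreover have "O' \<union> - K = UNIV" using assms by blast
  ultimately show ?thesis by simp
qed

text \<open>In coordinates the sum of the two integrands is the Euclidean divergence of \<open>f\<close> times the flux of \<open>\<phi>\<close>. This vector
  field has compact support, so its extension by zero is continuously differentiable and its divergence has integral zero.\<close>

lemma green_in_chart:
  assumes c: "c \<in> A" and f: "C1M f" and \<phi>: "smooth_fun A \<phi>"
    and K: "compact K" "K \<subseteq> snd c ` fst c" and off: "\<And>x. x \<notin> chart_inv c ` K \<Longrightarrow> f x = 0"
  shows "(\<integral>x. (if x \<in> fst c then f x * chart_lap c \<phi> x else 0) \<partial>V) = - (\<integral>x. grad_form f \<phi> x \<partial>V)"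
proof -
  let ?U = "snd c ` fst c"
  have C\<phi>: "C1M \<phi>" by (rule C1M_smooth[OF \<phi>])
  have Kcl: "closed (chart_inv c ` K)" by (rule compact_imp_closed[OF compact_chart_inv_image[OF c K]])
  have Kdom: "chart_inv c ` K \<subseteq> fst c" using chart_inv_in[OF c] K by blast
  define F where "F y = f (chart_inv c y)" for y
  have FC1: "C1_on F ?U" unfolding F_def[abs_def] by (rule C1M_chart[OF f c])
  have Foff: "F y = 0" if "y \<in> ?U" "y \<notin> K" for y
    unfolding F_def
  proof (rule off, rule notI)
    assume "chart_inv c y \<in> chart_inv c ` K"
    then obtain z where z: "z \<in> K" "chart_inv c y = chart_inv c z" by (elim imageE)
    have "y = snd c (chart_inv c y)" using coord_chart_inv[OF c that(1)] by simp
    also have "\<dots> = z" unfolding z(2) by (rule coord_chart_inv[OF c subsetD[OF K(2) z(1)]])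
    finally show False using z that by simp
  qed
  define H where "H i y = (if y \<in> ?U then F y * flux c \<phi> i y else 0)" for i y
  have Hoff: "H i y = 0" if "y \<notin> K" for i y using Foff that by (auto simp: H_def)
  have oU: "open ?U" by (rule open_img[OF c])
  have HC1: "C1_on (H i) UNIV" for i
  proof -
    have oK: "open (-K)" using compact_imp_closed[OF K(1)] by (rule open_Compl)
    have 1: "C1_on (H i) ?U"
      by (rule C1_on_cong[OF C1_on_mult[OF FC1 C1_flux[OF c \<phi>]] oU]) (auto simp: H_def)
    have 2: "C1_on (H i) (-K)"
      by (rule C1_on_cong[OF C1_on_const[of 0] oK]) (auto simp: Hoff)
    have "?U \<union> -K = UNIV" using K by blast
    then show ?thesis using C1_on_Un[OF 1 2 oU oK] by simp
  qed
  have dH: "partial_deriv i (H i) y = (if y \<in> ?U then F y * partial_deriv i (flux c \<phi> i) y + partial_deriv i F y * flux c \<phi> i y else 0)" for i y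
  proof (cases "y \<in> ?U")
    case True
    have "partial_deriv i (H i) y = partial_deriv i (\<lambda>y. F y * flux c \<phi> i y) y"
      by (rule partial_deriv_cong_open[OF oU True]) (simp add: H_def)
    also have "\<dots> = F y * partial_deriv i (flux c \<phi> i) y + partial_deriv i F y * flux c \<phi> i y"
      by (rule partial_deriv_mult[OF C1_on_differentiable[OF FC1 True] C1_on_differentiable[OF C1_flux[OF c \<phi>] True]])
    finally show ?thesis using True by simp
  next
    case False
    have "partial_deriv i (H i) y = partial_deriv i (\<lambda>y. 0) y"
      by (rule partial_deriv_cong_open[of "-K"])
         (use False K Hoff in \<open>auto intro: open_Compl compact_imp_closed\<close>)
    then show ?thesis using False by simp
  qed
  have grad0: "grad_form f \<phi> x = 0" if "x \<notin> fst c" for x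
    by (rule grad_form_local[OF f C\<phi>, of "- (chart_inv c ` K)"]) (use that Kdom Kcl off in auto)
  define k1 where "k1 x = (if x \<in> fst c then f x * chart_lap c \<phi> x else 0)" for x
  have k1c: "continuous_on UNIV k1"
    unfolding k1_def[abs_def]
    by (rule continuous_cutoff_mult[OF f open_dom[OF c] continuous_chart_lap[OF c \<phi>] Kcl Kdom off])
  have k2c: "continuous_on UNIV (grad_form f \<phi>)" by (rule continuous_grad_form[OF f C\<phi>])
  have "(\<integral>x. k1 x + grad_form f \<phi> x \<partial>V) =
    (\<integral>y. (if y \<in> ?U then density_coeff c y *\<^sub>R (k1 (chart_inv c y) + grad_form f \<phi> (chart_inv c y)) else 0) \<partial>lborel)"
  proof (rule chart_integral[OF c])
    show "(\<lambda>x. k1 x + grad_form f \<phi> x) \<in> borel_measurable borel"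
      by (intro borel_measurable_continuous_onI continuous_on_add k1c k2c)
    show "k1 x + grad_form f \<phi> x = 0" if "x \<notin> fst c" for x
      using that by (simp add: k1_def grad0)
  qed
  also have "\<dots> = (\<integral>y. (\<Sum>i\<in>UNIV. partial_deriv i (H i) y) \<partial>lborel)"
  proof (rule Bochner_Integration.integral_cong[OF refl])
    fix y
    show "(if y \<in> ?U then density_coeff c y *\<^sub>R (k1 (chart_inv c y) + grad_form f \<phi> (chart_inv c y)) else 0)
       = (\<Sum>i\<in>UNIV. partial_deriv i (H i) y)"
    proof (cases "y \<in> ?U")
      case True
      then have x: "chart_inv c y \<in> fst c" "snd c (chart_inv c y) = y"
        using chart_inv_in[OF c] coord_chart_inv[OF c] by auto
      have "density_coeff c y *\<^sub>R k1 (chart_inv c y) = F y * (\<Sum>i\<in>UNIV. partial_deriv i (flux c \<phi> i) y)"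
        using x density_pos[OF c True] by (simp add: k1_def chart_lap_flux F_def)
      moreover have "density_coeff c y *\<^sub>R grad_form f \<phi> (chart_inv c y) = (\<Sum>i\<in>UNIV. partial_deriv i F y * flux c \<phi> i y)"
        unfolding grad_form_chart[OF f C\<phi> c x(1)] x(2) grad_chart_def flux_def F_def[symmetric, abs_def]
        by (simp add: scaleR_sum_right sum_distrib_left F_def[abs_def])
      ultimately show ?thesis
        using True by (simp add: dH scaleR_add_right sum.distrib sum_distrib_left)
    next
      case False then show ?thesis by (simp add: dH)
    qed
  qed
  also have "\<dots> = (\<Sum>i\<in>UNIV. \<integral>y. partial_deriv i (H i) y \<partial>lborel)"
    unfolding partial_deriv_def
    by (rule Bochner_Integration.integral_sum) (rule integral_derivative_eq_0(1)[OF K(1) HC1 Hoff])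
  also have "\<dots> = 0"
    unfolding partial_deriv_def by (intro sum.neutral ballI integral_derivative_eq_0(2)[OF K(1) HC1 Hoff])
  finally have "(\<integral>x. k1 x \<partial>V) + (\<integral>x. grad_form f \<phi> x \<partial>V) = 0"
    by (subst (asm) Bochner_Integration.integral_add) (auto intro: integrable_continuous k1c k2c)
  then show ?thesis unfolding k1_def by (simp add: eq_neg_iff_add_eq_0)
qed

text \<open>The weak form of the chart Laplacian involves only the volume and the gradient form, which do
  not depend on the chart; so two charts give the same continuous function on their overlap.\<close>

lemma chart_lap_indep:
  assumes c: "c \<in> A" and d: "d \<in> A" and \<phi>: "smooth_fun A \<phi>" and x: "x \<in> fst c" "x \<in> fst d"
  shows "chart_lap c \<phi> x = chart_lap d \<phi> x"
proof (rule ccontr)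
  assume neq: "chart_lap c \<phi> x \<noteq> chart_lap d \<phi> x"
  define h where "h z = chart_lap c \<phi> z - chart_lap d \<phi> z" for z
  define P where "P z = Re (h z * cnj (h x))" for z
  let ?D = "fst c \<inter> fst d"
  have oD: "open ?D" by (intro open_Int open_dom c d)
  have hcont: "continuous_on ?D h"
    unfolding h_def
    by (intro continuous_intros continuous_on_subset[OF continuous_chart_lap[OF c \<phi>]]
        continuous_on_subset[OF continuous_chart_lap[OF d \<phi>]]) auto
  have Pcont: "continuous_on ?D P" unfolding P_def by (intro continuous_intros hcont)
  define O' where "O' = ?D \<inter> P -` {0<..}"
  have oO: "open O'" unfolding O'_def by (rule continuous_open_preimage[OF Pcont oD open_greaterThan])
  have "P x = (cmod (h x))\<^sup>2" unfolding P_def by (simp add: complex_norm_square[symmetric] del: of_real_power)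
  then have "P x > 0" using neq by (simp add: h_def)
  then have xO: "x \<in> O'" using x by (simp add: O'_def)
  have Oc: "O' \<subseteq> fst c" and Od: "O' \<subseteq> fst d" by (auto simp: O'_def)
  \<comment> \<open>test the weak form against a bump supported where the difference of the two Laplacians has positive inner product with its value at \<open>x\<close>\<close>
  obtain b :: "'m \<Rightarrow> real" and K
    where b: "C1M b" "\<And>z. 0 \<le> b z" "0 < b x" and K: "compact K" "K \<subseteq> snd c ` O'"
      and boff: "\<And>z. z \<notin> chart_inv c ` K \<Longrightarrow> b z = 0"
    by (rule bump_function[OF c oO Oc xO]) blast
  define f where "f z = complex_of_real (b z)" for z
  have f: "C1M f" unfolding f_def[abs_def] by (rule C1M_of_real[OF b(1)])
  have Kc: "K \<subseteq> snd c ` fst c" using K Oc by blast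
  have KO: "chart_inv c ` K \<subseteq> O'" using K chart_inv_coord[OF c] Oc by force
  have Kcomp: "compact (chart_inv c ` K)" by (rule compact_chart_inv_image[OF c K(1) Kc])
  have Kcl: "closed (chart_inv c ` K)" by (rule compact_imp_closed[OF Kcomp])
  define K' where "K' = snd d ` chart_inv c ` K"
  have K': "compact K'" "K' \<subseteq> snd d ` fst d"
    using KO Od unfolding K'_def
    by (auto intro!: compact_continuous_image[OF continuous_on_subset[OF continuous_coord[OF d]] Kcomp])
  have "chart_inv d ` K' = chart_inv c ` K"
    unfolding K'_def image_image using KO Od chart_inv_coord[OF d] by (intro image_cong) auto
  then have foff: "\<And>z. z \<notin> chart_inv c ` K \<Longrightarrow> f z = 0" "\<And>z. z \<notin> chart_inv d ` K' \<Longrightarrow> f z = 0"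
    using boff by (auto simp: f_def)
  define k where "k e z = (if z \<in> fst e then f z * chart_lap e \<phi> z else 0)" for e z
  have kint: "integrable V (k c)" "integrable V (k d)"
  proof -
    have "integrable V (k e)" if e: "e \<in> A" "chart_inv c ` K \<subseteq> fst e" for e
      unfolding k_def[abs_def]
      by (rule integrable_continuous[OF continuous_cutoff_mult[OF f open_dom[OF e(1)]
            continuous_chart_lap[OF e(1) \<phi>] Kcl e(2) foff(1)]])
    then show "integrable V (k c)" "integrable V (k d)" using c d KO Oc Od by blast+
  qed
  have "(\<integral>z. k c z \<partial>V) = (\<integral>z. k d z \<partial>V)"
    using green_in_chart[OF c f \<phi> K(1) Kc foff(1)] green_in_chart[OF d f \<phi> K' foff(2)]
    unfolding k_def by (rule trans[OF _ sym])
  then have zero: "(\<integral>z. (k c z - k d z) * cnj (h x) \<partial>V) = 0"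
    using kint by simp
  have ptw: "(k c z - k d z) * cnj (h x) = f z * (h z * cnj (h x))" for z
  proof (cases "z \<in> chart_inv c ` K")
    case True
    then have "z \<in> fst c" "z \<in> fst d" using KO Oc Od by auto
    then show ?thesis by (simp add: k_def h_def algebra_simps)
  next
    case False then show ?thesis by (simp add: k_def foff(1))
  qed
  have int0: "integrable V (\<lambda>z. (k c z - k d z) * cnj (h x))" using kint by simp
  note int = int0[unfolded ptw] and zero = zero[unfolded ptw]
  then have "(\<integral>z. Re (f z * (h z * cnj (h x))) \<partial>V) = 0" by (subst integral_Re[OF int]) simp
  then have "(\<integral>z. b z * P z \<partial>V) = 0" and "integrable V (\<lambda>z. b z * P z)"
    using integrable_Re[OF int] by (simp_all add: f_def P_def)
  moreover have nn: "0 \<le> b z * P z" for z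
    using b boff[of z] KO by (cases "z \<in> chart_inv c ` K") (auto simp: O'_def)
  ultimately have "AE z in V. b z * P z = 0"
    using integral_nonneg_eq_0_iff_AE by blast
  moreover define Z where "Z = b -` {0<..}"
  have oZ: "open Z"
    unfolding Z_def using continuous_open_preimage[OF C1M_continuous[OF b(1)] open_UNIV open_greaterThan] by simp
  have "b z * P z \<noteq> 0" if "z \<in> Z" for z
    using that boff[of z] KO by (cases "z \<in> chart_inv c ` K") (auto simp: O'_def Z_def)
  ultimately have "AE z in V. z \<notin> Z" by (auto elim: eventually_mono)
  moreover have "Z \<in> sets V" using oZ by simp
  ultimately have "Z \<in> null_sets V" using AE_iff_null_sets by blast
  then have "emeasure V Z = 0" by auto
  moreover have "x \<in> Z" using b by (simp add: Z_def)
  ultimately show False using emeasure_open_pos[OF oZ] by auto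
qed

lemma laplacian_chart:
  assumes "c \<in> A" "x \<in> fst c" "smooth_fun A \<phi>"
  shows "laplacian A g \<phi> x = chart_lap c \<phi> x"
proof -
  define d where "d = (SOME c. c \<in> A \<and> x \<in> fst c)"
  have "d \<in> A \<and> x \<in> fst d" unfolding d_def by (rule someI[of _ c]) (use assms in auto)
  then show ?thesis
    unfolding laplacian_def d_def[symmetric] Let_def chart_lap_def[symmetric]
    using assms by (intro chart_lap_indep) auto
qed

lemma continuous_laplacian:
  assumes "smooth_fun A \<phi>"
  shows "continuous_on UNIV (laplacian A g \<phi>)"
proof -
  have "continuous_on (\<Union>c\<in>A. fst c) (laplacian A g \<phi>)"
  proof (rule continuous_on_open_UN)
    fix c assume c: "c \<in> A"
    show "open (fst c)" by (rule open_dom[OF c])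
    show "continuous_on (fst c) (laplacian A g \<phi>)"
      using continuous_chart_lap[OF c assms] laplacian_chart[OF c _ assms] by (simp cong: continuous_on_cong)
  qed
  moreover have "(\<Union>c\<in>A. fst c) = UNIV" using cover by blast
  ultimately show ?thesis by simp
qed

text \<open>The bumps \<open>b x\<close> of a finite cover have a positive sum \<open>S\<close>, so \<open>f\<close> is the sum of the functions \<open>b x f / S\<close>, each supported in
  one chart; the local formula is additive because Laplacian and gradient form do not depend on the chart.\<close>

theorem green:
  assumes f: "C1M f" and \<phi>: "smooth_fun A \<phi>"
  shows "(\<integral>x. f x * laplacian A g \<phi> x \<partial>V) = - (\<integral>x. grad_form f \<phi> x \<partial>V)"
proof -
  have "\<exists>c b K. c \<in> A \<and> C1M b \<and> (\<forall>z. 0 \<le> b z) \<and> 0 < b x \<and> compact K \<and> K \<subseteq> snd c ` fst c \<and>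
      (\<forall>z. z \<notin> chart_inv c ` K \<longrightarrow> b z = (0::real))" for x
  proof -
    obtain c where c: "c \<in> A" "x \<in> fst c" by (rule cover)
    show ?thesis by (rule bump_function[OF c(1) open_dom[OF c(1)] order_refl c(2)]) (use c in blast)
  qed
  then obtain c b K where c: "\<And>x. c x \<in> A" and b: "\<And>x. C1M (b x)" "\<And>x z. 0 \<le> b x z" "\<And>x. 0 < b x x"
    and K: "\<And>x. compact (K x)" "\<And>x. K x \<subseteq> snd (c x) ` fst (c x)"
    and off: "\<And>x z. z \<notin> chart_inv (c x) ` K x \<Longrightarrow> b x z = (0::real)"
    by metis
  have oZ: "open (b x -` {0<..})" for x
    using continuous_open_preimage[OF C1M_continuous[OF b(1)] open_UNIV open_greaterThan] by simp
  obtain X where X: "finite X" "UNIV \<subseteq> (\<Union>x\<in>X. b x -` {0<..})"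
    by (rule compactE_image[OF compact_UNIV, of UNIV "\<lambda>x. b x -` {0<..}"]) (use oZ b in auto)
  define S where "S z = (\<Sum>x\<in>X. b x z)" for z
  have S: "S z > 0" for z
  proof -
    obtain x where "x \<in> X" "b x z > 0" using X by blast
    then show ?thesis unfolding S_def using X b by (intro sum_pos2[of X x]) auto
  qed
  define k where "k x z = complex_of_real (b x z) * (complex_of_real (inverse (S z)) * f z)" for x z
  have SC1: "C1M S" unfolding S_def[abs_def] by (intro C1M_sum b)
  have k: "C1M (k x)" for x
    unfolding k_def
    by (intro C1M_mult C1M_of_real b C1M_inverse SC1 f) (use S in \<open>simp add: less_imp_neq[symmetric]\<close>)
  have fsum: "f = (\<lambda>z. \<Sum>x\<in>X. k x z)"
  proof
    fix z
    have "(\<Sum>x\<in>X. k x z) = complex_of_real (S z * inverse (S z)) * f z"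
      by (simp add: k_def S_def sum_distrib_right mult.assoc)
    then show "f z = (\<Sum>x\<in>X. k x z)" using S[of z] by simp
  qed
  have koff: "z \<notin> chart_inv (c x) ` K x \<Longrightarrow> k x z = 0" for x z by (simp add: k_def off)
  have 1: "(\<integral>z. k x z * laplacian A g \<phi> z \<partial>V) = - (\<integral>z. grad_form (k x) \<phi> z \<partial>V)" for x
  proof -
    have "chart_inv (c x) ` K x \<subseteq> fst (c x)" using chart_inv_in[OF c] K by blast
    then have "k x z * laplacian A g \<phi> z = (if z \<in> fst (c x) then k x z * chart_lap (c x) \<phi> z else 0)" for z
      using koff[of z x] laplacian_chart[OF c _ \<phi>] by auto
    then show ?thesis using green_in_chart[OF c k \<phi> K koff] by simp
  qed
  have int1: "integrable V (\<lambda>z. k x z * laplacian A g \<phi> z)" for x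
    by (intro integrable_continuous continuous_on_mult continuous_laplacian \<phi> C1M_continuous k)
  have int2: "integrable V (grad_form (k x) \<phi>)" for x
    by (intro integrable_continuous continuous_grad_form k C1M_smooth \<phi>)
  have "(\<integral>z. f z * laplacian A g \<phi> z \<partial>V) = (\<integral>z. (\<Sum>x\<in>X. k x z * laplacian A g \<phi> z) \<partial>V)"
    by (subst fsum) (simp add: sum_distrib_right)
  also have "\<dots> = (\<Sum>x\<in>X. - (\<integral>z. grad_form (k x) \<phi> z \<partial>V))"
    by (subst Bochner_Integration.integral_sum[OF int1]) (simp add: 1)
  also have "\<dots> = - (\<integral>z. (\<Sum>x\<in>X. grad_form (k x) \<phi> z) \<partial>V)"
    by (subst Bochner_Integration.integral_sum[OF int2]) (simp add: sum_negf)
  also have "(\<lambda>z. \<Sum>x\<in>X. grad_form (k x) \<phi> z) = grad_form f \<phi>"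
  proof
    fix z
    have "grad_form (\<lambda>z. \<Sum>x\<in>X. k x z) \<phi> z = (\<Sum>x\<in>X. grad_form (k x) \<phi> z)"
      by (rule grad_form_sum_left[OF k C1M_smooth[OF \<phi>]])
    then show "(\<Sum>x\<in>X. grad_form (k x) \<phi> z) = grad_form f \<phi> z"
      by (simp only: fsum[symmetric])
  qed
  finally show ?thesis .
qed

end

section \<open>Complex conjugation and the Laplacian\<close>

lemma Ck_on_cong:
  assumes "open S"
  shows "(\<And>x. x \<in> S \<Longrightarrow> f x = h x) \<Longrightarrow> Ck_on k f S \<Longrightarrow> Ck_on k h S"
proof (induction k arbitrary: f h)
  case 0
  then show ?case by (simp cong: continuous_on_cong)
next
  case (Suc k)
  have "h differentiable (at x)" if "x \<in> S" for x
  proof -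
    have "(f has_derivative frechet_derivative f (at x)) (at x)"
      using Suc.prems(2) that frechet_derivative_works by auto
    then have "(h has_derivative frechet_derivative f (at x)) (at x)"
      by (rule has_derivative_transform_within_open[OF _ assms that]) (rule Suc.prems(1))
    then show ?thesis by (rule differentiableI)
  qed
  moreover have "Ck_on k (partial_deriv i h) S" for i
  proof (rule Suc.IH[of "partial_deriv i f"])
    show "partial_deriv i f x = partial_deriv i h x" if "x \<in> S" for x
      by (rule partial_deriv_cong_open[OF assms that Suc.prems(1)])
    show "Ck_on k (partial_deriv i f) S" using Suc.prems(2) by simp
  qed
  ultimately show ?case by simp
qed

lemma Ck_on_bounded_linear:
  assumes "open S" "bounded_linear L"
  shows "Ck_on k f S \<Longrightarrow> Ck_on k (\<lambda>x. L (f x)) S"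
proof (induction k arbitrary: f)
  case 0
  then show ?case using bounded_linear.continuous_on[OF assms(2)] by simp
next
  case (Suc k)
  have d: "f differentiable (at x)" if "x \<in> S" for x using Suc.prems that by simp
  have "(\<lambda>x. L (f x)) differentiable (at x)" if "x \<in> S" for x
    using bounded_linear.has_derivative[OF assms(2) d[OF that, unfolded frechet_derivative_works]]
    by (rule differentiableI)
  moreover have "Ck_on k (partial_deriv i (\<lambda>x. L (f x))) S" for i
  proof (rule Ck_on_cong[OF assms(1)])
    show "Ck_on k (\<lambda>x. L (partial_deriv i f x)) S" using Suc by simp
    show "L (partial_deriv i f x) = partial_deriv i (\<lambda>x. L (f x)) x" if "x \<in> S" for x
      using partial_deriv_bounded_linear[OF assms(2) d[OF that]] by simp
  qed
  ultimately show ?case by simp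
qed

context closed_riemannian_manifold
begin

lemma smooth_fun_cnj:
  assumes "smooth_fun A \<phi>" shows "smooth_fun A (\<lambda>x. cnj (\<phi> x))"
  unfolding smooth_fun_def smooth_on_def o_def
proof (intro ballI allI)
  fix c k assume c: "c \<in> A"
  have "Ck_on k (\<lambda>y. \<phi> (chart_inv c y)) (snd c ` fst c)"
    using assms c unfolding smooth_fun_def smooth_on_def o_def by blast
  then show "Ck_on k (\<lambda>y. cnj (\<phi> (chart_inv c y))) (snd c ` fst c)"
    by (rule Ck_on_bounded_linear[OF open_img[OF c] bounded_linear_cnj])
qed

text \<open>The \<open>L\<^sup>2\<close> Laplacian is tested against functions without conjugation, whereas coefficients are inner products; so the
  conjugates of the eigenfunctions are needed as test functions.\<close>

lemma laplacian_cnj: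
  assumes \<phi>: "smooth_fun A \<phi>"
  shows "laplacian A g (\<lambda>x. cnj (\<phi> x)) x = cnj (laplacian A g \<phi> x)"
proof -
  obtain c where c: "c \<in> A" "x \<in> fst c" by (rule cover)
  let ?U = "snd c ` fst c"
  have y: "snd c x \<in> ?U" using c by blast
  have fl: "flux c (\<lambda>x. cnj (\<phi> x)) i z = cnj (flux c \<phi> i z)" if "z \<in> ?U" for i z
    unfolding flux_def
    using partial_deriv_bounded_linear[OF bounded_linear_cnj C1_on_differentiable[OF C1M_chart[OF C1M_smooth[OF \<phi>] c(1)] that]]
    by simp
  have "partial_deriv i (flux c (\<lambda>x. cnj (\<phi> x)) i) (snd c x) = cnj (partial_deriv i (flux c \<phi> i) (snd c x))" for i
  proof -
    have "partial_deriv i (flux c (\<lambda>x. cnj (\<phi> x)) i) (snd c x) = partial_deriv i (\<lambda>z. cnj (flux c \<phi> i z)) (snd c x)"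
      by (rule partial_deriv_cong_open[OF open_img[OF c(1)] y fl])
    also have "\<dots> = cnj (partial_deriv i (flux c \<phi> i) (snd c x))"
      by (rule partial_deriv_bounded_linear[OF bounded_linear_cnj C1_on_differentiable[OF C1_flux[OF c(1) \<phi>] y]])
    finally show ?thesis .
  qed
  then show ?thesis
    by (simp add: laplacian_chart[OF c] smooth_fun_cnj \<phi> chart_lap_flux)
qed

lemma grad_form_cnj:
  assumes "C1M f" "C1M h"
  shows "grad_form (\<lambda>x. cnj (f x)) (\<lambda>x. cnj (h x)) x = cnj (grad_form f h x)"
proof -
  obtain c where c: "c \<in> A" "x \<in> fst c" by (rule cover)
  show ?thesis
    using assms
    by (simp add: grad_form_chart[OF _ _ c] C1M_bounded_linear[OF bounded_linear_cnj] grad_chart_def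
        partial_deriv_bounded_linear[OF bounded_linear_cnj differentiable_chart[OF _ c]])
qed

lemma L2_continuous:
  assumes "continuous_on UNIV f" shows "f \<in> L2_space V"
  unfolding L2_space_def
  using assms borel_measurable_continuous_onI[OF assms]
  by (auto intro!: integrable_continuous continuous_intros simp: measurable_cong_sets[OF sets_V refl])

end

section \<open>Spectral expansions\<close>

locale laplace_spectrum = closed_riemannian_manifold A g V
  for A :: "('m::t2_space, 'n::finite) chart set" and g :: "('m, 'n) metric" and V :: "'m measure" +
  fixes lam :: "nat \<Rightarrow> real" and e :: "nat \<Rightarrow> 'm \<Rightarrow> complex"
  assumes basis: "laplace_eigenbasis A g V lam e"
begin

lemma lam_mono: "i \<le> j \<Longrightarrow> lam i \<le> lam j"
  using basis unfolding laplace_eigenbasis_def mono_def by blast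

lemma lam_nonneg: "0 \<le> lam j"
  using basis lam_mono[of 0 j] unfolding laplace_eigenbasis_def by simp

lemma e_smooth: "smooth_fun A (e j)"
  using basis unfolding laplace_eigenbasis_def by blast

lemma e_laplacian: "laplacian A g (e j) x = - of_real ((lam j)\<^sup>2) * e j x"
proof -
  have "laplacian A g (e j) x + of_real ((lam j)\<^sup>2) * e j x = 0"
    using basis unfolding laplace_eigenbasis_def by blast
  then show ?thesis by (simp add: eq_neg_iff_add_eq_0)
qed

lemma e_L2 [simp]: "e j \<in> L2_space V"
  using basis unfolding laplace_eigenbasis_def by blast

lemma e_inner: "L2_inner V (e j) (e k) = (if j = k then 1 else 0)"
  using basis unfolding laplace_eigenbasis_def by blast

lemma e_C1M: "C1M (e j)" by (rule C1M_smooth[OF e_smooth])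

definition coef :: "('m \<Rightarrow> complex) \<Rightarrow> nat \<Rightarrow> complex" where
  "coef f j = L2_inner V f (e j)"

definition psum :: "nat set \<Rightarrow> (nat \<Rightarrow> complex) \<Rightarrow> 'm \<Rightarrow> complex" where
  "psum J c x = (\<Sum>j\<in>J. c j * e j x)"

lemma expansion:
  "f \<in> L2_space V \<Longrightarrow> (\<lambda>N. Lp_norm V 2 (\<lambda>x. f x - psum {..<N} (coef f) x)) \<longlonglongrightarrow> 0"
  using basis unfolding laplace_eigenbasis_def coef_def psum_def by blast

lemma psum_L2 [simp]: "psum J c \<in> L2_space V"
  unfolding psum_def[abs_def] by (intro L2_sum L2_cmult e_L2)

lemma psum_C1M: "C1M (psum J c)"
  unfolding psum_def[abs_def] by (intro C1M_sum C1M_mult C1M_const e_C1M)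

lemma psum_borel [simp]: "psum J c \<in> borel_measurable V"
  by (rule L2_borel) simp

lemma coef_psum: "finite J \<Longrightarrow> coef (psum J c) k = (if k \<in> J then c k else 0)"
proof -
  assume J: "finite J"
  have "coef (psum J c) k = (\<Sum>j\<in>J. c j * L2_inner V (e j) (e k))"
    unfolding coef_def psum_def[abs_def]
    by (subst L2_inner_sum_left) (auto intro: L2_cmult simp: L2_inner_cmult_left)
  also have "\<dots> = (\<Sum>j\<in>J. if j = k then c j else 0)"
    by (rule sum.cong) (auto simp: e_inner)
  finally show ?thesis using J by simp
qed

lemma inner_psum: "finite J \<Longrightarrow> f \<in> L2_space V \<Longrightarrow> L2_inner V f (psum J c) = (\<Sum>j\<in>J. cnj (c j) * coef f j)"
proof -
  assume J: "finite J" and f: "f \<in> L2_space V"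
  have "L2_inner V f (psum J c) = cnj (\<Sum>j\<in>J. c j * L2_inner V (e j) f)"
    unfolding L2_inner_commute[of V f] psum_def[abs_def]
    by (subst L2_inner_sum_left) (auto intro: L2_cmult simp: L2_inner_cmult_left f)
  also have "\<dots> = (\<Sum>j\<in>J. cnj (c j) * coef f j)"
    by (simp add: coef_def L2_inner_commute[of V "e _" f])
  finally show ?thesis .
qed

lemma coef_diff: "f \<in> L2_space V \<Longrightarrow> h \<in> L2_space V \<Longrightarrow> coef (\<lambda>x. f x - h x) j = coef f j - coef h j"
  unfolding coef_def by (simp add: L2_inner_diff_left)

lemma coef_add: "f \<in> L2_space V \<Longrightarrow> h \<in> L2_space V \<Longrightarrow> coef (\<lambda>x. f x + h x) j = coef f j + coef h j"
  unfolding coef_def by (simp add: L2_inner_add_left)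

lemma coef_cmult: "coef (\<lambda>x. c * f x) j = c * coef f j"
  unfolding coef_def by (rule L2_inner_cmult_left)

lemma norm_psum:
  assumes J: "finite J" shows "(\<integral>x. (norm (psum J c x))\<^sup>2 \<partial>V) = (\<Sum>j\<in>J. (norm (c j))\<^sup>2)"
proof -
  have "complex_of_real (\<integral>x. (norm (psum J c x))\<^sup>2 \<partial>V) = (\<Sum>j\<in>J. cnj (c j) * coef (psum J c) j)"
    unfolding L2_inner_self[symmetric] using inner_psum[OF J] by simp
  also have "\<dots> = (\<Sum>j\<in>J. of_real ((norm (c j))\<^sup>2))"
    using J by (intro sum.cong) (auto simp: coef_psum complex_norm_square mult.commute simp del: of_real_power)
  finally show ?thesis by (simp only: of_real_sum[symmetric] of_real_eq_iff)
qed

lemma norm_diff_psum: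
  assumes J: "finite J" and f: "f \<in> L2_space V"
  shows "(\<integral>x. (norm (f x - psum J (coef f) x))\<^sup>2 \<partial>V) = (\<integral>x. (norm (f x))\<^sup>2 \<partial>V) - (\<Sum>j\<in>J. (norm (coef f j))\<^sup>2)"
proof -
  let ?w = "psum J (coef f)" and ?S = "\<Sum>j\<in>J. (norm (coef f j))\<^sup>2"
  have d: "(\<lambda>x. f x - ?w x) \<in> L2_space V" by (intro L2_diff f psum_L2)
  have fw: "L2_inner V f ?w = of_real ?S"
    unfolding inner_psum[OF J f] by (simp add: complex_norm_square mult.commute del: of_real_power)
  have ww: "L2_inner V ?w ?w = of_real ?S"
    unfolding L2_inner_self norm_psum[OF J] ..
  have "L2_inner V ?w f = of_real ?S" using L2_inner_commute[of V ?w f] fw by simp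
  have "L2_inner V (\<lambda>x. f x - ?w x) (\<lambda>x. f x - ?w x) =
      L2_inner V f (\<lambda>x. f x - ?w x) - L2_inner V ?w (\<lambda>x. f x - ?w x)"
    by (rule L2_inner_diff_left[OF f psum_L2 d])
  also have "L2_inner V f (\<lambda>x. f x - ?w x) = cnj (L2_inner V f f - L2_inner V ?w f)"
    by (subst L2_inner_commute) (simp add: L2_inner_diff_left f)
  also have "L2_inner V ?w (\<lambda>x. f x - ?w x) = cnj (L2_inner V f ?w - L2_inner V ?w ?w)"
    by (subst L2_inner_commute) (simp add: L2_inner_diff_left f)
  finally have "complex_of_real (\<integral>x. (norm (f x - ?w x))\<^sup>2 \<partial>V) = of_real ((\<integral>x. (norm (f x))\<^sup>2 \<partial>V) - ?S)"
    unfolding fw ww \<open>L2_inner V ?w f = of_real ?S\<close> unfolding L2_inner_self by simp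
  then show ?thesis by (simp only: of_real_eq_iff)
qed

lemma bessel:
  assumes "finite J" "f \<in> L2_space V"
  shows "(\<Sum>j\<in>J. (norm (coef f j))\<^sup>2) \<le> (\<integral>x. (norm (f x))\<^sup>2 \<partial>V)"
proof -
  have "0 \<le> (\<integral>x. (norm (f x - psum J (coef f) x))\<^sup>2 \<partial>V)" by (rule Bochner_Integration.integral_nonneg) simp
  then show ?thesis using norm_diff_psum[OF assms] by simp
qed

lemma parseval:
  assumes f: "f \<in> L2_space V"
  shows "(\<lambda>j. (norm (coef f j))\<^sup>2) sums (\<integral>x. (norm (f x))\<^sup>2 \<partial>V)"
proof -
  have "(\<lambda>N. \<integral>x. (norm (f x - psum {..<N} (coef f) x))\<^sup>2 \<partial>V) \<longlonglongrightarrow> 0"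
    using iffD1[OF Lp_norm_2_tendsto_0_iff expansion[OF f]] f by (simp add: L2_diff)
  then have "(\<lambda>N. (\<integral>x. (norm (f x))\<^sup>2 \<partial>V) - (\<Sum>j<N. (norm (coef f j))\<^sup>2)) \<longlonglongrightarrow> 0"
    by (simp add: norm_diff_psum[OF _ f])
  from tendsto_diff[OF tendsto_const this, of "\<integral>x. (norm (f x))\<^sup>2 \<partial>V"]
  show ?thesis by (simp add: sums_def)
qed

text \<open>The projections are defined by choosing some \<open>L\<^sup>2\<close> limit; this makes the choice immaterial.\<close>

lemma AE_eq_of_L2_limits:
  assumes "h \<in> L2_space V" "k \<in> L2_space V" "\<And>N. s N \<in> L2_space V"
    and "(\<lambda>N. Lp_norm V 2 (\<lambda>x. h x - s N x)) \<longlonglongrightarrow> 0" "(\<lambda>N. Lp_norm V 2 (\<lambda>x. k x - s N x)) \<longlonglongrightarrow> 0"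
  shows "AE x in V. h x = k x"
proof -
  have hk: "(\<lambda>x. h x - k x) \<in> L2_space V" by (intro L2_diff assms)
  have neg: "Lp_norm V 2 (\<lambda>x. s N x - k x) = Lp_norm V 2 (\<lambda>x. k x - s N x)" for N
    by (simp add: Lp_norm_def norm_minus_commute)
  have "Lp_norm V 2 (\<lambda>x. h x - k x) \<le> Lp_norm V 2 (\<lambda>x. h x - s N x) + Lp_norm V 2 (\<lambda>x. k x - s N x)" for N
  proof -
    have "Lp_norm V 2 (\<lambda>x. (h x - s N x) + (s N x - k x)) \<le> Lp_norm V 2 (\<lambda>x. h x - s N x) + Lp_norm V 2 (\<lambda>x. s N x - k x)"
      by (rule Lp_norm_triangle) (auto intro!: L2_borel L2_diff assms)
    then show ?thesis unfolding neg by simp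
  qed
  moreover have "(\<lambda>N. Lp_norm V 2 (\<lambda>x. h x - s N x) + Lp_norm V 2 (\<lambda>x. k x - s N x)) \<longlonglongrightarrow> 0"
    using tendsto_add[OF assms(4,5)] by simp
  ultimately have "Lp_norm V 2 (\<lambda>x. h x - k x) \<le> 0"
    by (intro tendsto_le[OF sequentially_bot _ tendsto_const]) (auto intro!: always_eventually)
  then have "(\<integral>x. (norm (h x - k x))\<^sup>2 \<partial>V) \<le> 0" unfolding Lp_norm_2[OF hk] by simp
  then have "(\<integral>x. (norm (h x - k x))\<^sup>2 \<partial>V) = 0"
    by (intro antisym Bochner_Integration.integral_nonneg) auto
  then have "AE x in V. (norm (h x - k x))\<^sup>2 = 0"
    using integral_nonneg_eq_0_iff_AE[OF L2_integrable_power2[OF hk]] by simp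
  then show ?thesis by eventually_elim simp
qed

subsection \<open>Spectral projections as finite sums\<close>

lemma spectral_proj_eqI:
  assumes h: "h \<in> L2_space V"
    and lim: "(\<lambda>N. Lp_norm V 2 (\<lambda>x. h x - psum {j. j < N \<and> lam j \<in> I} (coef f) x)) \<longlonglongrightarrow> 0"
  shows "Lp_norm V p (spectral_proj V lam e I f) = Lp_norm V p h"
proof -
  let ?P = "\<lambda>h. h \<in> L2_space V \<and> (\<lambda>N. Lp_norm V 2 (\<lambda>x. h x - psum {j. j < N \<and> lam j \<in> I} (coef f) x)) \<longlonglongrightarrow> 0"
  have "spectral_proj V lam e I f = (SOME h. ?P h)"
    unfolding spectral_proj_def psum_def coef_def ..
  then have P: "?P (spectral_proj V lam e I f)" using someI[of ?P h] assms by simp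
  then have "AE x in V. spectral_proj V lam e I f x = h x"
    by (intro AE_eq_of_L2_limits[OF _ h psum_L2 _ lim]) (elim conjE, assumption)+
  then show ?thesis using P h by (intro Lp_norm_cong_AE L2_borel) auto
qed

lemma spectral_proj_finite:
  assumes "finite {j. lam j \<in> I}"
  shows "Lp_norm V p (spectral_proj V lam e I f) = Lp_norm V p (psum {j. lam j \<in> I} (coef f))"
proof (rule spectral_proj_eqI)
  obtain N0 where N0: "\<And>j. lam j \<in> I \<Longrightarrow> j < N0"
    using assms finite_nat_set_iff_bounded by auto
  have "\<forall>\<^sub>F N in sequentially. Lp_norm V 2 (\<lambda>x. psum {j. lam j \<in> I} (coef f) x - psum {j. j < N \<and> lam j \<in> I} (coef f) x) = 0"
    using eventually_ge_at_top[of N0]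
  proof eventually_elim
    case (elim N)
    then have "{j. j < N \<and> lam j \<in> I} = {j. lam j \<in> I}" using N0 order_less_le_trans by blast
    then show ?case using Lp_norm_zero[of 2 V] by simp
  qed
  then show "(\<lambda>N. Lp_norm V 2 (\<lambda>x. psum {j. lam j \<in> I} (coef f) x - psum {j. j < N \<and> lam j \<in> I} (coef f) x)) \<longlonglongrightarrow> 0"
    by (rule tendsto_eventually)
qed simp

text \<open>Subtracting the finitely many low frequencies exhibits the limit that defines the projection to the high ones.\<close>

lemma spectral_proj_cofinite:
  assumes "finite {j. lam j \<notin> I}" and f: "f \<in> L2_space V"
  shows "Lp_norm V p (spectral_proj V lam e I f) = Lp_norm V p (\<lambda>x. f x - psum {j. lam j \<notin> I} (coef f) x)"
proof (rule spectral_proj_eqI)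
  let ?C = "{j. lam j \<notin> I}"
  obtain N0 where N0: "\<And>j. lam j \<notin> I \<Longrightarrow> j < N0"
    using assms finite_nat_set_iff_bounded by auto
  have "\<forall>\<^sub>F N in sequentially. Lp_norm V 2 (\<lambda>x. f x - psum {..<N} (coef f) x) =
      Lp_norm V 2 (\<lambda>x. f x - psum ?C (coef f) x - psum {j. j < N \<and> lam j \<in> I} (coef f) x)"
    using eventually_ge_at_top[of N0]
  proof eventually_elim
    case (elim N)
    then have eq: "{..<N} = ?C \<union> {j. j < N \<and> lam j \<in> I}" using N0 order_less_le_trans by blast
    have "psum {..<N} (coef f) x = psum ?C (coef f) x + psum {j. j < N \<and> lam j \<in> I} (coef f) x" for x
      unfolding eq psum_def using assms by (intro sum.union_disjoint) auto
    then show ?case by (simp add: diff_diff_eq)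
  qed
  from Lim_transform_eventually[OF expansion[OF f] this]
  show "(\<lambda>N. Lp_norm V 2 (\<lambda>x. f x - psum ?C (coef f) x - psum {j. j < N \<and> lam j \<in> I} (coef f) x)) \<longlonglongrightarrow> 0" .
qed (intro L2_diff f psum_L2)

lemma psum_scale: "psum J (\<lambda>j. a * c j) x = a * psum J c x"
  unfolding psum_def by (simp add: sum_distrib_left mult.assoc)

text \<open>A sum of eigenfunctions in the window is its own projection; after normalisation it competes in the supremum that
  defines the operator norm.\<close>

lemma Lp_norm_psum_le_opnorm:
  assumes op: "L2_Lp_opnorm V p (spectral_proj V lam e I) \<le> ennreal B" "0 \<le> B" and p: "1 \<le> p"
    and fin: "finite {j. lam j \<in> I}" and J: "J \<subseteq> {j. lam j \<in> I}"
  shows "Lp_norm V p (psum J c) \<le> ennreal (B * sqrt (\<Sum>j\<in>J. (norm (c j))\<^sup>2))"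
proof -
  have finJ: "finite J" using fin J finite_subset by blast
  define r where "r = sqrt (\<Sum>j\<in>J. (norm (c j))\<^sup>2)"
  have r0: "0 \<le> r" unfolding r_def by (intro real_sqrt_ge_zero sum_nonneg) auto
  show ?thesis
  proof (cases "r = 0")
    case True
    then have "\<forall>j\<in>J. c j = 0" using finJ by (simp add: r_def sum_nonneg_eq_0_iff)
    then have "psum J c = (\<lambda>x. 0)" by (auto simp: psum_def)
    then show ?thesis using Lp_norm_zero[OF p, of V] by simp
  next
    case False
    then have r: "0 < r" using r0 by simp
    define f where "f = psum J (\<lambda>j. of_real (1/r) * c j)"
    have "(\<integral>x. (norm (f x))\<^sup>2 \<partial>V) = (\<Sum>j\<in>J. (norm (c j))\<^sup>2) / r\<^sup>2"
      unfolding f_def norm_psum[OF finJ] by (simp add: norm_mult norm_divide power_divide sum_divide_distrib)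
    also have "\<dots> = 1"
    proof -
      have "(\<Sum>j\<in>J. (norm (c j))\<^sup>2) = r\<^sup>2" unfolding r_def by (simp add: sum_nonneg)
      then show ?thesis using r by simp
    qed
    finally have "Lp_norm V 2 f \<le> 1" by (subst Lp_norm_2) (simp_all add: f_def)
    then have "Lp_norm V p (spectral_proj V lam e I f) \<le> L2_Lp_opnorm V p (spectral_proj V lam e I)"
      unfolding L2_Lp_opnorm_def by (intro SUP_upper) (simp add: f_def)
    then have "Lp_norm V p (psum {j. lam j \<in> I} (coef f)) \<le> ennreal B"
      using op(1) unfolding spectral_proj_finite[OF fin] by (rule order_trans)
    moreover have "psum {j. lam j \<in> I} (coef f) = f"
    proof
      fix x
      have "psum {j. lam j \<in> I} (coef f) x = psum J (coef f) x"
        unfolding psum_def using J fin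
        by (intro sum.mono_neutral_right) (auto simp: f_def coef_psum[OF finJ])
      also have "\<dots> = f x"
      proof -
        have "coef f j = of_real (1/r) * c j" if "j \<in> J" for j
          unfolding f_def using that by (simp add: coef_psum[OF finJ])
        then have "psum J (coef f) x = psum J (\<lambda>j. of_real (1/r) * c j) x"
          unfolding psum_def by (intro sum.cong) simp_all
        then show ?thesis by (simp only: f_def)
      qed
      finally show "psum {j. lam j \<in> I} (coef f) x = f x" .
    qed
    ultimately have "Lp_norm V p f \<le> ennreal B" by simp
    then have "Lp_norm V p (\<lambda>x. of_real r * f x) \<le> ennreal (norm (complex_of_real r) * B)"
      by (intro Lp_norm_cmult_le p op(2)) (simp add: f_def)
    moreover have "(\<lambda>x. of_real r * f x) = psum J c"
      using r by (auto simp: f_def psum_scale[symmetric])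
    ultimately show ?thesis using r by (simp add: r_def mult.commute)
  qed
qed

subsection \<open>Quasimodes in terms of their coefficients\<close>

lemma weak_eigenfunction:
  assumes "C1M f"
  shows "(\<integral>x. grad_form f (e j) x \<partial>V) = of_real ((lam j)\<^sup>2) * (\<integral>x. f x * e j x \<partial>V)"
proof -
  have "(\<integral>x. f x * laplacian A g (e j) x \<partial>V) = - of_real ((lam j)\<^sup>2) * (\<integral>x. f x * e j x \<partial>V)"
    unfolding e_laplacian by (simp add: mult.left_commute flip: integral_mult_right_zero)
  then show ?thesis using green[OF assms e_smooth, of j] by simp
qed

lemma coef_L2_laplacian:
  assumes "has_L2_laplacian A g V \<psi> D"
  shows "coef D j = - of_real ((lam j)\<^sup>2) * coef \<psi> j"
proof -
  have "(\<integral>x. \<psi> x * laplacian A g (\<lambda>x. cnj (e j x)) x \<partial>V) = (\<integral>x. D x * cnj (e j x) \<partial>V)"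
    using assms smooth_fun_cnj[OF e_smooth] unfolding has_L2_laplacian_def by blast
  moreover have "(\<integral>x. \<psi> x * laplacian A g (\<lambda>x. cnj (e j x)) x \<partial>V) = (\<integral>x. - of_real ((lam j)\<^sup>2) * (\<psi> x * cnj (e j x)) \<partial>V)"
    by (rule Bochner_Integration.integral_cong) (simp_all add: laplacian_cnj[OF e_smooth] e_laplacian)
  ultimately show ?thesis
    unfolding coef_def L2_inner_def by simp
qed

text \<open>Green's formula applied twice moves the Laplacian from the test function to the eigenfunction.\<close>

lemma has_L2_laplacian_psum:
  assumes J: "finite J"
  shows "has_L2_laplacian A g V (psum J c) (psum J (\<lambda>j. - of_real ((lam j)\<^sup>2) * c j))"
  unfolding has_L2_laplacian_def
proof (intro conjI allI impI psum_L2)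
  fix \<phi> assume \<phi>: "smooth_fun A \<phi>"
  have one: "(\<integral>x. e j x * laplacian A g \<phi> x \<partial>V) = - of_real ((lam j)\<^sup>2) * (\<integral>x. e j x * \<phi> x \<partial>V)" for j
  proof -
    have "(\<integral>x. e j x * laplacian A g \<phi> x \<partial>V) = - (\<integral>x. grad_form (e j) \<phi> x \<partial>V)"
      by (rule green[OF e_C1M \<phi>])
    also have "\<dots> = - (\<integral>x. grad_form \<phi> (e j) x \<partial>V)"
      by (simp add: grad_form_commute[OF e_C1M C1M_smooth[OF \<phi>]])
    also have "\<dots> = - of_real ((lam j)\<^sup>2) * (\<integral>x. e j x * \<phi> x \<partial>V)"
      unfolding weak_eigenfunction[OF C1M_smooth[OF \<phi>]] by (simp add: mult.commute)
    finally show ?thesis .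
  qed
  have i1: "integrable V (\<lambda>x. e j x * laplacian A g \<phi> x)" for j
    by (intro integrable_continuous continuous_on_mult C1M_continuous e_C1M continuous_laplacian \<phi>)
  have i2: "integrable V (\<lambda>x. e j x * \<phi> x)" for j
    by (intro integrable_continuous continuous_on_mult C1M_continuous e_C1M C1M_smooth \<phi>)
  have "(\<integral>x. psum J c x * laplacian A g \<phi> x \<partial>V) = (\<Sum>j\<in>J. c j * (\<integral>x. e j x * laplacian A g \<phi> x \<partial>V))"
    unfolding psum_def sum_distrib_right
    by (subst Bochner_Integration.integral_sum) (auto simp: mult.assoc i1)
  also have "\<dots> = (\<Sum>j\<in>J. (- of_real ((lam j)\<^sup>2) * c j) * (\<integral>x. e j x * \<phi> x \<partial>V))"
    unfolding one by (simp add: mult_ac)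
  also have "\<dots> = (\<integral>x. psum J (\<lambda>j. - of_real ((lam j)\<^sup>2) * c j) x * \<phi> x \<partial>V)"
    unfolding psum_def sum_distrib_right
    by (subst Bochner_Integration.integral_sum) (auto simp: mult.assoc i2)
  finally show "(\<integral>x. psum J c x * laplacian A g \<phi> x \<partial>V) = (\<integral>x. psum J (\<lambda>j. - of_real ((lam j)\<^sup>2) * c j) x * \<phi> x \<partial>V)" .
qed

text \<open>Bessel's inequality for \<open>\<psi>\<close> and for the residual, whose coefficients are \<open>(m\<^sup>2 - lam j\<^sup>2) coef \<psi> j\<close>.\<close>

lemma quasimode_coef:
  assumes "has_L2_laplacian A g V \<psi> D" "(\<integral>x. (norm (\<psi> x))\<^sup>2 \<partial>V) = 1"
    and "Lp_norm V 2 (\<lambda>x. D x + of_real (m\<^sup>2) * \<psi> x) \<le> ennreal r" "0 \<le> r" "finite J"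
  shows "(\<Sum>j\<in>J. (norm (coef \<psi> j))\<^sup>2) \<le> 1"
    and "(\<Sum>j\<in>J. (m\<^sup>2 - (lam j)\<^sup>2)\<^sup>2 * (norm (coef \<psi> j))\<^sup>2) \<le> r\<^sup>2"
proof -
  have L2: "\<psi> \<in> L2_space V" "D \<in> L2_space V" using assms(1) by (simp_all add: has_L2_laplacian_def)
  show "(\<Sum>j\<in>J. (norm (coef \<psi> j))\<^sup>2) \<le> 1" using bessel[OF assms(5) L2(1)] assms(2) by simp
  let ?q = "\<lambda>x. D x + of_real (m\<^sup>2) * \<psi> x"
  have q: "?q \<in> L2_space V" by (intro L2_add L2_cmult L2)
  have "coef ?q j = of_real (m\<^sup>2 - (lam j)\<^sup>2) * coef \<psi> j" for j
    unfolding coef_add[OF L2(2) L2_cmult[OF L2(1)]] coef_cmult coef_L2_laplacian[OF assms(1)]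
    by (simp add: algebra_simps)
  then have "(norm (coef ?q j))\<^sup>2 = (m\<^sup>2 - (lam j)\<^sup>2)\<^sup>2 * (norm (coef \<psi> j))\<^sup>2" for j
    by (simp add: norm_mult power_mult_distrib del: of_real_diff of_real_power)
  then have "(\<Sum>j\<in>J. (m\<^sup>2 - (lam j)\<^sup>2)\<^sup>2 * (norm (coef \<psi> j))\<^sup>2) \<le> (\<integral>x. (norm (?q x))\<^sup>2 \<partial>V)"
    using bessel[OF assms(5) q] by simp
  also have "\<dots> \<le> r\<^sup>2"
  proof -
    have "sqrt (\<integral>x. (norm (?q x))\<^sup>2 \<partial>V) \<le> r"
      using assms(3,4) unfolding Lp_norm_2[OF q] by simp
    then show ?thesis by (rule sqrt_le_D)
  qed
  finally show "(\<Sum>j\<in>J. (m\<^sup>2 - (lam j)\<^sup>2)\<^sup>2 * (norm (coef \<psi> j))\<^sup>2) \<le> r\<^sup>2" .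
qed

text \<open>If no frequency exceeds \<open>L\<close>, the residual is at least \<open>m\<^sup>2 - L\<^sup>2\<close> on every component; here Parseval's identity is needed
  and not only Bessel's inequality.\<close>

lemma quasimode_parameter_bound:
  assumes "has_L2_laplacian A g V \<psi> D" "(\<integral>x. (norm (\<psi> x))\<^sup>2 \<partial>V) = 1"
    and "Lp_norm V 2 (\<lambda>x. D x + of_real (m\<^sup>2) * \<psi> x) \<le> ennreal r" "0 \<le> r"
    and L: "\<And>j. lam j \<le> L" "L \<le> m"
  shows "m\<^sup>2 - L\<^sup>2 \<le> r"
proof -
  have L0: "0 \<le> L" using lam_nonneg[of 0] L(1)[of 0] by simp
  have low: "(m\<^sup>2 - L\<^sup>2)\<^sup>2 \<le> (m\<^sup>2 - (lam j)\<^sup>2)\<^sup>2" for j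
  proof -
    have "(lam j)\<^sup>2 \<le> L\<^sup>2" "L\<^sup>2 \<le> m\<^sup>2" using lam_nonneg[of j] L L0 by (auto intro: power_mono)
    then show ?thesis by (intro power_mono) auto
  qed
  have "(m\<^sup>2 - L\<^sup>2)\<^sup>2 * (\<Sum>j<N. (norm (coef \<psi> j))\<^sup>2) \<le> r\<^sup>2" for N
  proof -
    have "(m\<^sup>2 - L\<^sup>2)\<^sup>2 * (\<Sum>j<N. (norm (coef \<psi> j))\<^sup>2) \<le> (\<Sum>j<N. (m\<^sup>2 - (lam j)\<^sup>2)\<^sup>2 * (norm (coef \<psi> j))\<^sup>2)"
      unfolding sum_distrib_left by (intro sum_mono mult_right_mono low) auto
    also have "\<dots> \<le> r\<^sup>2" by (rule quasimode_coef(2)[OF assms(1-4)]) simp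
    finally show ?thesis .
  qed
  moreover have "(\<lambda>N. (m\<^sup>2 - L\<^sup>2)\<^sup>2 * (\<Sum>j<N. (norm (coef \<psi> j))\<^sup>2)) \<longlonglongrightarrow> (m\<^sup>2 - L\<^sup>2)\<^sup>2 * 1"
    using parseval[of \<psi>] assms(1,2) unfolding sums_def has_L2_laplacian_def
    by (intro tendsto_intros) auto
  ultimately have "(m\<^sup>2 - L\<^sup>2)\<^sup>2 \<le> r\<^sup>2" using LIMSEQ_le_const2 by fastforce
  then show ?thesis using assms(4) by (rule power2_le_imp_le)
qed

end

section \<open>Exponents and asymptotic bounds\<close>

lemma exponent_gt_2_cases:
  assumes "(2::ereal) < p"
  obtains (real) q where "p = ereal q" "2 < q" "inv_exponent p = 1 / q"
    | (infinite) "p = \<infinity>" "inv_exponent p = 0"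
  using assms by (cases p) (auto simp: inv_exponent_def inverse_eq_divide)

text \<open>The two branches of the exponent cross at \<open>p = 2(n+1)/(n-1)\<close>, and the one in force is always the larger.\<close>

lemma sogge_exponent_alternatives:
  assumes "2 < p" "2 \<le> n"
  shows "sogge_exponent p n = max (real n * (1/2 - inv_exponent p) - 1/2) ((real n - 1) / 2 * (1/2 - inv_exponent p))"
proof -
  define u where "u = 1/2 - inv_exponent p"
  have n: "real n \<ge> 2" using assms by simp
  have crit: "ereal (2 * (real n + 1) / (real n - 1)) \<le> p \<longleftrightarrow> 1 \<le> (real n + 1) * u"
    using assms(1)
  proof (cases rule: exponent_gt_2_cases)
    case (real q)
    have "2 * (real n + 1) / (real n - 1) \<le> q \<longleftrightarrow> 2 * (real n + 1) \<le> q * (real n - 1)"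
      using n by (simp add: divide_le_eq)
    also have "\<dots> \<longleftrightarrow> 1 \<le> (real n + 1) * (1/2 - 1/q)"
      using real(2) by (simp add: field_simps)
    finally show ?thesis using real by (simp add: u_def)
  next
    case infinite
    then show ?thesis using n by (simp add: u_def)
  qed
  have "real n * u - 1/2 - (real n - 1) / 2 * u = ((real n + 1) * u - 1) / 2"
    by (simp add: field_simps)
  then have "(real n - 1) / 2 * u \<le> real n * u - 1/2 \<longleftrightarrow> 0 \<le> ((real n + 1) * u - 1) / 2"
    by (metis diff_ge_0_iff_ge)
  then have "(real n - 1) / 2 * u \<le> real n * u - 1/2 \<longleftrightarrow> 1 \<le> (real n + 1) * u"
    by (simp add: zero_le_divide_iff)
  then show ?thesis
    unfolding sogge_exponent_def crit u_def[symmetric] by (auto simp: max_def)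
qed

lemma inv_exponent_lt_half: "2 < p \<Longrightarrow> inv_exponent p < 1/2"
  by (elim exponent_gt_2_cases) (simp_all add: divide_less_eq)

lemma sogge_exponent_pos: "2 < p \<Longrightarrow> 2 \<le> n \<Longrightarrow> 0 < sogge_exponent p n"
  using inv_exponent_lt_half[of p] by (simp add: sogge_exponent_alternatives less_max_iff_disj)

lemma sogge_exponent_ge_Sobolev:
  "2 < p \<Longrightarrow> 2 \<le> n \<Longrightarrow> real n * (1/2 - inv_exponent p) - 1/2 \<le> sogge_exponent p n"
  by (simp add: sogge_exponent_alternatives)

lemma sogge_exponent_subcritical:
  assumes "2 < p" "2 \<le> n" "real n * (1/2 - inv_exponent p) < 2"
  shows "sogge_exponent p n < 3/2"
proof -
  define u where "u = 1/2 - inv_exponent p"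
  have "0 < u" using inv_exponent_lt_half[OF assms(1)] by (simp add: u_def)
  then have "(real n - 1) / 2 * u \<le> real n * u / 2" by (simp add: field_simps)
  then show ?thesis
    using assms(3) unfolding sogge_exponent_alternatives[OF assms(1,2)] u_def[symmetric]
    by (simp only: max_less_iff_conj) linarith
qed

lemma is_smallo_add:
  assumes "is_smallo a r" "is_smallo b r"
  shows "is_smallo (\<lambda>k. a k + b k) r"
  unfolding is_smallo_def
proof (intro allI impI)
  fix \<epsilon> :: real assume "0 < \<epsilon>"
  then have "\<forall>\<^sub>F k in sequentially. a k \<le> ennreal (\<epsilon>/2 * r k)" "\<forall>\<^sub>F k in sequentially. b k \<le> ennreal (\<epsilon>/2 * r k)"
    using assms unfolding is_smallo_def by (metis half_gt_zero)+
  then show "\<forall>\<^sub>F k in sequentially. a k + b k \<le> ennreal (\<epsilon> * r k)"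
  proof eventually_elim
    case (elim k)
    have "a k + b k \<le> ennreal (\<epsilon>/2 * r k) + ennreal (\<epsilon>/2 * r k)" by (intro add_mono elim)
    also have "\<dots> \<le> ennreal (\<epsilon> * r k)"
    proof (cases "0 \<le> r k")
      case True
      then show ?thesis using \<open>0 < \<epsilon>\<close> by (simp flip: ennreal_plus)
    next
      case False
      then have "\<epsilon> / 2 * r k \<le> 0" using \<open>0 < \<epsilon>\<close> by (simp add: mult_le_0_iff)
      then have "ennreal (\<epsilon> / 2 * r k) = 0" by (rule ennreal_neg)
      then show ?thesis by simp
    qed
    finally show ?case .
  qed
qed

lemma is_smallo_mono: "is_smallo b r \<Longrightarrow> (\<And>k. a k \<le> b k) \<Longrightarrow> is_smallo a r"
  unfolding is_smallo_def using order_trans by (fast elim: eventually_mono)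

lemma sum_mult_le_sqrt:
  fixes x y :: "'i \<Rightarrow> real"
  shows "(\<Sum>k\<in>K. x k * y k) \<le> sqrt (\<Sum>k\<in>K. (x k)\<^sup>2) * sqrt (\<Sum>k\<in>K. (y k)\<^sup>2)"
proof -
  have "(\<Sum>k\<in>K. x k * y k)\<^sup>2 \<le> (sqrt (\<Sum>k\<in>K. (x k)\<^sup>2) * sqrt (\<Sum>k\<in>K. (y k)\<^sup>2))\<^sup>2"
    using Cauchy_Schwarz_ineq_sum[of x y K] by (simp add: power_mult_distrib sum_nonneg)
  then show ?thesis by (rule power2_le_imp_le) (simp add: sum_nonneg)
qed

lemma sum_int_inverse_squares_bounded:
  obtains C :: real where "0 < C" "\<And>K :: int set. finite K \<Longrightarrow> (\<Sum>k\<in>K. 1 / (1 + (real_of_int k)\<^sup>2)) \<le> C"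
proof -
  define a where "a m = 1 / (real (Suc m))\<^sup>2" for m
  have sa: "summable a"
    using summable_Suc_iff[of "\<lambda>m. inverse ((real m)\<^sup>2)"] inverse_power_summable[of 2, where 'a = real]
    unfolding a_def by (simp add: inverse_eq_divide)
  \<comment> \<open>applied to the nonnegative and to the negative integers, on each of which the absolute value is injective\<close>
  have half: "(\<Sum>k\<in>K. 1 / (1 + (real_of_int k)\<^sup>2)) \<le> 2 * suminf a"
    if K: "finite K" "inj_on (\<lambda>k. nat \<bar>k\<bar>) K" for K
  proof -
    have "(\<Sum>k\<in>K. 1 / (1 + (real_of_int k)\<^sup>2)) \<le> (\<Sum>k\<in>K. 2 * a (nat \<bar>k\<bar>))"
    proof (rule sum_mono)
      fix k :: int
      have "(real (Suc (nat \<bar>k\<bar>)))\<^sup>2 \<le> 2 * (1 + (real_of_int k)\<^sup>2)"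
      proof -
        define t where "t = \<bar>real_of_int k\<bar>"
        have "real (Suc (nat \<bar>k\<bar>)) = 1 + t" by (simp add: t_def)
        moreover have "(1 + t)\<^sup>2 \<le> 2 * (1 + t\<^sup>2)"
          using zero_le_power2[of "1 - t"] by (simp add: power2_eq_square algebra_simps)
        moreover have "t\<^sup>2 = (real_of_int k)\<^sup>2" by (simp add: t_def)
        ultimately show ?thesis by simp
      qed
      moreover have "0 < (real (Suc (nat \<bar>k\<bar>)))\<^sup>2" "0 < 1 + (real_of_int k)\<^sup>2"
        by (simp_all add: add_pos_nonneg del: of_nat_Suc)
      ultimately show "1 / (1 + (real_of_int k)\<^sup>2) \<le> 2 * a (nat \<bar>k\<bar>)"
        unfolding a_def by (simp add: divide_simps del: of_nat_Suc)
    qed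
    also have "\<dots> = 2 * (\<Sum>m\<in>(\<lambda>k. nat \<bar>k\<bar>) ` K. a m)"
      using K by (simp add: sum.reindex sum_distrib_left)
    also have "\<dots> \<le> 2 * suminf a"
      using K by (intro mult_left_mono sum_le_suminf[OF sa]) (auto simp: a_def)
    finally show ?thesis .
  qed
  have "(\<Sum>k\<in>K. 1 / (1 + (real_of_int k)\<^sup>2)) \<le> 4 * suminf a + 1" if K: "finite K" for K :: "int set"
  proof -
    have "(\<Sum>k\<in>K. 1 / (1 + (real_of_int k)\<^sup>2)) =
        (\<Sum>k\<in>K \<inter> {0..}. 1 / (1 + (real_of_int k)\<^sup>2)) + (\<Sum>k\<in>K \<inter> {..<0}. 1 / (1 + (real_of_int k)\<^sup>2))"
      using K by (subst sum.union_disjoint[symmetric]) (auto intro: sum.cong)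
    also have "\<dots> \<le> 2 * suminf a + 2 * suminf a"
      using K by (intro add_mono half) (auto simp: inj_on_def)
    finally show ?thesis by simp
  qed
  moreover have "0 \<le> suminf a" by (rule suminf_nonneg[OF sa]) (simp add: a_def)
  ultimately show ?thesis using that[of "4 * suminf a + 1"] by simp
qed

context laplace_spectrum
begin

section \<open>Quasimode bounds control spectral windows\<close>

lemma strong_of_quasimode_bound:
  assumes "quasimode_bound A g V p"
  shows "strong_quasimode_bound A g V lam e p"
  unfolding strong_quasimode_bound_def
proof (intro allI impI)
  fix \<mu> \<psi> D
  assume a: "filterlim \<mu> at_top sequentially" "\<forall>k. has_L2_laplacian A g V (\<psi> k) (D k)"
    "\<forall>k. (\<integral>x. (norm (\<psi> k x))\<^sup>2 \<partial>V) = 1"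
    and s: "is_smallo (\<lambda>k. Lp_norm V 2 (\<lambda>x. D k x + of_real ((\<mu> k)\<^sup>2) * \<psi> k x)
             + ennreal (\<mu> k powr (2 - real CARD('n) * (1/2 - inv_exponent p)))
               * Lp_norm V p (spectral_proj V lam e {2 * \<mu> k ..} (\<psi> k))) \<mu>"
  have "is_smallo (\<lambda>k. Lp_norm V 2 (\<lambda>x. D k x + of_real ((\<mu> k)\<^sup>2) * \<psi> k x)) \<mu>"
    by (rule is_smallo_mono[OF s]) simp
  then show "is_smallo (\<lambda>k. Lp_norm V p (\<psi> k)) (\<lambda>k. \<mu> k powr sogge_exponent p CARD('n))"
    using assms a unfolding quasimode_bound_def by blast
qed

lemma window_function_exists:
  assumes fin: "\<And>L. finite {j. lam j \<le> L}" and p: "1 \<le> p"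
    and big: "\<not> L2_Lp_opnorm V p (spectral_proj V lam e {s..t}) \<le> ennreal B" and "0 \<le> B"
  obtains J c where "J \<subseteq> {j. lam j \<in> {s..t}}" "finite J" "(\<Sum>j\<in>J. (norm (c j))\<^sup>2) = 1"
    "\<not> Lp_norm V p (psum J c) \<le> ennreal B"
proof -
  define J where "J = {j. lam j \<in> {s..t}}"
  have finJ: "finite J" unfolding J_def by (rule finite_subset[OF _ fin[of t]]) auto
  obtain f where f: "f \<in> L2_space V" "Lp_norm V 2 f \<le> 1"
    "\<not> Lp_norm V p (spectral_proj V lam e {s..t} f) \<le> ennreal B"
    using big unfolding L2_Lp_opnorm_def by (auto simp: SUP_le_iff)
  then have w: "\<not> Lp_norm V p (psum J (coef f)) \<le> ennreal B"
    using spectral_proj_finite[of "{s..t}"] finJ unfolding J_def by simp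
  define N where "N = (\<Sum>j\<in>J. (norm (coef f j))\<^sup>2)"
  have "N \<noteq> 0"
  proof
    assume "N = 0"
    then have "\<forall>j\<in>J. coef f j = 0" using finJ by (simp add: N_def sum_nonneg_eq_0_iff)
    then have "psum J (coef f) = (\<lambda>x. 0)" by (auto simp: psum_def)
    then show False using w Lp_norm_zero[OF p, of V] by simp
  qed
  moreover have "0 \<le> N" unfolding N_def by (intro sum_nonneg) auto
  ultimately have N: "0 < N" by simp
  have "(\<integral>x. (norm (f x))\<^sup>2 \<partial>V) \<le> 1" using f(2) unfolding Lp_norm_2[OF f(1)] by simp
  then have N1: "N \<le> 1" using bessel[OF finJ f(1)] unfolding N_def by linarith
  define c where "c j = of_real (1 / sqrt N) * coef f j" for j
  have "(\<Sum>j\<in>J. (norm (c j))\<^sup>2) = (1 / N) * N"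
    unfolding N_def c_def sum_distrib_left using N
    by (intro sum.cong) (auto simp: norm_mult norm_divide power_mult_distrib power_divide N_def)
  then have c1: "(\<Sum>j\<in>J. (norm (c j))\<^sup>2) = 1" using N by simp
  have "\<not> Lp_norm V p (psum J c) \<le> ennreal B"
  proof
    assume "Lp_norm V p (psum J c) \<le> ennreal B"
    then have "Lp_norm V p (\<lambda>x. of_real (sqrt N) * psum J c x) \<le> ennreal (norm (complex_of_real (sqrt N)) * B)"
      by (intro Lp_norm_cmult_le p psum_borel \<open>0 \<le> B\<close>)
    also have "\<dots> \<le> ennreal B"
      using N N1 \<open>0 \<le> B\<close> by (intro ennreal_leI) (simp add: mult_left_le_one_le)
    also have "(\<lambda>x. of_real (sqrt N) * psum J c x) = psum J (coef f)"
      using N by (auto simp: psum_scale[symmetric] c_def mult.assoc[symmetric] simp flip: of_real_mult)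
    finally show False using w by simp
  qed
  then show ?thesis using that[of J c] c1 finJ unfolding J_def by blast
qed

text \<open>The normalised functions in windows of width \<open>\<delta> k = 1 / (k + 2)\<close> at frequency \<open>s k > k + 1\<close> that violate the
  bound form a family of quasimodes. Their residual is at most \<open>\<delta> k (2 s k + \<delta> k)\<close>, and since \<open>s k + \<delta> k < 2 s k\<close>
  they have no high frequency part.\<close>

lemma window_of_strong_quasimode_bound:
  assumes fin: "\<And>L. finite {j. lam j \<le> L}" and p: "1 \<le> p"
    and q: "strong_quasimode_bound A g V lam e p"
  shows "shrinking_window_bound V lam e CARD('n) p"
proof (rule ccontr)
  let ?\<sigma> = "sogge_exponent p CARD('n)"
  assume "\<not> shrinking_window_bound V lam e CARD('n) p"
  then obtain \<epsilon> where \<epsilon>: "0 < \<epsilon>" and bad: "\<And>\<delta> \<Lambda>. 0 < \<delta> \<Longrightarrow> \<delta> < 1 \<Longrightarrow>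
      \<exists>s>\<Lambda>. \<not> L2_Lp_opnorm V p (spectral_proj V lam e {s..s+\<delta>}) \<le> ennreal (\<epsilon> * s powr ?\<sigma>)"
    unfolding shrinking_window_bound_def by metis
  define \<delta> where "\<delta> k = 1 / (real k + 2)" for k :: nat
  have \<delta>: "0 < \<delta> k" "\<delta> k < 1" for k by (auto simp: \<delta>_def)
  have "\<exists>s J c. s > real k + 1 \<and> J \<subseteq> {j. lam j \<in> {s..s+\<delta> k}} \<and> finite J \<and> (\<Sum>j\<in>J. (norm (c j))\<^sup>2) = 1 \<and>
      \<not> Lp_norm V p (psum J c) \<le> ennreal (\<epsilon> * s powr ?\<sigma>)" for k :: nat
  proof -
    obtain s where s: "s > real k + 1" "\<not> L2_Lp_opnorm V p (spectral_proj V lam e {s..s+\<delta> k}) \<le> ennreal (\<epsilon> * s powr ?\<sigma>)"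
      using bad[OF \<delta>] by blast
    have "0 \<le> \<epsilon> * s powr ?\<sigma>" using \<epsilon> by simp
    obtain J c where "J \<subseteq> {j. lam j \<in> {s..s+\<delta> k}}" "finite J" "(\<Sum>j\<in>J. (norm (c j))\<^sup>2) = 1"
      "\<not> Lp_norm V p (psum J c) \<le> ennreal (\<epsilon> * s powr ?\<sigma>)"
      by (rule window_function_exists[OF fin p s(2) \<open>0 \<le> \<epsilon> * s powr ?\<sigma>\<close>])
    then show ?thesis using s(1) by (intro exI[of _ s] exI[of _ J] exI[of _ c]) simp
  qed
  then obtain s J c where s: "\<And>k :: nat. s k > real k + 1" and J: "\<And>k. J k \<subseteq> {j. lam j \<in> {s k..s k+\<delta> k}}"
    and finJ: "\<And>k. finite (J k)" and c: "\<And>k. (\<Sum>j\<in>J k. (norm (c k j))\<^sup>2) = 1"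
    and big: "\<And>k. \<not> Lp_norm V p (psum (J k) (c k)) \<le> ennreal (\<epsilon> * s k powr ?\<sigma>)" by metis
  define \<psi> where "\<psi> k = psum (J k) (c k)" for k
  define D where "D k = psum (J k) (\<lambda>j. - of_real ((lam j)\<^sup>2) * c k j)" for k
  have lim: "filterlim s at_top sequentially"
  proof (rule filterlim_at_top_mono[OF filterlim_real_sequentially])
    show "\<forall>\<^sub>F k in sequentially. real k \<le> s k" using s by (intro always_eventually) (smt (verit))
  qed
  have lap: "has_L2_laplacian A g V (\<psi> k) (D k)" for k
    unfolding \<psi>_def D_def by (rule has_L2_laplacian_psum[OF finJ])
  have one: "(\<integral>x. (norm (\<psi> k x))\<^sup>2 \<partial>V) = 1" for k
    unfolding \<psi>_def norm_psum[OF finJ] by (rule c)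
  have res: "Lp_norm V 2 (\<lambda>x. D k x + of_real ((s k)\<^sup>2) * \<psi> k x) \<le> ennreal (3 * \<delta> k * s k)" for k
  proof -
    have s1: "1 \<le> s k" using s[of k] by simp
    let ?d = "\<lambda>j. of_real ((s k)\<^sup>2 - (lam j)\<^sup>2) * c k j"
    have eq: "(\<lambda>x. D k x + of_real ((s k)\<^sup>2) * \<psi> k x) = psum (J k) ?d"
      unfolding D_def \<psi>_def psum_scale[symmetric] unfolding psum_def
      by (auto simp: sum.distrib[symmetric] algebra_simps intro!: sum.cong)
    have "(\<Sum>j\<in>J k. (norm (?d j))\<^sup>2) \<le> (\<Sum>j\<in>J k. (3 * \<delta> k * s k)\<^sup>2 * (norm (c k j))\<^sup>2)"
    proof (rule sum_mono)
      fix j assume "j \<in> J k"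
      then have l: "s k \<le> lam j" "lam j \<le> s k + \<delta> k" using J by auto
      have "\<bar>(s k)\<^sup>2 - (lam j)\<^sup>2\<bar> = (lam j - s k) * (lam j + s k)"
      proof -
        have "(s k)\<^sup>2 \<le> (lam j)\<^sup>2" using l s1 by (intro power_mono) auto
        then show ?thesis by (simp add: power2_eq_square algebra_simps)
      qed
      also have "\<dots> \<le> \<delta> k * (3 * s k)" using l s1 \<delta>[of k] by (intro mult_mono) auto
      finally have "\<bar>(s k)\<^sup>2 - (lam j)\<^sup>2\<bar> \<le> \<bar>3 * \<delta> k * s k\<bar>" using s1 \<delta>[of k] by (simp add: mult_ac)
      then have "((s k)\<^sup>2 - (lam j)\<^sup>2)\<^sup>2 \<le> (3 * \<delta> k * s k)\<^sup>2" by (simp add: abs_le_square_iff)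
      then show "(norm (?d j))\<^sup>2 \<le> (3 * \<delta> k * s k)\<^sup>2 * (norm (c k j))\<^sup>2"
        by (simp add: norm_mult power_mult_distrib mult_right_mono del: of_real_diff of_real_power)
    qed
    also have "\<dots> = (3 * \<delta> k * s k)\<^sup>2" by (simp add: sum_distrib_left[symmetric] c)
    finally have "sqrt (\<Sum>j\<in>J k. (norm (?d j))\<^sup>2) \<le> 3 * \<delta> k * s k"
      using s1 \<delta>[of k] by (intro real_le_lsqrt) auto
    then show ?thesis unfolding eq Lp_norm_2[OF psum_L2] norm_psum[OF finJ] by (rule ennreal_leI)
  qed
  have high: "Lp_norm V p (spectral_proj V lam e {2 * s k..} (\<psi> k)) = 0" for k
  proof -
    have C: "finite {j. lam j \<notin> {2 * s k..}}" by (rule finite_subset[OF _ fin[of "2 * s k"]]) auto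
    have sub: "J k \<subseteq> {j. lam j \<notin> {2 * s k..}}" using J[of k] \<delta>[of k] s[of k] by fastforce
    have "\<psi> k x - psum {j. lam j \<notin> {2 * s k..}} (coef (\<psi> k)) x = 0" for x
    proof -
      have "psum {j. lam j \<notin> {2 * s k..}} (coef (\<psi> k)) x = psum (J k) (coef (\<psi> k)) x"
        unfolding psum_def using sub C
        by (intro sum.mono_neutral_right) (auto simp: \<psi>_def coef_psum[OF finJ])
      also have "\<dots> = psum (J k) (c k) x"
      proof -
        have "coef (\<psi> k) j = c k j" if "j \<in> J k" for j
          using that by (simp add: \<psi>_def coef_psum[OF finJ])
        then show ?thesis unfolding psum_def by (intro sum.cong) simp_all
      qed
      finally show ?thesis by (simp add: \<psi>_def)
    qed
    then show ?thesis
      unfolding spectral_proj_cofinite[OF C psum_L2[of "J k" "c k", folded \<psi>_def]]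
      using Lp_norm_zero[OF p, of V] by simp
  qed
  have small: "is_smallo (\<lambda>k. Lp_norm V 2 (\<lambda>x. D k x + of_real ((s k)\<^sup>2) * \<psi> k x)
             + ennreal (s k powr (2 - real CARD('n) * (1/2 - inv_exponent p)))
               * Lp_norm V p (spectral_proj V lam e {2 * s k ..} (\<psi> k))) s"
    unfolding is_smallo_def high
  proof (intro allI impI)
    fix \<eta> :: real assume "0 < \<eta>"
    obtain N :: nat where N: "3 / \<eta> < real N" using reals_Archimedean2 by blast
    show "\<forall>\<^sub>F k in sequentially. Lp_norm V 2 (\<lambda>x. D k x + of_real ((s k)\<^sup>2) * \<psi> k x)
        + ennreal (s k powr (2 - real CARD('n) * (1/2 - inv_exponent p))) * 0 \<le> ennreal (\<eta> * s k)"
      using eventually_ge_at_top[of N]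
    proof eventually_elim
      case (elim k)
      have "3 / \<eta> \<le> real k + 2" using N elim by simp
      then have "3 * \<delta> k \<le> \<eta>" using \<open>0 < \<eta>\<close> by (simp add: \<delta>_def field_simps)
      then have "3 * \<delta> k * s k \<le> \<eta> * s k" using s[of k] by (intro mult_right_mono) auto
      then show ?case using res[of k] by (simp add: ennreal_leI order_trans)
    qed
  qed
  have "is_smallo (\<lambda>k. Lp_norm V p (\<psi> k)) (\<lambda>k. s k powr ?\<sigma>)"
    using q[unfolded strong_quasimode_bound_def, rule_format, OF lim lap one small] .
  then have "\<forall>\<^sub>F k in sequentially. Lp_norm V p (\<psi> k) \<le> ennreal (\<epsilon> * s k powr ?\<sigma>)"
    using \<epsilon> unfolding is_smallo_def by blast
  then show False using big unfolding \<psi>_def by simp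
qed

section \<open>The degenerate case of bounded frequencies\<close>

text \<open>If the frequencies are bounded, the windows at high frequency are empty, and there are no quasimodes of large
  parameter; so all conditions hold. It remains to treat frequencies that tend to infinity.\<close>

lemma bounded_frequencies:
  assumes L: "\<And>j. lam j \<le> L" and p: "1 \<le> p"
  shows "shrinking_window_bound V lam e n p" and "quasimode_bound A g V p"
proof -
  show "shrinking_window_bound V lam e n p"
    unfolding shrinking_window_bound_def
  proof (intro allI impI)
    fix \<epsilon> :: real assume "0 < \<epsilon>"
    have "L2_Lp_opnorm V p (spectral_proj V lam e {s..s+1/2}) \<le> ennreal (\<epsilon> * s powr sogge_exponent p n)" if "s > L" for s
    proof -
      have "lam j < s" for j using that L[of j] by simp
      then have J: "{j. lam j \<in> {s..s+1/2}} = {}" by (auto simp: not_le)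
      have "Lp_norm V p (spectral_proj V lam e {s..s+1/2} f) = 0" for f
      proof -
        have "psum {} (coef f) = (\<lambda>x. 0)" by (auto simp: psum_def)
        then show ?thesis using spectral_proj_finite[of "{s..s+1/2}" p f] Lp_norm_zero[OF p, of V] unfolding J by simp
      qed
      then show ?thesis unfolding L2_Lp_opnorm_def by (simp add: SUP_le_iff)
    qed
    then show "\<exists>\<delta> \<Lambda> :: real. 0 < \<delta> \<and> \<delta> < 1 \<and>
        (\<forall>s>\<Lambda>. L2_Lp_opnorm V p (spectral_proj V lam e {s..s+\<delta>}) \<le> ennreal (\<epsilon> * s powr sogge_exponent p n))"
      by (intro exI[of _ "1/2"] exI[of _ L]) simp
  qed
  show "quasimode_bound A g V p"
    unfolding quasimode_bound_def
  proof (intro allI impI)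
    fix \<mu> :: "nat \<Rightarrow> real" and \<psi> D
    assume \<mu>: "filterlim \<mu> at_top sequentially" and lap: "\<forall>k. has_L2_laplacian A g V (\<psi> k) (D k)"
      and one: "\<forall>k. (\<integral>x. (norm (\<psi> k x))\<^sup>2 \<partial>V) = 1"
      and s: "is_smallo (\<lambda>k. Lp_norm V 2 (\<lambda>x. D k x + of_real ((\<mu> k)\<^sup>2) * \<psi> k x)) \<mu>"
    have "\<forall>\<^sub>F k in sequentially. \<mu> k > \<bar>L\<bar> + 2" using \<mu> unfolding filterlim_at_top_dense by (rule spec)
    moreover have "\<forall>\<^sub>F k in sequentially. Lp_norm V 2 (\<lambda>x. D k x + of_real ((\<mu> k)\<^sup>2) * \<psi> k x) \<le> ennreal (1 * \<mu> k)"
      using s[unfolded is_smallo_def, rule_format, of 1] by simp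
    ultimately have "\<forall>\<^sub>F k in sequentially. False"
    proof eventually_elim
      case (elim k)
      have L0: "0 \<le> L" using L[of 0] lam_nonneg[of 0] by simp
      have "(\<mu> k)\<^sup>2 - L\<^sup>2 \<le> \<mu> k"
        using elim L lap one L0 by (intro quasimode_parameter_bound[of "\<psi> k" "D k"]) auto
      moreover have "(\<mu> k)\<^sup>2 - L\<^sup>2 = (\<mu> k - L) * (\<mu> k + L)" by (simp add: power2_eq_square algebra_simps)
      moreover have "(\<mu> k - L) * (\<mu> k + L) \<ge> 2 * \<mu> k"
        using elim L0 by (intro mult_mono) auto
      ultimately show ?case using elim by linarith
    qed
    then show "is_smallo (\<lambda>k. Lp_norm V p (\<psi> k)) (\<lambda>k. \<mu> k powr sogge_exponent p CARD('n))" by simp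
  qed
qed

lemma finite_or_bounded_frequencies:
  obtains (discrete) "\<And>L. finite {j. lam j \<le> L}" | (bounded) L where "\<And>j. lam j \<le> L"
proof (cases "\<exists>L. \<forall>j. lam j \<le> L")
  case False
  have "finite {j. lam j \<le> L}" for L
  proof -
    obtain i where "lam i > L" using False not_le by blast
    then have "{j. lam j \<le> L} \<subseteq> {..<i}" using lam_mono by (force simp: not_le[symmetric])
    then show ?thesis by (rule finite_subset) simp
  qed
  then show ?thesis by (rule discrete)
qed (use bounded in blast)

section \<open>Summing the window bound over cells\<close>

text \<open>The bound on window operators, stated for the finite sums of eigenfunctions to which it is applied.\<close>

definition window_bound :: "ereal \<Rightarrow> real \<Rightarrow> real \<Rightarrow> real \<Rightarrow> real \<Rightarrow> bool" where
  "window_bound p \<sigma> \<epsilon> \<delta> \<Lambda> \<longleftrightarrow> (\<forall>s J c. \<Lambda> < s \<longrightarrow> J \<subseteq> {j. lam j \<in> {s..s+\<delta>}} \<longrightarrow>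
     Lp_norm V p (psum J c) \<le> ennreal (\<epsilon> * s powr \<sigma> * sqrt (\<Sum>j\<in>J. (norm (c j))\<^sup>2)))"

lemma window_bound_of_shrinking:
  assumes fin: "\<And>L. finite {j. lam j \<le> L}" and p: "1 \<le> p"
    and "shrinking_window_bound V lam e n p" and \<epsilon>: "0 < \<epsilon>"
  obtains \<delta> \<Lambda> where "0 < \<delta>" "\<delta> < 1" "1 \<le> \<Lambda>" "window_bound p (sogge_exponent p n) \<epsilon> \<delta> \<Lambda>"
proof -
  obtain \<delta> \<Lambda> where d: "0 < \<delta>" "\<delta> < 1"
    and op: "\<And>s. s > \<Lambda> \<Longrightarrow> L2_Lp_opnorm V p (spectral_proj V lam e {s..s+\<delta>}) \<le> ennreal (\<epsilon> * s powr sogge_exponent p n)"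
    using assms(3) \<epsilon> unfolding shrinking_window_bound_def by metis
  have "window_bound p (sogge_exponent p n) \<epsilon> \<delta> (max 1 \<Lambda>)"
    unfolding window_bound_def
  proof (intro allI impI)
    fix s J c assume s: "max 1 \<Lambda> < s" and J: "J \<subseteq> {j. lam j \<in> {s..s+\<delta>}}"
    have "finite {j. lam j \<in> {s..s+\<delta>}}" by (rule finite_subset[OF _ fin[of "s+\<delta>"]]) auto
    then show "Lp_norm V p (psum J c) \<le> ennreal (\<epsilon> * s powr sogge_exponent p n * sqrt (\<Sum>j\<in>J. (norm (c j))\<^sup>2))"
      using op[of s] s \<epsilon> J by (intro Lp_norm_psum_le_opnorm[OF _ _ p]) auto
  qed
  then show ?thesis using that[of \<delta> "max 1 \<Lambda>"] d by simp
qed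

text \<open>The frequencies \<open>lam j\<close> in \<open>[a + \<delta> k, a + \<delta> (k + 1))\<close> form the cell \<open>k\<close>. The anchor \<open>a\<close> is \<open>\<mu>\<close> for estimates near the
  spectral parameter and \<open>0\<close> for high frequencies.\<close>

definition cell :: "real \<Rightarrow> real \<Rightarrow> nat \<Rightarrow> int" where
  "cell \<delta> a j = \<lfloor>(lam j - a) / \<delta>\<rfloor>"

lemma cell_bounds:
  assumes "0 < \<delta>"
  shows "a + \<delta> * real_of_int (cell \<delta> a j) \<le> lam j" "lam j < a + \<delta> * real_of_int (cell \<delta> a j) + \<delta>"
proof -
  have "real_of_int (cell \<delta> a j) \<le> (lam j - a) / \<delta>" "(lam j - a) / \<delta> < real_of_int (cell \<delta> a j) + 1"
    unfolding cell_def by linarith+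
  then show "a + \<delta> * real_of_int (cell \<delta> a j) \<le> lam j" "lam j < a + \<delta> * real_of_int (cell \<delta> a j) + \<delta>"
    using assms by (simp_all add: pos_le_divide_eq pos_divide_less_eq algebra_simps)
qed

definition cell_mass :: "real \<Rightarrow> real \<Rightarrow> nat set \<Rightarrow> (nat \<Rightarrow> complex) \<Rightarrow> int \<Rightarrow> real" where
  "cell_mass \<delta> a J c k = (\<Sum>j | j \<in> J \<and> cell \<delta> a j = k. (norm (c j))\<^sup>2)"

lemma cell_mass_nonneg: "0 \<le> cell_mass \<delta> a J c k"
  unfolding cell_mass_def by (intro sum_nonneg) auto

lemma sum_cell_mass:
  assumes "finite J"
  shows "(\<Sum>k\<in>cell \<delta> a ` J. w k * cell_mass \<delta> a J c k) = (\<Sum>j\<in>J. w (cell \<delta> a j) * (norm (c j))\<^sup>2)"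
proof -
  have "(\<Sum>k\<in>cell \<delta> a ` J. w k * cell_mass \<delta> a J c k) =
      (\<Sum>k\<in>cell \<delta> a ` J. \<Sum>j | j \<in> J \<and> cell \<delta> a j = k. w (cell \<delta> a j) * (norm (c j))\<^sup>2)"
    unfolding cell_mass_def sum_distrib_left by (intro sum.cong refl) auto
  also have "\<dots> = (\<Sum>j\<in>J. w (cell \<delta> a j) * (norm (c j))\<^sup>2)"
    by (rule sum.image_gen[OF assms, symmetric])
  finally show ?thesis .
qed

text \<open>Every occupied cell starts above \<open>\<Lambda>\<close>, since its length is less than \<open>1\<close> and it contains a frequency above \<open>\<Lambda> + 1\<close>.\<close>

lemma Lp_norm_psum_cells:
  assumes W: "window_bound p \<sigma> \<epsilon> \<delta> \<Lambda>" and p: "1 \<le> p" and \<delta>: "0 < \<delta>" "\<delta> < 1" and \<epsilon>: "0 \<le> \<epsilon>"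
    and J: "finite J" "\<And>j. j \<in> J \<Longrightarrow> \<Lambda> + 1 < lam j"
  shows "Lp_norm V p (psum J c) \<le>
    ennreal (\<epsilon> * (\<Sum>k\<in>cell \<delta> a ` J. (a + \<delta> * real_of_int k) powr \<sigma> * sqrt (cell_mass \<delta> a J c k)))"
proof -
  let ?K = "cell \<delta> a ` J" and ?J = "\<lambda>k. {j. j \<in> J \<and> cell \<delta> a j = k}"
  let ?b = "\<lambda>k. \<epsilon> * (a + \<delta> * real_of_int k) powr \<sigma> * sqrt (cell_mass \<delta> a J c k)"
  have "psum J c = (\<lambda>x. \<Sum>k\<in>?K. psum (?J k) c x)"
    unfolding psum_def by (intro ext sum.image_gen[OF J(1)])
  then have "Lp_norm V p (psum J c) \<le> (\<Sum>k\<in>?K. Lp_norm V p (psum (?J k) c))"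
    using Lp_norm_sum_le[OF p, of ?K "\<lambda>k. psum (?J k) c" V] J by simp
  also have "\<dots> \<le> (\<Sum>k\<in>?K. ennreal (?b k))"
  proof (rule sum_mono)
    fix k assume "k \<in> ?K"
    then obtain i where i: "i \<in> J" "cell \<delta> a i = k" by auto
    have "\<Lambda> < a + \<delta> * real_of_int k"
      using cell_bounds(2)[OF \<delta>(1), where j = i and a = a] J(2)[OF i(1)] i \<delta> by simp
    moreover have "?J k \<subseteq> {j. lam j \<in> {a + \<delta> * real_of_int k..a + \<delta> * real_of_int k + \<delta>}}"
      using cell_bounds[OF \<delta>(1), where a = a] less_imp_le by auto
    ultimately show "Lp_norm V p (psum (?J k) c) \<le> ennreal (?b k)"
      using W unfolding window_bound_def cell_mass_def by blast
  qed
  also have "\<dots> = ennreal (\<Sum>k\<in>?K. ?b k)"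
    using \<epsilon> by (intro sum_ennreal mult_nonneg_nonneg real_sqrt_ge_zero cell_mass_nonneg) auto
  finally show ?thesis by (simp add: sum_distrib_left mult.assoc)
qed

lemma Lp_norm_e_finite:
  assumes "1 \<le> p" shows "\<exists>B\<ge>0. Lp_norm V p (e j) \<le> ennreal B"
proof -
  have "bounded (range (e j))"
    by (rule compact_imp_bounded[OF compact_continuous_image[OF C1M_continuous[OF e_C1M] compact_UNIV]])
  then obtain C where "\<And>x. norm (e j x) \<le> C" unfolding bounded_iff by auto
  then have "Lp_norm V p (e j) < \<infinity>"
    by (intro Lp_norm_bounded[OF finite_V assms] L2_borel e_L2)
  then show ?thesis by (cases "Lp_norm V p (e j)") auto
qed

lemma Lp_norm_psum_crude:
  assumes "1 \<le> p" "finite J"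
  shows "\<exists>B\<ge>0. \<forall>c. Lp_norm V p (psum J c) \<le> ennreal (B * sqrt (\<Sum>j\<in>J. (norm (c j))\<^sup>2))"
proof -
  obtain B where B: "\<And>j. 0 \<le> B j" "\<And>j. Lp_norm V p (e j) \<le> ennreal (B j)"
    using Lp_norm_e_finite[OF assms(1)] by metis
  have "Lp_norm V p (psum J c) \<le> ennreal ((\<Sum>j\<in>J. B j) * sqrt (\<Sum>j\<in>J. (norm (c j))\<^sup>2))" for c
  proof -
    have le: "norm (c j) \<le> sqrt (\<Sum>j\<in>J. (norm (c j))\<^sup>2)" if "j \<in> J" for j
      using that assms(2) by (intro real_le_rsqrt member_le_sum) auto
    have "Lp_norm V p (psum J c) \<le> (\<Sum>j\<in>J. Lp_norm V p (\<lambda>x. c j * e j x))"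
      unfolding psum_def[abs_def] by (intro Lp_norm_sum_le assms L2_borel L2_cmult e_L2)
    also have "\<dots> \<le> (\<Sum>j\<in>J. ennreal (norm (c j) * B j))"
      by (intro sum_mono Lp_norm_cmult_le assms B L2_borel e_L2)
    also have "\<dots> = ennreal (\<Sum>j\<in>J. norm (c j) * B j)"
      by (intro sum_ennreal mult_nonneg_nonneg B) auto
    also have "\<dots> \<le> ennreal ((\<Sum>j\<in>J. B j) * sqrt (\<Sum>j\<in>J. (norm (c j))\<^sup>2))"
    proof (rule ennreal_leI)
      have "(\<Sum>j\<in>J. norm (c j) * B j) \<le> (\<Sum>j\<in>J. sqrt (\<Sum>j\<in>J. (norm (c j))\<^sup>2) * B j)"
        by (intro sum_mono mult_right_mono le B)
      then show "(\<Sum>j\<in>J. norm (c j) * B j) \<le> (\<Sum>j\<in>J. B j) * sqrt (\<Sum>j\<in>J. (norm (c j))\<^sup>2)"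
        by (simp add: sum_distrib_left sum_distrib_right mult.commute)
    qed
    finally show ?thesis .
  qed
  then show ?thesis using B by (intro exI[of _ "\<Sum>j\<in>J. B j"]) (auto intro: sum_nonneg)
qed

end

context laplace_spectrum
begin

lemma psum_split:
  assumes "finite J"
  shows "psum J c x = psum {j \<in> J. P j} c x + psum {j \<in> J. \<not> P j} c x"
proof -
  have "J = {j \<in> J. P j} \<union> {j \<in> J. \<not> P j}" by blast
  then show ?thesis
    using assms sum.union_disjoint[of "{j \<in> J. P j}" "{j \<in> J. \<not> P j}" "\<lambda>j. c j * e j x"]
    unfolding psum_def by auto
qed

lemma Lp_norm_psum_split:
  assumes "1 \<le> p" "finite J"
  shows "Lp_norm V p (psum J c) \<le> Lp_norm V p (psum {j \<in> J. P j} c) + Lp_norm V p (psum {j \<in> J. \<not> P j} c)"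
proof -
  have "psum J c = (\<lambda>x. psum {j \<in> J. P j} c x + psum {j \<in> J. \<not> P j} c x)"
    using psum_split[OF assms(2)] by blast
  then show ?thesis using Lp_norm_triangle[OF assms(1) psum_borel psum_borel] by simp
qed

lemma sum_subset_mass_le:
  "finite J \<Longrightarrow> I \<subseteq> J \<Longrightarrow> (\<Sum>j\<in>I. (norm (c j :: complex))\<^sup>2) \<le> (\<Sum>j\<in>J. (norm (c j))\<^sup>2)"
  by (rule sum_mono2) auto

lemma Lp_norm_tail_le:
  assumes p: "1 \<le> p" and f: "f \<in> L2_space V" and C: "finite C" and "0 \<le> a"
    and bd: "\<And>J. finite J \<Longrightarrow> J \<inter> C = {} \<Longrightarrow> Lp_norm V p (psum J (coef f)) \<le> ennreal a"
  shows "Lp_norm V p (\<lambda>x. f x - psum C (coef f) x) \<le> ennreal a"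
proof (rule Lp_norm_le_of_L2_limit[OF p, where f = "\<lambda>N. psum ({..<N} - C) (coef f)"])
  obtain N0 where N0: "\<And>j. j \<in> C \<Longrightarrow> j < N0"
    using C finite_nat_set_iff_bounded by auto
  have "\<forall>\<^sub>F N in sequentially. Lp_norm V 2 (\<lambda>x. f x - psum {..<N} (coef f) x) =
      Lp_norm V 2 (\<lambda>x. f x - psum C (coef f) x - psum ({..<N} - C) (coef f) x)"
    using eventually_ge_at_top[of N0]
  proof eventually_elim
    case (elim N)
    then have eq: "{..<N} = C \<union> ({..<N} - C)" using N0 order_less_le_trans by blast
    have "psum {..<N} (coef f) x = psum C (coef f) x + psum ({..<N} - C) (coef f) x" for x
    proof -
      have "psum (C \<union> ({..<N} - C)) (coef f) x = psum C (coef f) x + psum ({..<N} - C) (coef f) x"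
        unfolding psum_def using C by (intro sum.union_disjoint) auto
      then show ?thesis using eq by simp
    qed
    then show ?case by (simp add: diff_diff_eq)
  qed
  from Lim_transform_eventually[OF expansion[OF f] this]
  show "(\<lambda>N. Lp_norm V 2 (\<lambda>x. f x - psum C (coef f) x - psum ({..<N} - C) (coef f) x)) \<longlonglongrightarrow> 0" .
  show "(\<lambda>x. f x - psum C (coef f) x) \<in> L2_space V" by (intro L2_diff f psum_L2)
  show "Lp_norm V p (psum ({..<N} - C) (coef f)) \<le> ennreal a" for N by (rule bd) auto
qed (use \<open>0 \<le> a\<close> in auto)

section \<open>Windows control the frequencies near the spectral parameter\<close>

text \<open>A frequency in the cell \<open>k\<close> satisfies \<open>|k| \<le> |lam j - m| / \<delta> + 1\<close>, and \<open>m |lam j - m| \<le> |m\<^sup>2 - lam j\<^sup>2|\<close>. So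
  the weight \<open>1 + k\<^sup>2\<close> costs at most \<open>3\<close> times the mass plus \<open>2 / (\<delta> m)\<^sup>2\<close> times the squared residual.\<close>

lemma cell_weighted_mass:
  assumes \<delta>: "0 < \<delta>" and m: "1 \<le> m" and J: "finite J"
    and mass: "(\<Sum>j\<in>J. (norm (c j))\<^sup>2) \<le> 1"
    and res: "(\<Sum>j\<in>J. (m\<^sup>2 - (lam j)\<^sup>2)\<^sup>2 * (norm (c j))\<^sup>2) \<le> (\<delta> * m)\<^sup>2"
  shows "(\<Sum>k\<in>cell \<delta> m ` J. (1 + (real_of_int k)\<^sup>2) * cell_mass \<delta> m J c k) \<le> 5"
proof -
  have w: "1 + (real_of_int (cell \<delta> m j))\<^sup>2 \<le> 3 + 2 / (\<delta> * m)\<^sup>2 * (m\<^sup>2 - (lam j)\<^sup>2)\<^sup>2" for j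
  proof -
    define x where "x = (lam j - m) / \<delta>"
    have "\<bar>real_of_int (cell \<delta> m j)\<bar> \<le> \<bar>x\<bar> + 1" unfolding cell_def x_def by linarith
    then have "(real_of_int (cell \<delta> m j))\<^sup>2 \<le> (\<bar>x\<bar> + 1)\<^sup>2"
      by (metis abs_ge_zero power2_abs power_mono)
    also have "\<dots> \<le> 2 * x\<^sup>2 + 2"
      using zero_le_power2[of "\<bar>x\<bar> - 1"] by (simp add: power2_eq_square algebra_simps)
    finally have "(real_of_int (cell \<delta> m j))\<^sup>2 \<le> 2 * x\<^sup>2 + 2" .
    moreover have "x\<^sup>2 \<le> (m\<^sup>2 - (lam j)\<^sup>2)\<^sup>2 / (\<delta> * m)\<^sup>2"
    proof -
      have "m\<^sup>2 \<le> (lam j + m)\<^sup>2" using m lam_nonneg[of j] by (intro power_mono) auto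
      then have "(lam j - m)\<^sup>2 * m\<^sup>2 \<le> (lam j - m)\<^sup>2 * (lam j + m)\<^sup>2" by (intro mult_left_mono) auto
      also have "\<dots> = (m\<^sup>2 - (lam j)\<^sup>2)\<^sup>2" by (simp add: power2_eq_square algebra_simps)
      finally show ?thesis using \<delta> m by (simp add: x_def power_divide power_mult_distrib field_simps)
    qed
    ultimately show ?thesis by simp
  qed
  have "(\<Sum>k\<in>cell \<delta> m ` J. (1 + (real_of_int k)\<^sup>2) * cell_mass \<delta> m J c k)
      = (\<Sum>j\<in>J. (1 + (real_of_int (cell \<delta> m j))\<^sup>2) * (norm (c j))\<^sup>2)"
    by (rule sum_cell_mass[OF J])
  also have "\<dots> \<le> (\<Sum>j\<in>J. (3 + 2 / (\<delta> * m)\<^sup>2 * (m\<^sup>2 - (lam j)\<^sup>2)\<^sup>2) * (norm (c j))\<^sup>2)"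
    by (intro sum_mono mult_right_mono w) auto
  also have "\<dots> = 3 * (\<Sum>j\<in>J. (norm (c j))\<^sup>2) + 2 / (\<delta> * m)\<^sup>2 * (\<Sum>j\<in>J. (m\<^sup>2 - (lam j)\<^sup>2)\<^sup>2 * (norm (c j))\<^sup>2)"
    by (simp add: distrib_right sum.distrib sum_distrib_left mult.assoc)
  also have "\<dots> \<le> 3 * 1 + 2 / (\<delta> * m)\<^sup>2 * (\<delta> * m)\<^sup>2"
    by (intro add_mono mult_left_mono mass res) auto
  also have "\<dots> = 5" using \<delta> m by simp
  finally show ?thesis .
qed

text \<open>The factor \<open>2 powr \<sigma>\<close> comes from replacing the left end of each cell by \<open>2 m\<close>, and \<open>sqrt (5 C)\<close> from Cauchy-Schwarz.
  Neither depends on \<open>\<delta>\<close>, which is what makes \<open>\<epsilon>\<close> usable as a small factor although \<open>\<delta>\<close> depends on it.\<close>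

lemma Lp_norm_near_le:
  assumes W: "window_bound p \<sigma> \<epsilon> \<delta> \<Lambda>" and p: "1 \<le> p" and \<delta>: "0 < \<delta>" "\<delta> < 1" and \<epsilon>: "0 \<le> \<epsilon>"
    and \<Lambda>: "1 \<le> \<Lambda>" and \<sigma>: "0 \<le> \<sigma>" and m: "1 \<le> m"
    and J: "finite J" "\<And>j. j \<in> J \<Longrightarrow> \<Lambda> + 1 < lam j" "\<And>j. j \<in> J \<Longrightarrow> lam j < 2 * m"
    and mass: "(\<Sum>j\<in>J. (norm (c j))\<^sup>2) \<le> 1"
    and res: "(\<Sum>j\<in>J. (m\<^sup>2 - (lam j)\<^sup>2)\<^sup>2 * (norm (c j))\<^sup>2) \<le> (\<delta> * m)\<^sup>2"
    and C: "\<And>K :: int set. finite K \<Longrightarrow> (\<Sum>k\<in>K. 1 / (1 + (real_of_int k)\<^sup>2)) \<le> C"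
  shows "Lp_norm V p (psum J c) \<le> ennreal (\<epsilon> * (2 powr \<sigma> * sqrt (5 * C)) * m powr \<sigma>)"
proof -
  let ?K = "cell \<delta> m ` J" and ?M = "cell_mass \<delta> m J c"
  have C0: "0 \<le> C" using C[of "{}"] by simp
  have "(\<Sum>k\<in>?K. (m + \<delta> * real_of_int k) powr \<sigma> * sqrt (?M k)) \<le> (\<Sum>k\<in>?K. (2 * m) powr \<sigma> * sqrt (?M k))"
  proof (rule sum_mono)
    fix k assume "k \<in> ?K"
    then obtain i where i: "i \<in> J" "cell \<delta> m i = k" by auto
    have "0 \<le> m + \<delta> * real_of_int k" "m + \<delta> * real_of_int k \<le> 2 * m"
      using cell_bounds[OF \<delta>(1), where j = i and a = m] J(2,3)[OF i(1)] i \<delta> \<Lambda> by simp_all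
    then show "(m + \<delta> * real_of_int k) powr \<sigma> * sqrt (?M k) \<le> (2 * m) powr \<sigma> * sqrt (?M k)"
      using \<sigma> by (intro mult_right_mono powr_mono2 real_sqrt_ge_zero cell_mass_nonneg)
  qed
  also have "\<dots> = (2 * m) powr \<sigma> * (\<Sum>k\<in>?K. sqrt (1 / (1 + (real_of_int k)\<^sup>2)) * sqrt ((1 + (real_of_int k)\<^sup>2) * ?M k))"
  proof -
    have "sqrt (?M k) = sqrt (1 / (1 + (real_of_int k)\<^sup>2)) * sqrt ((1 + (real_of_int k)\<^sup>2) * ?M k)" for k
    proof -
      have "1 + (real_of_int k)\<^sup>2 \<noteq> 0" using zero_le_power2[of "real_of_int k"] by linarith
      then show ?thesis by (simp flip: real_sqrt_mult)
    qed
    then show ?thesis unfolding sum_distrib_left by (intro sum.cong refl) simp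
  qed
  also have "\<dots> \<le> (2 * m) powr \<sigma> * (sqrt (\<Sum>k\<in>?K. (sqrt (1 / (1 + (real_of_int k)\<^sup>2)))\<^sup>2) *
      sqrt (\<Sum>k\<in>?K. (sqrt ((1 + (real_of_int k)\<^sup>2) * ?M k))\<^sup>2))"
    by (intro mult_left_mono sum_mult_le_sqrt) auto
  also have "\<dots> = (2 * m) powr \<sigma> * (sqrt (\<Sum>k\<in>?K. 1 / (1 + (real_of_int k)\<^sup>2)) *
      sqrt (\<Sum>k\<in>?K. (1 + (real_of_int k)\<^sup>2) * ?M k))"
    using cell_mass_nonneg by (simp add: real_sqrt_pow2 add_nonneg_nonneg mult_nonneg_nonneg)
  also have "\<dots> \<le> (2 * m) powr \<sigma> * (sqrt C * sqrt 5)"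
    using J cell_weighted_mass[OF \<delta>(1) m J(1) mass res] C0
    by (intro mult_left_mono mult_mono real_sqrt_le_mono C) (auto intro!: sum_nonneg mult_nonneg_nonneg cell_mass_nonneg)
  also have "\<dots> = 2 powr \<sigma> * sqrt (5 * C) * m powr \<sigma>"
    using m by (simp add: powr_mult real_sqrt_mult)
  finally have "\<epsilon> * (\<Sum>k\<in>?K. (m + \<delta> * real_of_int k) powr \<sigma> * sqrt (?M k)) \<le> \<epsilon> * (2 powr \<sigma> * sqrt (5 * C) * m powr \<sigma>)"
    using \<epsilon> by (rule mult_left_mono)
  then show ?thesis
    using Lp_norm_psum_cells[OF W p \<delta> \<epsilon> J(1,2), of c m] by (simp add: ennreal_leI mult.assoc order_trans)
qed

lemma low_frequencies_smallo:
  assumes fin: "\<And>L. finite {j. lam j \<le> L}" and p: "2 < p" and n: "2 \<le> n"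
    and win: "shrinking_window_bound V lam e n p"
    and \<mu>: "filterlim \<mu> at_top sequentially" and lap: "\<And>k. has_L2_laplacian A g V (\<psi> k) (D k)"
    and one: "\<And>k. (\<integral>x. (norm (\<psi> k x))\<^sup>2 \<partial>V) = 1"
    and res: "is_smallo (\<lambda>k. Lp_norm V 2 (\<lambda>x. D k x + of_real ((\<mu> k)\<^sup>2) * \<psi> k x)) \<mu>"
  shows "is_smallo (\<lambda>k. Lp_norm V p (psum {j. lam j < 2 * \<mu> k} (coef (\<psi> k)))) (\<lambda>k. \<mu> k powr sogge_exponent p n)"
  unfolding is_smallo_def
proof (intro allI impI)
  fix \<epsilon> :: real assume \<epsilon>: "0 < \<epsilon>"
  let ?\<sigma> = "sogge_exponent p n"
  have \<sigma>: "0 < ?\<sigma>" by (rule sogge_exponent_pos[OF p n])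
  have p1: "1 \<le> p" using p by (cases p) auto
  obtain C where C: "0 < C" "\<And>K :: int set. finite K \<Longrightarrow> (\<Sum>k\<in>K. 1 / (1 + (real_of_int k)\<^sup>2)) \<le> C"
    by (rule sum_int_inverse_squares_bounded) blast
  define H where "H = 2 powr ?\<sigma> * sqrt (5 * C)"
  have H: "0 < H" using C by (simp add: H_def)
  \<comment> \<open>the window bound is used with a constant so small that the cells contribute at most half of \<open>\<epsilon>\<close>\<close>
  define \<epsilon>1 where "\<epsilon>1 = \<epsilon> / 2 / H"
  have \<epsilon>1: "0 < \<epsilon>1" "\<epsilon>1 * H = \<epsilon> / 2" using \<epsilon> H by (auto simp: \<epsilon>1_def)
  obtain \<delta> \<Lambda> where \<delta>: "0 < \<delta>" "\<delta> < 1" and \<Lambda>: "1 \<le> \<Lambda>" and W: "window_bound p ?\<sigma> \<epsilon>1 \<delta> \<Lambda>"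
    by (rule window_bound_of_shrinking[OF fin p1 win \<epsilon>1(1)])
  obtain B where B: "0 \<le> B" and crude: "\<And>c. Lp_norm V p (psum {j. lam j \<le> \<Lambda> + 1} c) \<le>
      ennreal (B * sqrt (\<Sum>j | lam j \<le> \<Lambda> + 1. (norm (c j))\<^sup>2))"
    using Lp_norm_psum_crude[OF p1 fin] by blast
  \<comment> \<open>beyond \<open>t\<close> the bounded contribution of the frequencies below \<open>\<Lambda> + 1\<close> is at most half of \<open>\<epsilon> \<mu>\<^bsup>\<sigma>\<^esup>\<close>\<close>
  define t where "t = (2 * B / \<epsilon>) powr (1 / ?\<sigma>)"
  have "\<forall>\<^sub>F k in sequentially. \<mu> k > max t (\<Lambda> + 1)" using \<mu> unfolding filterlim_at_top_dense by (rule spec)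
  moreover have "\<forall>\<^sub>F k in sequentially. Lp_norm V 2 (\<lambda>x. D k x + of_real ((\<mu> k)\<^sup>2) * \<psi> k x) \<le> ennreal (\<delta> * \<mu> k)"
    using res \<delta> unfolding is_smallo_def by simp
  ultimately show "\<forall>\<^sub>F k in sequentially. Lp_norm V p (psum {j. lam j < 2 * \<mu> k} (coef (\<psi> k))) \<le> ennreal (\<epsilon> * \<mu> k powr ?\<sigma>)"
  proof eventually_elim
    case (elim k)
    let ?m = "\<mu> k" and ?c = "coef (\<psi> k)"
    define J where "J = {j. lam j < 2 * ?m}"
    have J: "finite J" unfolding J_def by (rule finite_subset[OF _ fin[of "2 * ?m"]]) auto
    have m: "1 \<le> ?m" "\<Lambda> + 1 < 2 * ?m" using elim \<Lambda> by auto
    have "0 \<le> \<delta> * ?m" using \<delta> m by simp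
    note qc = quasimode_coef[OF lap one elim(2) this]
    have low: "{j \<in> J. lam j \<le> \<Lambda> + 1} = {j. lam j \<le> \<Lambda> + 1}" using m by (auto simp: J_def)
    have "Lp_norm V p (psum {j \<in> J. lam j \<le> \<Lambda> + 1} ?c) \<le> ennreal (\<epsilon> / 2 * ?m powr ?\<sigma>)"
    proof -
      have "Lp_norm V p (psum {j \<in> J. lam j \<le> \<Lambda> + 1} ?c) \<le> ennreal (B * sqrt (\<Sum>j | lam j \<le> \<Lambda> + 1. (norm (?c j))\<^sup>2))"
        unfolding low by (rule crude)
      also have "\<dots> \<le> ennreal (\<epsilon> / 2 * ?m powr ?\<sigma>)"
      proof (rule ennreal_leI)
        have "B * sqrt (\<Sum>j | lam j \<le> \<Lambda> + 1. (norm (?c j))\<^sup>2) \<le> B * 1"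
          using B qc(1)[OF fin[of "\<Lambda> + 1"]] by (intro mult_left_mono) auto
        also have "B * 1 \<le> \<epsilon> / 2 * ?m powr ?\<sigma>"
        proof -
          have "2 * B / \<epsilon> = t powr ?\<sigma>" using \<sigma> \<epsilon> B by (simp add: t_def powr_powr)
          also have "\<dots> \<le> ?m powr ?\<sigma>" using elim \<sigma> by (intro powr_mono2) (auto simp: t_def)
          finally show ?thesis using \<epsilon> by (simp add: field_simps)
        qed
        finally show "B * sqrt (\<Sum>j | lam j \<le> \<Lambda> + 1. (norm (?c j))\<^sup>2) \<le> \<epsilon> / 2 * ?m powr ?\<sigma>" .
      qed
      finally show ?thesis .
    qed
    moreover have "Lp_norm V p (psum {j \<in> J. \<not> lam j \<le> \<Lambda> + 1} ?c) \<le> ennreal (\<epsilon> / 2 * ?m powr ?\<sigma>)"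
    proof -
      have fJ: "finite {j \<in> J. \<not> lam j \<le> \<Lambda> + 1}" using J by simp
      have "Lp_norm V p (psum {j \<in> J. \<not> lam j \<le> \<Lambda> + 1} ?c) \<le> ennreal (\<epsilon>1 * H * ?m powr ?\<sigma>)"
        unfolding H_def
        by (rule Lp_norm_near_le[OF W p1 \<delta> less_imp_le[OF \<epsilon>1(1)] \<Lambda> less_imp_le[OF \<sigma>] m(1) fJ _ _ qc(1)[OF fJ] qc(2)[OF fJ] C(2)])
           (auto simp: J_def)
      then show ?thesis unfolding \<epsilon>1(2) .
    qed
    ultimately have "Lp_norm V p (psum J ?c) \<le> ennreal (\<epsilon> / 2 * ?m powr ?\<sigma>) + ennreal (\<epsilon> / 2 * ?m powr ?\<sigma>)"
      using Lp_norm_psum_split[OF p1 J, of ?c "\<lambda>j. lam j \<le> \<Lambda> + 1"] by (meson add_mono order_trans)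
    also have "\<dots> = ennreal (\<epsilon> * ?m powr ?\<sigma>)" using \<epsilon> by (simp flip: ennreal_plus)
    finally show ?case unfolding J_def .
  qed
qed

section \<open>High frequencies below the critical exponent\<close>

lemma quasimode_high_mass:
  assumes m: "0 \<le> m" and J: "finite J" "\<And>j. j \<in> J \<Longrightarrow> 2 * m \<le> lam j"
    and res: "(\<Sum>j\<in>J. (m\<^sup>2 - (lam j)\<^sup>2)\<^sup>2 * (norm (c j :: complex))\<^sup>2) \<le> r\<^sup>2"
  shows "(\<Sum>j\<in>J. (lam j) ^ 4 * (norm (c j))\<^sup>2) \<le> 2 * r\<^sup>2"
proof -
  have "(lam j) ^ 4 \<le> 2 * (m\<^sup>2 - (lam j)\<^sup>2)\<^sup>2" if "j \<in> J" for j
  proof -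
    have "(2 * m)\<^sup>2 \<le> (lam j)\<^sup>2" using m J(2)[OF that] by (intro power_mono) auto
    then have "3 / 4 * (lam j)\<^sup>2 \<le> (lam j)\<^sup>2 - m\<^sup>2" by (simp add: power_mult_distrib)
    then have "(3 / 4 * (lam j)\<^sup>2)\<^sup>2 \<le> ((lam j)\<^sup>2 - m\<^sup>2)\<^sup>2" by (intro power_mono) auto
    moreover have "(3 / 4 * (lam j)\<^sup>2)\<^sup>2 = 9 / 16 * (lam j) ^ 4" by (simp add: power2_eq_square power4_eq_xxxx)
    moreover have "((lam j)\<^sup>2 - m\<^sup>2)\<^sup>2 = (m\<^sup>2 - (lam j)\<^sup>2)\<^sup>2" by (rule power2_commute)
    moreover have "0 \<le> (lam j) ^ 4" using lam_nonneg by simp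
    ultimately show ?thesis by linarith
  qed
  then have "(\<Sum>j\<in>J. (lam j) ^ 4 * (norm (c j))\<^sup>2) \<le> (\<Sum>j\<in>J. 2 * (m\<^sup>2 - (lam j)\<^sup>2)\<^sup>2 * (norm (c j))\<^sup>2)"
    by (intro sum_mono mult_right_mono) auto
  also have "\<dots> \<le> 2 * r\<^sup>2" using res by (simp add: sum_distrib_left[symmetric] mult.assoc)
  finally show ?thesis .
qed

text \<open>Since \<open>\<sigma> < 3/2\<close>, the exponent \<open>2 \<sigma> - 4\<close> is less than \<open>-1\<close> and splits as \<open>- b - a\<close> with \<open>b > 1\<close>, which makes the series converge, and
  \<open>a \<ge> 0\<close>, which supplies the power of \<open>m\<close> that is needed when \<open>\<sigma> < 1\<close>.\<close>

lemma cell_power_sum_bounded: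
  assumes \<delta>: "0 < \<delta>" and \<sigma>: "\<sigma> < 3/2"
  obtains S where "0 < S" "\<And>(K :: int set) m. finite K \<Longrightarrow> 1 \<le> m \<Longrightarrow> (\<And>k. k \<in> K \<Longrightarrow> m \<le> \<delta> * real_of_int k) \<Longrightarrow>
    (\<Sum>k\<in>K. (\<delta> * real_of_int k) powr (2 * \<sigma> - 4)) \<le> S * m powr (2 * (\<sigma> - 1))"
proof -
  define b where "b = min 2 (4 - 2 * \<sigma>)"
  define a where "a = max 0 (2 - 2 * \<sigma>)"
  have ab: "2 * \<sigma> - 4 = - b + - a" "b > 1" "a \<ge> 0" "- a \<le> 2 * (\<sigma> - 1)" using \<sigma> by (auto simp: a_def b_def)
  define s where "s i = \<delta> powr (-b) * real i powr (-b)" for i :: nat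
  have sum: "summable s"
    unfolding s_def using ab(2) by (intro summable_mult) (simp add: summable_real_powr_iff)
  have "(\<Sum>k\<in>K. (\<delta> * real_of_int k) powr (2 * \<sigma> - 4)) \<le> (suminf s + 1) * m powr (2 * (\<sigma> - 1))"
    if K: "finite K" and m: "1 \<le> m" and ge: "\<And>k. k \<in> K \<Longrightarrow> m \<le> \<delta> * real_of_int k" for K :: "int set" and m
  proof -
    have pos: "0 < k" if "k \<in> K" for k
    proof -
      have "0 < \<delta> * real_of_int k" using ge[OF that] m by linarith
      then show ?thesis using \<delta> by (simp add: zero_less_mult_iff)
    qed
    have "(\<Sum>k\<in>K. (\<delta> * real_of_int k) powr (2 * \<sigma> - 4)) \<le> (\<Sum>k\<in>K. s (nat k) * m powr (2 * (\<sigma> - 1)))"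
    proof (rule sum_mono)
      fix k assume k: "k \<in> K"
      have "(\<delta> * real_of_int k) powr (-a) \<le> m powr (-a)"
        using ge[OF k] m ab by (intro powr_mono2') auto
      also have "\<dots> \<le> m powr (2 * (\<sigma> - 1))" using m ab by (intro powr_mono) auto
      finally have "(\<delta> * real_of_int k) powr (-a) \<le> m powr (2 * (\<sigma> - 1))" .
      moreover have "(\<delta> * real_of_int k) powr (-b) = s (nat k)"
        using pos[OF k] \<delta> by (simp add: s_def powr_mult)
      ultimately show "(\<delta> * real_of_int k) powr (2 * \<sigma> - 4) \<le> s (nat k) * m powr (2 * (\<sigma> - 1))"
        unfolding ab(1) powr_add by (simp add: mult_left_mono s_def)
    qed
    also have "\<dots> = (\<Sum>i\<in>nat ` K. s i) * m powr (2 * (\<sigma> - 1))"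
    proof -
      have "inj_on nat K" using pos by (auto simp: inj_on_def) (metis less_imp_le nat_eq_iff2)
      then show ?thesis by (simp add: sum.reindex sum_distrib_right)
    qed
    also have "\<dots> \<le> (suminf s + 1) * m powr (2 * (\<sigma> - 1))"
      using sum_le_suminf[OF sum, of "nat ` K"] K by (intro mult_right_mono) (auto simp: s_def)
    finally show ?thesis .
  qed
  moreover have "0 \<le> suminf s" by (rule suminf_nonneg[OF sum]) (simp add: s_def)
  ultimately show ?thesis using that[of "suminf s + 1"] by simp
qed

text \<open>Cauchy-Schwarz with the weights \<open>s\<^sub>k\<^sup>4\<close>, where \<open>s\<^sub>k = \<delta> k\<close>: above \<open>2 \<mu>\<close> the quantity \<open>lam j\<^sup>2\<close> is comparable with
  \<open>lam j\<^sup>2 - \<mu>\<^sup>2\<close>, so the weighted mass is at most twice the squared residual. The width \<open>\<delta>\<close> is fixed here, and the smallness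
  comes from the residual.\<close>

lemma high_frequencies_smallo_subcritical:
  assumes fin: "\<And>L. finite {j. lam j \<le> L}" and p: "2 < p" and n: "2 \<le> n"
    and win: "shrinking_window_bound V lam e n p" and sub: "sogge_exponent p n < 3/2"
    and \<mu>: "filterlim \<mu> at_top sequentially" and lap: "\<And>k. has_L2_laplacian A g V (\<psi> k) (D k)"
    and one: "\<And>k. (\<integral>x. (norm (\<psi> k x))\<^sup>2 \<partial>V) = 1"
    and res: "is_smallo (\<lambda>k. Lp_norm V 2 (\<lambda>x. D k x + of_real ((\<mu> k)\<^sup>2) * \<psi> k x)) \<mu>"
  shows "is_smallo (\<lambda>k. Lp_norm V p (\<lambda>x. \<psi> k x - psum {j. lam j < 2 * \<mu> k} (coef (\<psi> k)) x))
    (\<lambda>k. \<mu> k powr sogge_exponent p n)"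
  unfolding is_smallo_def
proof (intro allI impI)
  fix \<epsilon> :: real assume \<epsilon>: "0 < \<epsilon>"
  let ?\<sigma> = "sogge_exponent p n"
  have p1: "1 \<le> p" using p by (cases p) auto
  obtain \<delta> \<Lambda> where \<delta>: "0 < \<delta>" "\<delta> < 1" and \<Lambda>: "1 \<le> \<Lambda>" and W: "window_bound p ?\<sigma> 1 \<delta> \<Lambda>"
    by (rule window_bound_of_shrinking[OF fin p1 win zero_less_one])
  obtain S where S: "0 < S" and Sb: "\<And>(K :: int set) m. finite K \<Longrightarrow> 1 \<le> m \<Longrightarrow> (\<And>k. k \<in> K \<Longrightarrow> m \<le> \<delta> * real_of_int k) \<Longrightarrow>
    (\<Sum>k\<in>K. (\<delta> * real_of_int k) powr (2 * ?\<sigma> - 4)) \<le> S * m powr (2 * (?\<sigma> - 1))"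
    by (rule cell_power_sum_bounded[OF \<delta>(1) sub]) blast
  \<comment> \<open>the residual is at most \<open>\<eta> \<mu>\<close> eventually, which absorbs the constant of the convergent series\<close>
  define \<eta> where "\<eta> = \<epsilon> / sqrt (2 * S)"
  have \<eta>: "0 < \<eta>" "sqrt (2 * S) * \<eta> = \<epsilon>" using \<epsilon> S by (auto simp: \<eta>_def)
  have "\<forall>\<^sub>F k in sequentially. \<mu> k > \<Lambda> + 1" using \<mu> unfolding filterlim_at_top_dense by (rule spec)
  moreover have "\<forall>\<^sub>F k in sequentially. Lp_norm V 2 (\<lambda>x. D k x + of_real ((\<mu> k)\<^sup>2) * \<psi> k x) \<le> ennreal (\<eta> * \<mu> k)"
    using res \<eta> unfolding is_smallo_def by simp
  ultimately show "\<forall>\<^sub>F k in sequentially. Lp_norm V p (\<lambda>x. \<psi> k x - psum {j. lam j < 2 * \<mu> k} (coef (\<psi> k)) x) \<le> ennreal (\<epsilon> * \<mu> k powr ?\<sigma>)"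
  proof eventually_elim
    case (elim k)
    let ?m = "\<mu> k" and ?c = "coef (\<psi> k)"
    have m: "1 \<le> ?m" using elim \<Lambda> by simp
    have "0 \<le> \<eta> * ?m" using \<eta> m by simp
    note qc = quasimode_coef[OF lap one elim(2) this]
    have \<psi>: "\<psi> k \<in> L2_space V" using lap[of k] by (simp add: has_L2_laplacian_def)
    show ?case
    proof (rule Lp_norm_tail_le[OF p1 \<psi>])
      show "finite {j. lam j < 2 * ?m}" by (rule finite_subset[OF _ fin[of "2 * ?m"]]) auto
      show "0 \<le> \<epsilon> * ?m powr ?\<sigma>" using \<epsilon> by simp
      fix J assume J: "finite J" "J \<inter> {j. lam j < 2 * ?m} = {}"
      then have Jl: "2 * ?m \<le> lam j" if "j \<in> J" for j using that by fastforce
      let ?K = "cell \<delta> 0 ` J" and ?M = "cell_mass \<delta> 0 J ?c"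
      have K: "?m \<le> \<delta> * real_of_int k" if k: "k \<in> ?K" for k
      proof -
        obtain i where "i \<in> J" "cell \<delta> 0 i = k" using k by auto
        then show ?thesis using cell_bounds(2)[OF \<delta>(1), where j = i and a = 0] Jl[of i] \<delta> m by simp
      qed
      have fourth: "(\<Sum>k\<in>?K. (\<delta> * real_of_int k) ^ 4 * ?M k) \<le> 2 * (\<eta> * ?m)\<^sup>2"
      proof -
        have "(\<Sum>k\<in>?K. (\<delta> * real_of_int k) ^ 4 * ?M k) = (\<Sum>j\<in>J. (\<delta> * real_of_int (cell \<delta> 0 j)) ^ 4 * (norm (?c j))\<^sup>2)"
          by (rule sum_cell_mass[OF J(1)])
        also have "\<dots> \<le> (\<Sum>j\<in>J. (lam j) ^ 4 * (norm (?c j))\<^sup>2)"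
        proof (intro sum_mono mult_right_mono power_mono)
          fix j assume "j \<in> J"
          then show "0 \<le> \<delta> * real_of_int (cell \<delta> 0 j)" using K[of "cell \<delta> 0 j"] m by auto
          show "\<delta> * real_of_int (cell \<delta> 0 j) \<le> lam j" using cell_bounds(1)[OF \<delta>(1), of 0 j] by simp
        qed simp
        also have "\<dots> \<le> 2 * (\<eta> * ?m)\<^sup>2"
          by (rule quasimode_high_mass[OF _ J(1) Jl qc(2)[OF J(1)]]) (use m in auto)
        finally show ?thesis .
      qed
      have "(\<Sum>k\<in>?K. (0 + \<delta> * real_of_int k) powr ?\<sigma> * sqrt (?M k)) =
          (\<Sum>k\<in>?K. (\<delta> * real_of_int k) powr (?\<sigma> - 2) * ((\<delta> * real_of_int k)\<^sup>2 * sqrt (?M k)))"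
      proof (rule sum.cong[OF refl])
        fix k assume "k \<in> ?K"
        then have "0 < \<delta> * real_of_int k" using K[of k] m by linarith
        then have "(\<delta> * real_of_int k) powr ?\<sigma> = (\<delta> * real_of_int k) powr (?\<sigma> - 2) * (\<delta> * real_of_int k)\<^sup>2"
          by (simp add: powr_diff powr_numeral)
        then show "(0 + \<delta> * real_of_int k) powr ?\<sigma> * sqrt (?M k) =
          (\<delta> * real_of_int k) powr (?\<sigma> - 2) * ((\<delta> * real_of_int k)\<^sup>2 * sqrt (?M k))" by simp
      qed
      also have "\<dots> \<le> sqrt (\<Sum>k\<in>?K. ((\<delta> * real_of_int k) powr (?\<sigma> - 2))\<^sup>2) * sqrt (\<Sum>k\<in>?K. ((\<delta> * real_of_int k)\<^sup>2 * sqrt (?M k))\<^sup>2)"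
        by (rule sum_mult_le_sqrt)
      also have "(\<Sum>k\<in>?K. ((\<delta> * real_of_int k) powr (?\<sigma> - 2))\<^sup>2) = (\<Sum>k\<in>?K. (\<delta> * real_of_int k) powr (2 * ?\<sigma> - 4))"
      proof (rule sum.cong[OF refl])
        fix k
        show "((\<delta> * real_of_int k) powr (?\<sigma> - 2))\<^sup>2 = (\<delta> * real_of_int k) powr (2 * ?\<sigma> - 4)"
          unfolding power2_eq_square powr_add[symmetric] by simp
      qed
      also have "(\<Sum>k\<in>?K. ((\<delta> * real_of_int k)\<^sup>2 * sqrt (?M k))\<^sup>2) = (\<Sum>k\<in>?K. (\<delta> * real_of_int k) ^ 4 * ?M k)"
        by (simp add: power_mult_distrib cell_mass_nonneg flip: power_mult)
      also have "sqrt (\<Sum>k\<in>?K. (\<delta> * real_of_int k) powr (2 * ?\<sigma> - 4)) * sqrt (\<Sum>k\<in>?K. (\<delta> * real_of_int k) ^ 4 * ?M k)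
          \<le> sqrt (S * ?m powr (2 * (?\<sigma> - 1))) * sqrt (2 * (\<eta> * ?m)\<^sup>2)"
        using J K m fourth Sb[of ?K ?m] S
        by (intro mult_mono real_sqrt_le_mono) (auto intro!: sum_nonneg mult_nonneg_nonneg cell_mass_nonneg)
      also have "\<dots> = \<epsilon> * ?m powr ?\<sigma>"
      proof -
        have "?m powr (2 * (?\<sigma> - 1)) = (?m powr (?\<sigma> - 1))\<^sup>2"
          unfolding power2_eq_square powr_add[symmetric] by simp
        then have s1: "sqrt (S * ?m powr (2 * (?\<sigma> - 1))) = sqrt S * ?m powr (?\<sigma> - 1)" by (simp add: real_sqrt_mult)
        have s2: "sqrt (2 * (\<eta> * ?m)\<^sup>2) = sqrt 2 * (\<eta> * ?m)" using \<eta> m by (simp add: real_sqrt_mult)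
        have s3: "?m powr (?\<sigma> - 1) * ?m = ?m powr ?\<sigma>" using m by (simp add: powr_diff)
        have "sqrt (S * ?m powr (2 * (?\<sigma> - 1))) * sqrt (2 * (\<eta> * ?m)\<^sup>2)
            = (sqrt 2 * sqrt S * \<eta>) * (?m powr (?\<sigma> - 1) * ?m)"
          unfolding s1 s2 by (simp only: mult_ac)
        then have "sqrt (S * ?m powr (2 * (?\<sigma> - 1))) * sqrt (2 * (\<eta> * ?m)\<^sup>2) = (sqrt (2 * S) * \<eta>) * ?m powr ?\<sigma>"
          unfolding s3 real_sqrt_mult[symmetric] .
        then show ?thesis unfolding \<eta>(2) .
      qed
      finally have "(\<Sum>k\<in>?K. (0 + \<delta> * real_of_int k) powr ?\<sigma> * sqrt (?M k)) \<le> \<epsilon> * ?m powr ?\<sigma>" .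
      moreover have "\<Lambda> + 1 < lam j" if "j \<in> J" for j using Jl[OF that] elim(1) m by linarith
      ultimately show "Lp_norm V p (psum J ?c) \<le> ennreal (\<epsilon> * ?m powr ?\<sigma>)"
        using Lp_norm_psum_cells[OF W p1 \<delta> _ J(1), of ?c 0] by (simp add: ennreal_leI order_trans)
    qed
  qed
qed

text \<open>Below any frequency \<open>N\<close> the windows only give a Bernstein inequality with the critical power of \<open>N\<close>.\<close>

lemma bernstein_of_window_bound:
  assumes fin: "\<And>L. finite {j. lam j \<le> L}" and p1: "1 \<le> p"
    and W: "window_bound p (3/2) 1 \<delta> \<Lambda>" and \<delta>: "0 < \<delta>" "\<delta> < 1" and \<Lambda>: "1 \<le> \<Lambda>"
  obtains C where "0 < C" "\<And>N J c. 1 \<le> N \<Longrightarrow> J \<subseteq> {j. lam j \<le> N} \<Longrightarrow>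
    Lp_norm V p (psum J c) \<le> ennreal (C * N\<^sup>2 * sqrt (\<Sum>j\<in>J. (norm (c j))\<^sup>2))"
proof -
  let ?J0 = "{j. lam j \<le> \<Lambda> + 1}"
  obtain B where B: "0 \<le> B" and crude: "\<And>c. Lp_norm V p (psum ?J0 c) \<le> ennreal (B * sqrt (\<Sum>j\<in>?J0. (norm (c j))\<^sup>2))"
    using Lp_norm_psum_crude[OF p1 fin] by blast
  have "Lp_norm V p (psum J c) \<le> ennreal ((B + sqrt (2 / \<delta>)) * N\<^sup>2 * sqrt (\<Sum>j\<in>J. (norm (c j))\<^sup>2))"
    if N: "1 \<le> N" and JN: "J \<subseteq> {j. lam j \<le> N}" for N J c
  proof -
    have J: "finite J" by (rule finite_subset[OF JN fin])
    define M where "M = sqrt (\<Sum>j\<in>J. (norm (c j))\<^sup>2)"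
    have M0: "0 \<le> M" unfolding M_def by (intro real_sqrt_ge_zero sum_nonneg) auto
    have "Lp_norm V p (psum {j \<in> J. lam j \<le> \<Lambda> + 1} c) \<le> ennreal (B * M)"
    proof -
      define c' where "c' j = (if j \<in> J then c j else 0)" for j
      have "psum {j \<in> J. lam j \<le> \<Lambda> + 1} c = psum ?J0 c'"
        unfolding psum_def c'_def using fin by (intro ext sum.mono_neutral_cong_left) auto
      moreover have "(\<Sum>j\<in>?J0. (norm (c' j))\<^sup>2) \<le> (\<Sum>j\<in>J. (norm (c j))\<^sup>2)"
      proof -
        have "(\<Sum>j\<in>?J0. (norm (c' j))\<^sup>2) = (\<Sum>j\<in>{j \<in> J. lam j \<le> \<Lambda> + 1}. (norm (c j))\<^sup>2)"
          unfolding c'_def using fin by (intro sum.mono_neutral_cong_right) auto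
        also have "\<dots> \<le> (\<Sum>j\<in>J. (norm (c j))\<^sup>2)" by (rule sum_subset_mass_le[OF J]) auto
        finally show ?thesis .
      qed
      ultimately show ?thesis
        using crude[of c'] B unfolding M_def
        by (simp add: order_trans[OF _ ennreal_leI] mult_left_mono)
    qed
    also have "\<dots> \<le> ennreal (B * N\<^sup>2 * M)"
    proof (rule ennreal_leI)
      have "1 \<le> N\<^sup>2" using N by simp
      then have "B * 1 \<le> B * N\<^sup>2" using B by (rule mult_left_mono)
      then show "B * M \<le> B * N\<^sup>2 * M" using M0 by (simp add: mult_right_mono)
    qed
    finally have low: "Lp_norm V p (psum {j \<in> J. lam j \<le> \<Lambda> + 1} c) \<le> ennreal (B * N\<^sup>2 * M)" .
    let ?J1 = "{j \<in> J. \<not> lam j \<le> \<Lambda> + 1}"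
    let ?K = "cell \<delta> 0 ` ?J1" and ?M = "cell_mass \<delta> 0 ?J1 c"
    have J1: "finite ?J1" using J by simp
    have K: "0 \<le> real_of_int k" "\<delta> * real_of_int k \<le> N" if k: "k \<in> ?K" for k
    proof -
      obtain i where i: "i \<in> ?J1" "cell \<delta> 0 i = k" using k by auto
      then have "lam i \<le> N" using JN by auto
      then show "\<delta> * real_of_int k \<le> N" using cell_bounds(1)[OF \<delta>(1), of 0 i] i by simp
      have "0 < \<delta> * real_of_int k"
        using cell_bounds(2)[OF \<delta>(1), where j = i and a = 0] i \<delta> \<Lambda> by simp
      then show "0 \<le> real_of_int k" using \<delta> by (simp add: zero_less_mult_iff)
    qed
    have cardK: "real (card ?K) \<le> 2 / \<delta> * N"
    proof -
      have "?K \<subseteq> {0..\<lfloor>N / \<delta>\<rfloor>}"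
        using K \<delta> by (auto simp: le_floor_iff pos_le_divide_eq mult.commute)
      then have "card ?K \<le> card {0..\<lfloor>N / \<delta>\<rfloor>}" by (intro card_mono) auto
      also have "\<dots> = nat (\<lfloor>N / \<delta>\<rfloor> + 1)" by simp
      finally have "real (card ?K) \<le> real (nat (\<lfloor>N / \<delta>\<rfloor> + 1))" by simp
      also have "\<dots> \<le> N / \<delta> + 1"
      proof -
        have "0 \<le> N / \<delta>" using N \<delta> by simp
        then show ?thesis by linarith
      qed
      also have "\<dots> \<le> 2 / \<delta> * N"
      proof -
        have "1 \<le> N / \<delta>" using N \<delta> by (simp add: pos_le_divide_eq)
        then show ?thesis by simp
      qed
      finally show ?thesis .
    qed
    have "(\<Sum>k\<in>?K. (0 + \<delta> * real_of_int k) powr (3/2) * sqrt (?M k)) \<le> (\<Sum>k\<in>?K. N powr (3/2) * (1 * sqrt (?M k)))"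
      using K \<delta> by (intro sum_mono) (auto intro!: mult_right_mono powr_mono2 real_sqrt_ge_zero cell_mass_nonneg)
    also have "\<dots> \<le> N powr (3/2) * (sqrt (\<Sum>k\<in>?K. 1\<^sup>2) * sqrt (\<Sum>k\<in>?K. (sqrt (?M k))\<^sup>2))"
      using sum_mult_le_sqrt[of "\<lambda>_. 1" "\<lambda>k. sqrt (?M k)" ?K]
      unfolding sum_distrib_left[symmetric] by (intro mult_left_mono) auto
    also have "\<dots> \<le> N powr (3/2) * (sqrt (2 / \<delta> * N) * M)"
    proof (intro mult_left_mono mult_mono)
      show "sqrt (\<Sum>k\<in>?K. 1\<^sup>2) \<le> sqrt (2 / \<delta> * N)" using cardK by simp
      have "(\<Sum>k\<in>?K. (sqrt (?M k))\<^sup>2) = (\<Sum>k\<in>?K. 1 * ?M k)" by (simp add: cell_mass_nonneg)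
      also have "\<dots> = (\<Sum>j\<in>?J1. 1 * (norm (c j))\<^sup>2)" by (rule sum_cell_mass[OF J1])
      also have "\<dots> \<le> (\<Sum>j\<in>J. (norm (c j))\<^sup>2)" using sum_subset_mass_le[OF J, of ?J1 c] by auto
      finally show "sqrt (\<Sum>k\<in>?K. (sqrt (?M k))\<^sup>2) \<le> M" unfolding M_def by simp
    qed (use N \<delta> in \<open>auto intro!: sum_nonneg\<close>)
    also have "\<dots> = sqrt (2 / \<delta>) * N\<^sup>2 * M"
    proof -
      have "N powr (3/2) * sqrt N = N powr (3/2 + 1/2)"
        unfolding powr_add using N by (simp add: powr_half_sqrt)
      also have "\<dots> = N\<^sup>2" using N by simp
      finally have h: "N powr (3/2) * sqrt N = N\<^sup>2" .
      have "N powr (3/2) * (sqrt (2 / \<delta> * N) * M) = sqrt (2 / \<delta>) * (N powr (3/2) * sqrt N) * M"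
        by (simp only: real_sqrt_mult) (simp add: mult_ac)
      then show ?thesis unfolding h .
    qed
    finally have le: "1 * (\<Sum>k\<in>?K. (0 + \<delta> * real_of_int k) powr (3/2) * sqrt (?M k)) \<le> sqrt (2 / \<delta>) * N\<^sup>2 * M"
      unfolding mult_1 .
    have "Lp_norm V p (psum ?J1 c) \<le> ennreal (1 * (\<Sum>k\<in>?K. (0 + \<delta> * real_of_int k) powr (3/2) * sqrt (?M k)))"
      by (rule Lp_norm_psum_cells[OF W p1 \<delta> zero_le_one J1]) simp
    also note ennreal_leI[OF le]
    finally have high: "Lp_norm V p (psum ?J1 c) \<le> ennreal (sqrt (2 / \<delta>) * N\<^sup>2 * M)" .
    then have "Lp_norm V p (psum J c) \<le> ennreal (B * N\<^sup>2 * M) + ennreal (sqrt (2 / \<delta>) * N\<^sup>2 * M)"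
      using low Lp_norm_psum_split[OF p1 J, of c "\<lambda>j. lam j \<le> \<Lambda> + 1"] by (meson add_mono order_trans)
    also have "\<dots> = ennreal ((B + sqrt (2 / \<delta>)) * N\<^sup>2 * M)"
      using B M0 \<delta> by (subst ennreal_plus[symmetric]) (auto simp: algebra_simps)
    finally show ?thesis unfolding M_def .
  qed
  moreover have "0 < B + sqrt (2 / \<delta>)" using B \<delta> by (simp add: add_nonneg_pos)
  ultimately show ?thesis using that[of "B + sqrt (2 / \<delta>)"] by blast
qed

end

section \<open>Nash inequality from the Bernstein inequality\<close>

text \<open>A quantitative form of the inequality between arithmetic and geometric means for \<open>Y\<^bsup>2/3\<^esup> y\<^bsup>1/3\<^esup>\<close>, with a factor in front of
  \<open>y\<close> small enough to be absorbed in \<open>sobolev_positive_part\<close>.\<close>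

lemma cube_root_absorb:
  fixes x y Y :: real
  assumes "0 \<le> y" "0 \<le> Y" "x ^ 3 \<le> Y\<^sup>2 * y"
  shows "x \<le> y / 4 + 2 * Y"
proof (rule ccontr)
  define t where "t = y / 4 + 2 * Y"
  assume "\<not> x \<le> y / 4 + 2 * Y"
  then have "t < x" "0 \<le> t" using assms by (simp_all add: t_def)
  then have "t ^ 3 < x ^ 3" by (intro power_strict_mono) auto
  moreover have "t ^ 3 = 3 * (Y\<^sup>2 * y) + (y ^ 3 / 64 + 3 / 8 * (y\<^sup>2 * Y) + 8 * Y ^ 3)"
    by (simp add: t_def power2_eq_square power3_eq_cube field_simps)
  moreover have "0 \<le> y ^ 3 / 64 + 3 / 8 * (y\<^sup>2 * Y) + 8 * Y ^ 3" "0 \<le> Y\<^sup>2 * y" using assms by auto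
  ultimately show False using assms(3) by linarith
qed

context laplace_spectrum
begin

definition energy_density :: "('m \<Rightarrow> real) \<Rightarrow> 'm \<Rightarrow> real" where
  "energy_density v x = Re (grad_form (\<lambda>x. of_real (v x)) (\<lambda>x. of_real (v x)) x)"

definition energy :: "('m \<Rightarrow> real) \<Rightarrow> real" where
  "energy v = (\<integral>x. energy_density v x \<partial>V)"

lemma energy_density_nonneg: "C1M v \<Longrightarrow> 0 \<le> energy_density v x"
  using grad_form_cnj_nonneg[OF C1M_of_real] by (simp add: energy_density_def)

lemma continuous_energy_density: "C1M v \<Longrightarrow> continuous_on UNIV (energy_density v)"
  unfolding energy_density_def[abs_def] by (intro continuous_intros continuous_grad_form C1M_of_real)

lemma energy_density_compose:
  assumes v: "C1M v" and d: "\<And>t. (\<phi> has_real_derivative \<phi>' t) (at t)" "continuous_on UNIV \<phi>'"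
  shows "energy_density (\<lambda>x. \<phi> (v x)) x = (\<phi>' (v x))\<^sup>2 * energy_density v x"
proof -
  let ?F = "\<lambda>x. complex_of_real (\<phi> (v x))" and ?v = "\<lambda>x. complex_of_real (v x)"
  have F: "C1M ?F" and v': "C1M ?v" by (intro C1M_of_real C1M_real_compose[OF v d] v)+
  have "grad_form ?F ?F x = of_real (\<phi>' (v x)) * grad_form ?v ?F x"
    by (rule grad_form_real_compose_left[OF v F d])
  also have "grad_form ?v ?F x = grad_form ?F ?v x" by (rule grad_form_commute[OF v' F])
  also have "\<dots> = of_real (\<phi>' (v x)) * grad_form ?v ?v x"
    by (rule grad_form_real_compose_left[OF v v' d])
  finally show ?thesis unfolding energy_density_def by (simp add: power2_eq_square)
qed

lemma grad_form_diff_left: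
  assumes "C1M f" "C1M k" "C1M h"
  shows "grad_form (\<lambda>x. f x - k x) h x = grad_form f h x - grad_form k h x"
  using grad_form_add_left[OF assms(1) C1M_mult[OF C1M_const assms(2), of "-1"] assms(3)]
    grad_form_cmult_left[OF assms(2,3), of "-1"] by simp

lemma integral_grad_psum_cnj:
  assumes J: "finite J" and u: "C1M u"
  shows "(\<integral>x. grad_form (psum J c) (\<lambda>x. cnj (u x)) x \<partial>V) = (\<Sum>j\<in>J. c j * (of_real ((lam j)\<^sup>2) * cnj (coef u j)))"
proof -
  have cu: "C1M (\<lambda>x. cnj (u x))" by (rule C1M_bounded_linear[OF bounded_linear_cnj u])
  have "grad_form (psum J c) (\<lambda>x. cnj (u x)) x = (\<Sum>j\<in>J. c j * grad_form (\<lambda>x. cnj (u x)) (e j) x)" for x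
    unfolding psum_def[abs_def]
    by (simp add: grad_form_sum_left grad_form_cmult_left C1M_mult e_C1M cu grad_form_commute[OF e_C1M cu])
  moreover have "integrable V (grad_form (\<lambda>x. cnj (u x)) (e j))" for j
    by (intro integrable_continuous continuous_grad_form cu e_C1M)
  ultimately have "(\<integral>x. grad_form (psum J c) (\<lambda>x. cnj (u x)) x \<partial>V) =
      (\<Sum>j\<in>J. c j * (\<integral>x. grad_form (\<lambda>x. cnj (u x)) (e j) x \<partial>V))"
    by (simp add: Bochner_Integration.integral_sum)
  moreover have "(\<integral>x. cnj (u x) * e j x \<partial>V) = cnj (coef u j)" for j
    unfolding coef_def L2_inner_def Bochner_Integration.integral_cnj[symmetric] by (simp add: mult.commute)
  ultimately show ?thesis by (simp add: weak_eigenfunction[OF cu])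
qed

text \<open>The gradients of the \<open>e j\<close> are orthogonal with squared length \<open>lam j\<^sup>2\<close>, so this is Bessel's inequality for the
  gradient form: the energy of the remainder \<open>h\<close> is nonnegative and \<open>h\<close> is orthogonal to the finite sum \<open>w\<close>.\<close>

lemma energy_bessel:
  assumes J: "finite J" and v: "C1M v"
  shows "(\<Sum>j\<in>J. (lam j)\<^sup>2 * (norm (coef (\<lambda>x. of_real (v x)) j))\<^sup>2) \<le> energy v"
proof -
  define F where "F x = complex_of_real (v x)" for x
  define w where "w = psum J (coef F)"
  define h where "h x = F x - w x" for x
  define Q where "Q = (\<Sum>j\<in>J. (lam j)\<^sup>2 * (norm (coef F j))\<^sup>2)"
  have F: "C1M F" unfolding F_def[abs_def] by (rule C1M_of_real[OF v])
  have w: "C1M w" unfolding w_def by (rule psum_C1M)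
  have mw: "C1M (\<lambda>x. (-1) * w x)" by (intro C1M_mult C1M_const w)
  have h_eq: "h = (\<lambda>x. F x + (-1) * w x)" by (auto simp: h_def)
  have h: "C1M h" unfolding h_eq by (intro C1M_add F mw)
  have cF: "C1M (\<lambda>x. cnj (F x))" and cw: "C1M (\<lambda>x. cnj (w x))" and ch: "C1M (\<lambda>x. cnj (h x))"
    by (intro C1M_bounded_linear[OF bounded_linear_cnj] F w h)+
  have FL: "F \<in> L2_space V" by (rule L2_continuous[OF C1M_continuous[OF F]])
  have coefh: "coef h j = 0" if "j \<in> J" for j
    unfolding h_def[abs_def] coef_diff[OF FL psum_L2[of J "coef F", folded w_def]]
    using that by (simp add: w_def coef_psum[OF J])
  have wh: "(\<integral>x. grad_form w (\<lambda>x. cnj (h x)) x \<partial>V) = 0"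
    unfolding w_def integral_grad_psum_cnj[OF J h] by (simp add: coefh)
  have wF: "(\<integral>x. grad_form w (\<lambda>x. cnj (F x)) x \<partial>V) = of_real Q"
    unfolding w_def integral_grad_psum_cnj[OF J F] Q_def
    by (simp add: complex_norm_square mult_ac del: of_real_power) 
  have int: "integrable V (grad_form a b)" if "C1M a" "C1M b" for a b
    by (intro integrable_continuous continuous_grad_form that)
  have "grad_form h (\<lambda>x. cnj (h x)) x = grad_form F (\<lambda>x. cnj (F x)) x - cnj (grad_form w (\<lambda>x. cnj (F x)) x) - grad_form w (\<lambda>x. cnj (h x)) x" for x
  proof -
    have "grad_form h (\<lambda>x. cnj (h x)) x = grad_form F (\<lambda>x. cnj (h x)) x - grad_form w (\<lambda>x. cnj (h x)) x"
      using grad_form_diff_left[OF F w ch, of x] by (simp only: h_def[abs_def, symmetric])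
    also have "grad_form F (\<lambda>x. cnj (h x)) x = cnj (grad_form h (\<lambda>x. cnj (F x)) x)"
      using grad_form_cnj[OF h cF, of x] by (simp add: grad_form_commute[OF F ch])
    also have "grad_form h (\<lambda>x. cnj (F x)) x = grad_form F (\<lambda>x. cnj (F x)) x - grad_form w (\<lambda>x. cnj (F x)) x"
      using grad_form_diff_left[OF F w cF, of x] by (simp only: h_def[abs_def, symmetric])
    also have "cnj (grad_form F (\<lambda>x. cnj (F x)) x - grad_form w (\<lambda>x. cnj (F x)) x) =
        grad_form F (\<lambda>x. cnj (F x)) x - cnj (grad_form w (\<lambda>x. cnj (F x)) x)"
      using grad_form_cnj[OF F cF, of x] by (simp add: grad_form_commute[OF cF F])
    finally show ?thesis .
  qed
  then have "(\<integral>x. grad_form h (\<lambda>x. cnj (h x)) x \<partial>V) =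
      (\<integral>x. grad_form F (\<lambda>x. cnj (F x)) x \<partial>V) - cnj (of_real Q) - 0"
    using int[OF F cF] int[OF w cF] int[OF w ch] by (simp add: wF wh)
  then have "Re (\<integral>x. grad_form h (\<lambda>x. cnj (h x)) x \<partial>V) = Re (\<integral>x. grad_form F (\<lambda>x. cnj (F x)) x \<partial>V) - Q"
    by simp
  moreover have "0 \<le> Re (\<integral>x. grad_form h (\<lambda>x. cnj (h x)) x \<partial>V)"
    unfolding integral_Re[OF int[OF h ch], symmetric]
    by (intro Bochner_Integration.integral_nonneg grad_form_cnj_nonneg h)
  moreover have "Re (\<integral>x. grad_form F (\<lambda>x. cnj (F x)) x \<partial>V) = energy v"
    unfolding integral_Re[OF int[OF F cF], symmetric] unfolding energy_def energy_density_def F_def by simp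
  ultimately show ?thesis unfolding Q_def F_def by linarith
qed

text \<open>By duality, a Bernstein inequality into \<open>L\<^sup>q\<close> bounds the low frequency part of a function by
  its height and the volume of its support.\<close>

lemma low_mass_of_support:
  assumes bern: "\<And>c. Lp_norm V (ereal q) (psum J c) \<le> ennreal (K * sqrt (\<Sum>j\<in>J. (norm (c j))\<^sup>2))"
    and K: "0 < K" and q: "1 < q" and J: "finite J" and v: "C1M v" and S: "S \<in> sets V"
    and bd: "\<And>x. \<bar>v x\<bar> \<le> H * indicator S x" and H: "0 \<le> H"
  shows "(\<Sum>j\<in>J. (norm (coef (\<lambda>x. of_real (v x)) j))\<^sup>2) \<le> (H * K * measure V S powr (1 - 1/q))\<^sup>2"
proof -
  define F where "F x = complex_of_real (v x)" for x
  define X where "X = (\<Sum>j\<in>J. (norm (coef F j))\<^sup>2)"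
  have X0: "0 \<le> X" unfolding X_def by (intro sum_nonneg) auto
  let ?w = "psum J (coef F)" and ?m = "measure V S powr (1 - 1/q)"
  have F: "C1M F" unfolding F_def[abs_def] by (rule C1M_of_real[OF v])
  have FL: "F \<in> L2_space V" by (rule L2_continuous[OF C1M_continuous[OF F]])
  show ?thesis
  proof (cases "X = 0")
    case False
    then have X: "0 < X" using X0 by simp
    have int: "integrable V (\<lambda>x. F x * cnj (?w x))"
      by (rule L2_mult_integrable[OF FL L2_cnj[OF psum_L2]])
    have "X = norm (L2_inner V F ?w)"
    proof -
      have "L2_inner V F ?w = of_real X"
        unfolding inner_psum[OF J FL] X_def by (simp add: complex_norm_square mult.commute del: of_real_power)
      then show ?thesis using X by simp
    qed
    also have "\<dots> \<le> (\<integral>x. norm (F x * cnj (?w x)) \<partial>V)"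
      unfolding L2_inner_def by (rule integral_norm_bound)
    finally have "ennreal X \<le> ennreal (\<integral>x. norm (F x * cnj (?w x)) \<partial>V)" by (rule ennreal_leI)
    also have "\<dots> = (\<integral>\<^sup>+x. ennreal (norm (F x * cnj (?w x))) \<partial>V)"
      using int by (intro nn_integral_eq_integral[symmetric]) auto
    also have "\<dots> \<le> (\<integral>\<^sup>+x. ennreal H * (ennreal (norm (?w x)) * indicator S x) \<partial>V)"
    proof (rule nn_integral_mono)
      fix x
      have "norm (F x * cnj (?w x)) \<le> H * indicator S x * norm (?w x)"
        using bd[of x] by (simp add: norm_mult F_def mult_right_mono)
      then show "ennreal (norm (F x * cnj (?w x))) \<le> ennreal H * (ennreal (norm (?w x)) * indicator S x)"
        using H by (auto simp: indicator_def simp flip: ennreal_mult intro: ennreal_leI)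
    qed
    also have "\<dots> = ennreal H * (\<integral>\<^sup>+x\<in>S. ennreal (norm (?w x)) \<partial>V)"
    proof -
      have [measurable]: "?w \<in> borel_measurable V" "S \<in> sets V" by (rule psum_borel, rule S)
      show ?thesis by (intro nn_integral_cmult) measurable
    qed
    also have "\<dots> \<le> ennreal H * ennreal (K * sqrt X * ?m)"
      using X K bern[of "coef F"]
      by (intro mult_left_mono set_nn_integral_le_Lp_norm[OF finite_V q psum_borel S]) (auto simp: X_def)
    also have "\<dots> = ennreal (H * (K * sqrt X * ?m))"
      using H K X by (simp add: ennreal_mult)
    finally have "X \<le> H * (K * sqrt X * ?m)"
      using H K X by (simp add: ennreal_le_iff)
    then have "sqrt X * sqrt X \<le> sqrt X * (H * K * ?m)" using X by (simp add: mult_ac)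
    then have "sqrt X \<le> H * K * ?m" by (rule mult_left_le_imp_le) (use X in simp)
    then have "X \<le> (H * K * ?m)\<^sup>2" using X by (simp add: real_le_lsqrt sqrt_le_D)
    then show ?thesis unfolding X_def F_def .
  qed (simp add: X_def F_def[abs_def])
qed

text \<open>The power \<open>2\<close> of \<open>N\<close> is that of the critical exponent, where \<open>n (1/2 - 1/q) = 2\<close>.\<close>

definition bernstein :: "real \<Rightarrow> real \<Rightarrow> bool" where
  "bernstein q C \<longleftrightarrow> (\<forall>N J c. 1 \<le> N \<longrightarrow> J \<subseteq> {j. lam j \<le> N} \<longrightarrow>
     Lp_norm V (ereal q) (psum J c) \<le> ennreal (C * N\<^sup>2 * sqrt (\<Sum>j\<in>J. (norm (c j))\<^sup>2)))"

lemma bernsteinD: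
  "bernstein q C \<Longrightarrow> 1 \<le> N \<Longrightarrow> J \<subseteq> {j. lam j \<le> N} \<Longrightarrow>
    Lp_norm V (ereal q) (psum J c) \<le> ennreal (C * N\<^sup>2 * sqrt (\<Sum>j\<in>J. (norm (c j))\<^sup>2))"
  unfolding bernstein_def by blast

text \<open>Split the mass of \<open>v\<close> at frequency \<open>N\<close>: the low part is at most \<open>a N\<^sup>4\<close> by duality and the high part at most
  \<open>energy v / N\<^sup>2\<close>. The two balance at \<open>N\<^sup>6 = E / a\<close>. Only \<open>N \<ge> 1\<close> is allowed, and the mass
  is included in \<open>E\<close> so that the remaining case \<open>E \<le> a\<close> is trivial.\<close>

lemma nash:
  assumes fin: "\<And>L. finite {j. lam j \<le> L}" and B: "bernstein q C" and C: "0 < C" and q: "1 < q"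
    and v: "C1M v" and S: "S \<in> sets V" and bd: "\<And>x. \<bar>v x\<bar> \<le> H * indicator S x" and H: "0 \<le> H"
  shows "(\<integral>x. (v x)\<^sup>2 \<partial>V) ^ 3 \<le>
    8 * (energy v + (\<integral>x. (v x)\<^sup>2 \<partial>V))\<^sup>2 * (H * C * measure V S powr (1 - 1/q))\<^sup>2"
proof -
  define F where "F x = complex_of_real (v x)" for x
  define X where "X = (\<integral>x. (v x)\<^sup>2 \<partial>V)"
  define a where "a = (H * C * measure V S powr (1 - 1/q))\<^sup>2"
  have F: "C1M F" unfolding F_def[abs_def] by (rule C1M_of_real[OF v])
  have FL: "F \<in> L2_space V" by (rule L2_continuous[OF C1M_continuous[OF F]])
  have X0: "0 \<le> X" unfolding X_def by (intro Bochner_Integration.integral_nonneg) simp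
  have E0: "0 \<le> energy v"
    unfolding energy_def by (intro Bochner_Integration.integral_nonneg energy_density_nonneg v)
  have a0: "0 \<le> a" by (simp add: a_def)
  have split: "X \<le> a * N ^ 4 + energy v / N\<^sup>2" if N: "1 \<le> N" for N
  proof -
    have part: "(\<Sum>j<k. (norm (coef F j))\<^sup>2) \<le> a * N ^ 4 + energy v / N\<^sup>2" for k
    proof -
      have "(\<Sum>j<k. (norm (coef F j))\<^sup>2) = (\<Sum>j\<in>{j\<in>{..<k}. lam j \<le> N}. (norm (coef F j))\<^sup>2) + (\<Sum>j\<in>{j\<in>{..<k}. N < lam j}. (norm (coef F j))\<^sup>2)"
        by (subst sum.union_disjoint[symmetric]) (auto intro!: sum.cong)
      also have "\<dots> \<le> a * N ^ 4 + energy v / N\<^sup>2"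
      proof (rule add_mono)
        have "(\<Sum>j\<in>{j\<in>{..<k}. lam j \<le> N}. (norm (coef F j))\<^sup>2) \<le> (H * (C * N\<^sup>2) * measure V S powr (1 - 1/q))\<^sup>2"
          unfolding F_def
          by (rule low_mass_of_support[OF bernsteinD[OF B N] _ q _ v S bd H]) (use C N in auto)
        also have "\<dots> = a * N ^ 4" by (simp add: a_def power_mult_distrib flip: power_mult)
        finally show "(\<Sum>j\<in>{j\<in>{..<k}. lam j \<le> N}. (norm (coef F j))\<^sup>2) \<le> a * N ^ 4" .
        have "(\<Sum>j\<in>{j\<in>{..<k}. N < lam j}. (norm (coef F j))\<^sup>2) * N\<^sup>2 \<le> (\<Sum>j\<in>{j\<in>{..<k}. N < lam j}. (lam j)\<^sup>2 * (norm (coef F j))\<^sup>2)"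
          unfolding sum_distrib_right using N
          by (intro sum_mono) (auto simp: mult.commute intro!: mult_right_mono power_mono)
        also have "\<dots> \<le> energy v" unfolding F_def by (rule energy_bessel[OF _ v]) simp
        finally show "(\<Sum>j\<in>{j\<in>{..<k}. N < lam j}. (norm (coef F j))\<^sup>2) \<le> energy v / N\<^sup>2"
          using N by (simp add: pos_le_divide_eq)
      qed
      finally show ?thesis .
    qed
    have "(\<lambda>k. \<Sum>j<k. (norm (coef F j))\<^sup>2) \<longlonglongrightarrow> X"
      using parseval[OF FL] by (simp add: sums_def X_def F_def)
    then show ?thesis by (rule LIMSEQ_le_const2) (use part in auto)
  qed
  define E where "E = energy v + X"
  have XE: "X \<le> E" "0 \<le> E" "energy v \<le> E" using E0 X0 by (auto simp: E_def)
  have "X ^ 3 \<le> 8 * E\<^sup>2 * a"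
  proof (cases "E \<le> a")
    case True
    have "X ^ 3 \<le> E ^ 3" using XE X0 by (intro power_mono) auto
    also have "\<dots> = E\<^sup>2 * E" by (simp add: power2_eq_square power3_eq_cube)
    also have "\<dots> \<le> E\<^sup>2 * a" using True by (intro mult_left_mono) auto
    also have "\<dots> \<le> 8 * E\<^sup>2 * a" using a0 by (simp add: mult_right_mono)
    finally show ?thesis .
  next
    case False
    show ?thesis
    proof (cases "a = 0")
      case True
      have "X \<le> 0"
      proof (rule field_le_epsilon)
        fix \<epsilon> :: real assume \<epsilon>: "0 < \<epsilon>"
        define N where "N = 1 + E / \<epsilon>"
        have N: "1 \<le> N" using XE \<epsilon> by (simp add: N_def)
        have "X \<le> energy v / N\<^sup>2" using split[OF N] True by simp
        also have "\<dots> \<le> E / N" using XE N E0 by (intro frac_le) (auto simp: power2_eq_square)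
        also have "\<dots> \<le> 0 + \<epsilon>" using N \<epsilon> XE by (simp add: N_def field_simps)
        finally show "X \<le> 0 + \<epsilon>" .
      qed
      then show ?thesis using X0 True by simp
    next
      case a: False
      \<comment> \<open>the frequency at which the two bounds agree, at least \<open>1\<close> because \<open>E > a\<close>\<close>
      define N where "N = root 6 (E / a)"
      have apos: "0 < a" using a a0 by simp
      have N1: "1 \<le> N" using False apos by (simp add: N_def)
      have N6: "N ^ 6 = E / a" using apos XE by (simp add: N_def)
      have "X \<le> a * N ^ 4 + E / N\<^sup>2"
        using split[OF N1] XE N1 by (smt (verit) divide_right_mono zero_le_power2)
      also have "E / N\<^sup>2 = a * N ^ 4"
      proof -
        have "E = a * N ^ 6" using N6 apos by simp
        also have "\<dots> = a * N ^ 4 * N\<^sup>2" by (simp flip: power_add)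
        finally show ?thesis using N1 by simp
      qed
      finally have "X \<le> 2 * (a * N ^ 4)" by simp
      then have "X ^ 3 \<le> (2 * (a * N ^ 4)) ^ 3" using X0 by (intro power_mono) auto
      also have "\<dots> = 8 * (a * N ^ 6)\<^sup>2 * a"
        by (simp add: power_mult_distrib power2_eq_square power3_eq_cube flip: power_mult)
      also have "a * N ^ 6 = E" using N6 apos by simp
      finally show ?thesis .
    qed
  qed
  then show ?thesis unfolding E_def X_def a_def .
qed

end

section \<open>Smooth truncations\<close>

text \<open>A step from \<open>0\<close> to \<open>1\<close> on \<open>[1, 2]\<close> of class C1: the second difference of the squared positive part.\<close>

definition trunc :: "real \<Rightarrow> real" where
  "trunc t = 2 * ((max 0 (t - 1))\<^sup>2 - 2 * (max 0 (t - 3/2))\<^sup>2 + (max 0 (t - 2))\<^sup>2)"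

definition trunc' :: "real \<Rightarrow> real" where
  "trunc' t = 4 * (max 0 (t - 1) - 2 * max 0 (t - 3/2) + max 0 (t - 2))"

lemma trunc_deriv: "(trunc has_real_derivative trunc' t) (at t)"
proof -
  have d: "((\<lambda>t. (max 0 (t - c))\<^sup>2) has_real_derivative 2 * max 0 (t - c)) (at t)" for c :: real
  proof -
    have "((\<lambda>t. t - c) has_real_derivative 1) (at t)" by (auto intro!: derivative_eq_intros)
    from DERIV_chain2[where f = "\<lambda>t. (max 0 t)\<^sup>2" and g = "\<lambda>t. t - c",
        OF has_real_derivative_positive_part_square this]
    show ?thesis by simp
  qed
  show ?thesis
    unfolding trunc_def[abs_def] trunc'_def
    by (rule DERIV_cong[OF DERIV_cmult[OF DERIV_add[OF DERIV_diff[OF d DERIV_cmult[OF d]] d]]]) simp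
qed

lemma
  shows trunc_below: "t \<le> 1 \<Longrightarrow> trunc t = 0" and trunc_above: "2 \<le> t \<Longrightarrow> trunc t = 1"
    and trunc_range: "0 \<le> trunc t" "trunc t \<le> 1" and trunc_slope: "1 \<le> t \<Longrightarrow> trunc t \<le> 2 * (t - 1)"
    and trunc'_off: "t \<le> 1 \<or> 2 \<le> t \<Longrightarrow> trunc' t = 0" and trunc'_range: "\<bar>trunc' t\<bar> \<le> 2"
proof -
  consider "t \<le> 1" | "1 \<le> t" "t \<le> 3/2" | "3/2 \<le> t" "t \<le> 2" | "2 \<le> t" by linarith
  then have "(t \<le> 1 \<longrightarrow> trunc t = 0) \<and> (2 \<le> t \<longrightarrow> trunc t = 1) \<and> 0 \<le> trunc t \<and> trunc t \<le> 1 \<and>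
     (1 \<le> t \<longrightarrow> trunc t \<le> 2 * (t - 1)) \<and> (t \<le> 1 \<or> 2 \<le> t \<longrightarrow> trunc' t = 0) \<and> \<bar>trunc' t\<bar> \<le> 2"
  proof cases
    case 1
    then show ?thesis by (auto simp: trunc_def trunc'_def max_def)
  next
    case 2
    have "trunc t = 2 * (t - 1)\<^sup>2" "trunc' t = 4 * (t - 1)" using 2 by (auto simp: trunc_def trunc'_def max_def)
    moreover have "(t - 1)\<^sup>2 \<le> (t - 1) * (1/2)" unfolding power2_eq_square using 2 by (intro mult_left_mono) auto
    moreover have "0 \<le> (t - 1)\<^sup>2" by simp
    ultimately show ?thesis using 2 by (auto simp: abs_if)
  next
    case 3
    have tr: "trunc t = 1 - 2 * (2 - t)\<^sup>2" "trunc' t = 4 * (2 - t)"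
      using 3 by (auto simp: trunc_def trunc'_def max_def power2_eq_square algebra_simps)
    moreover have "(2 - t)\<^sup>2 \<le> (2 - t) * (1/2)" unfolding power2_eq_square using 3 by (intro mult_left_mono) auto
    moreover have le1: "trunc t \<le> 1" unfolding tr(1) by simp
    moreover have "trunc t \<le> 2 * (t - 1)" using le1 3 by argo
    ultimately show ?thesis using 3 by (auto simp: abs_if)
  next
    case 4
    then have "trunc t = 1" "trunc' t = 0"
      by (auto simp: trunc_def trunc'_def max_def power2_eq_square algebra_simps)
    then show ?thesis using 4 by auto
  qed
  then show "t \<le> 1 \<Longrightarrow> trunc t = 0" "2 \<le> t \<Longrightarrow> trunc t = 1" "0 \<le> trunc t" "trunc t \<le> 1"
    "1 \<le> t \<Longrightarrow> trunc t \<le> 2 * (t - 1)" "t \<le> 1 \<or> 2 \<le> t \<Longrightarrow> trunc' t = 0" "\<bar>trunc' t\<bar> \<le> 2" by blast+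
qed

lemma continuous_trunc': "continuous_on UNIV trunc'"
  unfolding trunc'_def[abs_def] by (intro continuous_intros)

text \<open>This makes the sum of the squared truncations at the levels \<open>a, 2a, 4a, \<dots>\<close> telescope to at most \<open>t\<^sup>2\<close>.\<close>

lemma trunc_square_telescope:
  assumes "0 < a"
  shows "(a * trunc (t / a))\<^sup>2 \<le> (min (max 0 t) (2 * a))\<^sup>2 - (min (max 0 t) a)\<^sup>2"
proof -
  consider "t \<le> a" | "a \<le> t" "t \<le> 2 * a" | "2 * a \<le> t" by linarith
  then show ?thesis
  proof cases
    case 1
    then show ?thesis using assms trunc_below[of "t / a"] by (auto simp: min_def max_def)
  next
    case 2
    define s where "s = t / a"
    have s: "1 \<le> s" "t = a * s" using 2 assms by (auto simp: s_def)
    have "(trunc s)\<^sup>2 \<le> trunc s * 1"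
      unfolding power2_eq_square using trunc_range[of s] by (intro mult_left_mono) auto
    also have "\<dots> \<le> (s + 1) * (s - 1)"
    proof -
      have "2 * (s - 1) \<le> (s + 1) * (s - 1)" using s by (intro mult_right_mono) auto
      then show ?thesis using trunc_slope[OF s(1)] by simp
    qed
    also have "\<dots> = s\<^sup>2 - 1" by (simp add: power2_eq_square algebra_simps)
    finally have "a\<^sup>2 * (trunc s)\<^sup>2 \<le> a\<^sup>2 * (s\<^sup>2 - 1)" by (rule mult_left_mono) simp
    moreover have "min (max 0 t) (2 * a) = a * s" "min (max 0 t) a = a" using 2 assms s by auto
    ultimately show ?thesis by (simp add: power_mult_distrib algebra_simps s_def[symmetric])
  next
    case 3
    then have "2 \<le> t / a" using assms by (simp add: pos_le_divide_eq)
    then show ?thesis using 3 assms trunc_above[of "t / a"] by (auto simp: power_mult_distrib)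
  qed
qed

context laplace_spectrum
begin

section \<open>The critical Sobolev inequality\<close>

lemma integrable_C1M_compose:
  assumes "C1M v" "continuous_on UNIV (\<phi> :: real \<Rightarrow> real)"
  shows "integrable V (\<lambda>x. \<phi> (v x))"
  by (intro integrable_continuous continuous_on_compose2[OF assms(2) C1M_continuous[OF assms(1)]]) simp

lemma superlevel_sets:
  fixes v :: "'m \<Rightarrow> real"
  assumes "C1M v" shows "{x. t \<le> v x} \<in> sets V"
  using borel_closed[OF closed_Collect_le[OF continuous_on_const C1M_continuous[OF assms]], of t] by simp

lemma integrable_superlevel:
  fixes v :: "'m \<Rightarrow> real"
  assumes "C1M v" shows "integrable V (\<lambda>x. indicator {x. t \<le> v x} x :: real)"
  by (rule integrable_real_indicator, rule superlevel_sets[OF assms]) (simp add: emeasure_eq_measure)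

text \<open>Dominates the energy density plus the square of the truncation \<open>a trunc (v / a)\<close>, whose gradient lives where \<open>a < v < 2a\<close> and is at
  most twice that of \<open>v\<close>. Over dyadic levels these regions are disjoint.\<close>

definition shell :: "('m \<Rightarrow> real) \<Rightarrow> real \<Rightarrow> 'm \<Rightarrow> real" where
  "shell v a x = 4 * (energy_density v x * indicator {x. a < v x \<and> v x < 2 * a} x) + (a * trunc (v x / a))\<^sup>2"

lemma continuous_trunc: "continuous_on UNIV (\<lambda>t. a * trunc (t / b))"
  unfolding trunc_def by (cases "b = 0") (auto intro!: continuous_intros)

lemma integrable_shell:
  assumes "C1M v" shows "integrable V (shell v a)"
proof -
  have c: "continuous_on UNIV v" by (rule C1M_continuous[OF assms])
  have "{x. a < v x \<and> v x < 2 * a} = {x. a < v x} \<inter> {x. v x < 2 * a}" by blast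
  then have "open {x. a < v x \<and> v x < 2 * a}"
    by (simp only:) (intro open_Int open_Collect_less c continuous_on_const)
  then have "{x. a < v x \<and> v x < 2 * a} \<in> sets V" by simp
  then have "integrable V (\<lambda>x. energy_density v x * indicator {x. a < v x \<and> v x < 2 * a} x)"
    by (intro integrable_real_mult_indicator integrable_continuous continuous_energy_density assms)
  moreover have "integrable V (\<lambda>x. (a * trunc (v x / a))\<^sup>2)"
    by (rule integrable_C1M_compose[OF assms]) (intro continuous_intros continuous_trunc)
  ultimately show ?thesis unfolding shell_def[abs_def] by (intro Bochner_Integration.integrable_add integrable_mult_right)
qed

text \<open>Nash's inequality for the truncation at height \<open>a\<close>, which equals \<open>a\<close> where \<open>v \<ge> 2a\<close> and vanishes where \<open>v < a\<close>: it
  bounds the volume of one superlevel set by that of the next larger one.\<close>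

lemma truncation_step:
  assumes fin: "\<And>L. finite {j. lam j \<le> L}" and B: "bernstein q C" and C: "0 < C" and q: "1 < q"
    and v: "C1M v" and a: "0 < a"
  shows "(a\<^sup>2 * measure V {x. 2 * a \<le> v x}) ^ 3 \<le>
    8 * (\<integral>x. shell v a x \<partial>V)\<^sup>2 * (a * C * measure V {x. a \<le> v x} powr (1 - 1/q))\<^sup>2"
proof -
  define f where "f x = a * trunc (v x / a)" for x
  have d: "((\<lambda>t. a * trunc (t / a)) has_real_derivative trunc' (t / a)) (at t)" for t
  proof -
    have "((\<lambda>t. t / a) has_real_derivative 1 / a) (at t)" by (rule DERIV_cdivide[OF DERIV_ident])
    note DERIV_cmult[OF DERIV_chain2[where f = trunc and g = "\<lambda>t. t / a", OF trunc_deriv this], of a]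
    moreover have "a * (trunc' (t / a) * (1 / a)) = trunc' (t / a)" using a by simp
    ultimately show ?thesis by (rule DERIV_cong)
  qed
  have c': "continuous_on UNIV (\<lambda>t. trunc' (t / a))"
    by (rule continuous_on_compose2[OF continuous_trunc']) (use a in \<open>auto intro!: continuous_intros\<close>)
  have f: "C1M f" unfolding f_def[abs_def] by (rule C1M_real_compose[OF v d c'])
  have ed: "energy_density f x \<le> 4 * (energy_density v x * indicator {x. a < v x \<and> v x < 2 * a} x)" for x
  proof -
    have eq: "energy_density f x = (trunc' (v x / a))\<^sup>2 * energy_density v x"
      unfolding f_def[abs_def] by (rule energy_density_compose[OF v d c'])
    show ?thesis
    proof (cases "a < v x \<and> v x < 2 * a")
      case True
      have "(trunc' (v x / a))\<^sup>2 \<le> 2\<^sup>2"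
        using power_mono[OF trunc'_range[of "v x / a"] abs_ge_zero, of 2] by simp
      then show ?thesis unfolding eq using True energy_density_nonneg[OF v, of x] by (simp add: mult_right_mono)
    next
      case False
      then have "trunc' (v x / a) = 0"
        using a by (intro trunc'_off) (auto simp: pos_divide_le_eq pos_le_divide_eq not_less)
      then show ?thesis unfolding eq using False by simp
    qed
  qed
  have i1: "integrable V (energy_density f)" by (intro integrable_continuous continuous_energy_density f)
  have i2: "integrable V (\<lambda>x. (f x)\<^sup>2)" by (intro integrable_C1M_compose[OF f] continuous_intros)
  have G: "energy f + (\<integral>x. (f x)\<^sup>2 \<partial>V) \<le> (\<integral>x. shell v a x \<partial>V)"
    unfolding energy_def Bochner_Integration.integral_add[OF i1 i2, symmetric] using ed
    by (intro integral_mono Bochner_Integration.integrable_add i1 i2 integrable_shell v) (simp add: shell_def f_def)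
  have nn: "0 \<le> energy f + (\<integral>x. (f x)\<^sup>2 \<partial>V)"
    unfolding energy_def by (intro add_nonneg_nonneg Bochner_Integration.integral_nonneg energy_density_nonneg f) simp
  have "a\<^sup>2 * measure V {x. 2 * a \<le> v x} = (\<integral>x. a\<^sup>2 * indicator {x. 2 * a \<le> v x} x \<partial>V)"
    by simp
  also have "\<dots> \<le> (\<integral>x. (f x)\<^sup>2 \<partial>V)"
  proof (intro integral_mono i2)
    show "integrable V (\<lambda>x. a\<^sup>2 * indicator {x. 2 * a \<le> v x} x)"
      by (intro integrable_mult_right integrable_superlevel v)
    show "a\<^sup>2 * indicator {x. 2 * a \<le> v x} x \<le> (f x)\<^sup>2" for x
      using trunc_above[of "v x / a"] a by (auto simp: f_def indicator_def pos_le_divide_eq)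
  qed
  finally have "(a\<^sup>2 * measure V {x. 2 * a \<le> v x}) ^ 3 \<le> (\<integral>x. (f x)\<^sup>2 \<partial>V) ^ 3"
    by (intro power_mono) auto
  also have "\<dots> \<le> 8 * (energy f + (\<integral>x. (f x)\<^sup>2 \<partial>V))\<^sup>2 * (a * C * measure V {x. a \<le> v x} powr (1 - 1/q))\<^sup>2"
  proof (rule nash[OF fin B C q f superlevel_sets[OF v]])
    show "\<bar>f x\<bar> \<le> a * indicator {x. a \<le> v x} x" for x
      using trunc_range[of "v x / a"] trunc_below[of "v x / a"] a
      by (auto simp: f_def indicator_def abs_mult pos_divide_le_eq not_le)
  qed (use a in simp)
  also have "\<dots> \<le> 8 * (\<integral>x. shell v a x \<partial>V)\<^sup>2 * (a * C * measure V {x. a \<le> v x} powr (1 - 1/q))\<^sup>2"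
    using G nn by (intro mult_right_mono mult_left_mono power_mono) auto
  finally show ?thesis .
qed

lemma sum_shells_le:
  assumes v: "C1M v" and \<alpha>: "0 < \<alpha>"
  shows "(\<Sum>i<M. \<integral>x. shell v (\<alpha> * 2 ^ i) x \<partial>V) \<le> 4 * energy v + (\<integral>x. (v x)\<^sup>2 \<partial>V)"
proof -
  define a where "a i = \<alpha> * 2 ^ i" for i :: nat
  have a: "0 < a i" "a (Suc i) = 2 * a i" for i using \<alpha> by (auto simp: a_def)
  have pt: "(\<Sum>i<M. shell v (a i) x) \<le> 4 * energy_density v x + (v x)\<^sup>2" for x
  proof -
    define h where "h i = (if a i < v x then 1 else 0 :: real)" for i
    \<comment> \<open>the indicators of the disjoint shells are at most the differences of the indicators \<open>h\<close> of \<open>a i < v\<close>, which telescope\<close>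
    have h: "indicator {x. a i < v x \<and> v x < 2 * a i} x \<le> h i - h (Suc i)" for i
      using a(1)[of i] by (auto simp: h_def a(2) indicator_def)
    define k where "k i = (min (max 0 (v x)) (a i))\<^sup>2" for i
    have "(\<Sum>i<M. shell v (a i) x) \<le> (\<Sum>i<M. 4 * (energy_density v x * (h i - h (Suc i))) + (k (Suc i) - k i))"
      unfolding shell_def k_def a(2)
      by (intro sum_mono add_mono mult_left_mono h energy_density_nonneg v trunc_square_telescope a(1)) auto
    also have "\<dots> = 4 * (energy_density v x * (h 0 - h M)) + (k M - k 0)"
      unfolding sum.distrib sum_distrib_left[symmetric] sum_lessThan_telescope sum_lessThan_telescope' ..
    also have "\<dots> \<le> 4 * (energy_density v x * 1) + (v x)\<^sup>2"
    proof (intro add_mono mult_left_mono energy_density_nonneg v)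
      show "h 0 - h M \<le> 1" by (auto simp: h_def)
      have "k M \<le> \<bar>v x\<bar>\<^sup>2" unfolding k_def using a(1)[of M] by (intro power_mono) auto
      moreover have "0 \<le> k 0" by (simp add: k_def)
      ultimately show "k M - k 0 \<le> (v x)\<^sup>2" by simp
    qed simp
    finally show ?thesis by simp
  qed
  have i1: "integrable V (energy_density v)" by (intro integrable_continuous continuous_energy_density v)
  have i2: "integrable V (\<lambda>x. (v x)\<^sup>2)" by (intro integrable_C1M_compose[OF v] continuous_intros)
  have "(\<Sum>i<M. \<integral>x. shell v (a i) x \<partial>V) = (\<integral>x. (\<Sum>i<M. shell v (a i) x) \<partial>V)"
    by (rule Bochner_Integration.integral_sum[symmetric]) (rule integrable_shell[OF v])
  also have "\<dots> \<le> (\<integral>x. 4 * energy_density v x + (v x)\<^sup>2 \<partial>V)"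
    by (intro integral_mono pt Bochner_Integration.integrable_sum integrable_shell v
        Bochner_Integration.integrable_add integrable_mult_right i1 i2)
  also have "\<dots> = 4 * energy v + (\<integral>x. (v x)\<^sup>2 \<partial>V)"
    unfolding energy_def using i1 i2 by simp
  finally show ?thesis unfolding a_def .
qed

text \<open>The level \<open>\<alpha> 2\<^sup>i \<le> t < \<alpha> 2\<^bsup>i + 1\<^esup>\<close> of \<open>t\<close> supplies the dominating term; the values below \<open>\<alpha>\<close> are covered by the first one.\<close>

lemma dyadic_layers:
  fixes t :: real
  assumes "0 < \<alpha>" "0 < q" "t < \<alpha> * 2 ^ Suc M"
  shows "(max 0 t) powr q \<le> \<alpha> powr q + (\<Sum>i\<le>M. (2 * (\<alpha> * 2 ^ i)) powr q * indicator {s. \<alpha> * 2 ^ i \<le> s} t)"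
  using assms(3)
proof (induction M)
  case 0
  have "(max 0 t) powr q \<le> (if t < \<alpha> then \<alpha> else 2 * \<alpha>) powr q"
    using 0 assms by (intro powr_mono2) auto
  also have "\<dots> \<le> \<alpha> powr q + (2 * \<alpha>) powr q * indicator {s. \<alpha> \<le> s} t"
    by (auto simp: indicator_def)
  finally show ?case by simp
next
  case (Suc M)
  let ?s = "\<Sum>i\<le>M. (2 * (\<alpha> * 2 ^ i)) powr q * indicator {s. \<alpha> * 2 ^ i \<le> s} t"
  have s0: "0 \<le> ?s" by (intro sum_nonneg) (auto simp: indicator_def)
  show ?case
  proof (cases "t < \<alpha> * 2 ^ Suc M")
    case True
    have "0 \<le> (2 * (\<alpha> * 2 ^ Suc M)) powr q * indicator {s. \<alpha> * 2 ^ Suc M \<le> s} t"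
      by (auto simp: indicator_def)
    with Suc.IH[OF True] show ?thesis unfolding sum.atMost_Suc by linarith
  next
    case False
    have "(max 0 t) powr q \<le> (2 * (\<alpha> * 2 ^ Suc M)) powr q"
      using Suc.prems assms by (intro powr_mono2) auto
    also have "\<dots> = (2 * (\<alpha> * 2 ^ Suc M)) powr q * indicator {s. \<alpha> * 2 ^ Suc M \<le> s} t"
      using False by (simp add: indicator_def)
    finally show ?thesis unfolding sum.atMost_Suc using s0 powr_ge_zero[of \<alpha> q] by linarith
  qed
qed

text \<open>With \<open>a i = \<alpha> 2\<^sup>i\<close> the integral of \<open>v\<^sup>q\<close> is comparable with the sum \<open>Bs\<close> of \<open>b i = (a i)\<^sup>q |{v \<ge> a i}|\<close>. The choice of \<open>q\<close>
  makes all powers of \<open>a i\<close> cancel in \<open>truncation_step\<close>, which becomes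
  \<open>b (i + 1)\<^sup>3 \<le> D G\<^sub>i\<^sup>2 b i\<^bsup>1 + 4/\<nu>\<^esup>\<close> with \<open>G\<^sub>i\<close> the integral of the \<open>i\<close>-th shell. Bounding \<open>b i\<^bsup>4/\<nu>\<^esup>\<close> by \<open>Bs\<^bsup>4/\<nu>\<^esup>\<close>,
  extracting the cube root and summing gives \<open>Bs - b 0 \<le> Bs / 4 + 2 sqrt D Bs\<^bsup>2/\<nu>\<^esup> \<Sum> G\<^sub>i\<close>. The lowest level \<open>\<alpha>\<close> is chosen so
  small that \<open>b 0\<close> is absorbed too. In the application \<open>\<nu>\<close> is the dimension, so that \<open>q = 2n/(n-2)\<close>.\<close>

lemma sobolev_positive_part:
  assumes fin: "\<And>L. finite {j. lam j \<le> L}" and \<nu>: "4 < \<nu>"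
    and B: "bernstein (2 * \<nu> / (\<nu> - 4)) C" and C: "0 < C"
  shows "\<exists>C1>0. \<forall>v. C1M v \<longrightarrow>
    (\<integral>x. (max 0 (v x)) powr (2 * \<nu> / (\<nu> - 2)) \<partial>V) powr (1 - 2/\<nu>) \<le> C1 * (4 * energy v + (\<integral>x. (v x)\<^sup>2 \<partial>V))"
proof -
  define q where "q = 2 * \<nu> / (\<nu> - 2)"
  define q0 where "q0 = 2 * \<nu> / (\<nu> - 4)"
  have q: "0 < q" using \<nu> by (simp add: q_def)
  have q0: "1 < q0" "2 * (1 - 1/q0) = 1 + 4/\<nu>" using \<nu> by (auto simp: q0_def field_simps)
  have q34: "3 * q = 4 + q * (1 + 4/\<nu>)" using \<nu> by (simp add: q_def field_simps)
  define D where "D = 2 powr (3 * q) * 8 * C\<^sup>2"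
  have D: "0 < D" using C by (simp add: D_def)
  define C1 where "C1 = (2 powr (q + 1)) powr (1 - 2/\<nu>) * (5 * sqrt D)"
  have \<kappa>: "0 < 1 - 2/\<nu>" using \<nu> by simp
  have C1: "0 < C1" using D by (simp add: C1_def)
  have main: "(\<integral>x. (max 0 (v x)) powr q \<partial>V) powr (1 - 2/\<nu>) \<le> C1 * (4 * energy v + (\<integral>x. (v x)\<^sup>2 \<partial>V))"
    if v: "C1M v" for v
  proof -
    define P where "P = (\<integral>x. (max 0 (v x)) powr q \<partial>V)"
    define Es where "Es = 4 * energy v + (\<integral>x. (v x)\<^sup>2 \<partial>V)"
    have Es0: "0 \<le> Es"
      unfolding Es_def energy_def
      by (intro add_nonneg_nonneg mult_nonneg_nonneg Bochner_Integration.integral_nonneg energy_density_nonneg v) auto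
    have P0: "0 \<le> P" unfolding P_def by (intro Bochner_Integration.integral_nonneg) simp
    show ?thesis
    proof (cases "P = 0")
      case True
      then show ?thesis using C1 Es0 unfolding P_def Es_def by simp
    next
      case False
      then have P: "0 < P" using P0 by simp
      define W where "W = measure V UNIV"
      have W: "0 \<le> W" by (simp add: W_def)
      \<comment> \<open>the layer below \<open>\<alpha>\<close> carries at most a fixed small fraction of \<open>P\<close>\<close>
      define \<alpha> where "\<alpha> = (P / (2 powr (q + 2) * (W + 1))) powr (1/q)"
      have \<alpha>: "0 < \<alpha>" using P W by (simp add: \<alpha>_def)
      have \<alpha>q: "\<alpha> powr q * W \<le> P / 2 powr (q + 2)"
      proof -
        have "\<alpha> powr q = P / (2 powr (q + 2) * (W + 1))"
          using P W q by (simp add: \<alpha>_def powr_powr)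
        then have "\<alpha> powr q * W = P / 2 powr (q + 2) * (W / (W + 1))" by (simp add: field_simps)
        also have "\<dots> \<le> P / 2 powr (q + 2) * 1" using P W by (intro mult_left_mono) auto
        finally show ?thesis by simp
      qed
      obtain R where R: "\<And>x. v x \<le> R"
      proof -
        have "bounded (range v)"
          by (rule compact_imp_bounded[OF compact_continuous_image[OF C1M_continuous[OF v] compact_UNIV]])
        then obtain R where "\<And>x. \<bar>v x\<bar> \<le> R" unfolding bounded_iff by auto
        then show ?thesis using that[of R] by (meson abs_le_iff)
      qed
      obtain M where M: "R / \<alpha> < 2 ^ M" using real_arch_pow[of 2 "R / \<alpha>"] by auto
      have top: "v x < \<alpha> * 2 ^ Suc M" for x
      proof -
        have "R < \<alpha> * 2 ^ M" using M \<alpha> by (simp add: pos_divide_less_eq mult.commute)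
        also have "\<dots> \<le> \<alpha> * 2 ^ Suc M" using \<alpha> by simp
        finally show ?thesis using R[of x] by linarith
      qed
      define a where "a i = \<alpha> * 2 ^ i" for i :: nat
      have a: "0 < a i" "a (Suc i) = 2 * a i" for i using \<alpha> by (auto simp: a_def)
      define m where "m t = measure V {x. t \<le> v x}" for t
      have m0: "0 \<le> m t" for t by (simp add: m_def)
      define b where "b i = a i powr q * m (a i)" for i
      have b0: "0 \<le> b i" for i by (simp add: b_def m0)
      define Bs where "Bs = (\<Sum>i\<le>M. b i)"
      define G where "G i = (\<integral>x. shell v (a i) x \<partial>V)" for i
      have G0: "0 \<le> G i" for i
        unfolding G_def shell_def
        by (intro Bochner_Integration.integral_nonneg add_nonneg_nonneg mult_nonneg_nonneg energy_density_nonneg v) auto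
      have bB: "b i \<le> Bs" if "i \<le> M" for i
        unfolding Bs_def using that b0 by (intro member_le_sum) auto
      have Bs0: "0 \<le> Bs" unfolding Bs_def by (intro sum_nonneg b0)
      \<comment> \<open>with this \<open>Y\<close> the recursion reads \<open>b (i + 1)\<^sup>3 \<le> (Y i)\<^sup>2 b i\<close>\<close>
      define Y where "Y i = sqrt D * Bs powr (2/\<nu>) * G i" for i
      have Y0: "0 \<le> Y i" for i using G0 D by (simp add: Y_def)
      have step: "b (Suc i) \<le> b i / 4 + 2 * Y i" if i: "i < M" for i
      proof (rule cube_root_absorb[OF b0 Y0])
        have bi: "b (Suc i) = 2 powr q * a i powr q * m (2 * a i)"
          using a(1)[of i] by (simp add: b_def a(2) powr_mult)
        have ts: "((a i)\<^sup>2 * m (2 * a i)) ^ 3 \<le> 8 * (G i)\<^sup>2 * (a i * C * m (a i) powr (1 - 1/q0))\<^sup>2"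
          unfolding G_def m_def by (rule truncation_step[OF fin B[folded q0_def] C q0(1) v a(1)])
        have "b (Suc i) ^ 3 = 2 powr (3 * q) * a i powr (3 * q) * (m (2 * a i)) ^ 3"
          unfolding bi using a(1)[of i] by (simp add: power_mult_distrib powr_power mult.commute)
        also have "a i powr (3 * q) = (a i) ^ 4 * a i powr (q * (1 + 4/\<nu>))"
          unfolding q34 powr_add using a(1)[of i] by (simp add: powr_numeral)
        also have "2 powr (3 * q) * ((a i) ^ 4 * a i powr (q * (1 + 4/\<nu>))) * (m (2 * a i)) ^ 3
            = 2 powr (3 * q) * a i powr (q * (1 + 4/\<nu>)) / (a i)\<^sup>2 * ((a i)\<^sup>2 * m (2 * a i)) ^ 3"
          using a(1)[of i] by (simp add: field_simps power2_eq_square power3_eq_cube power4_eq_xxxx)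
        also have "\<dots> \<le> 2 powr (3 * q) * a i powr (q * (1 + 4/\<nu>)) / (a i)\<^sup>2 * (8 * (G i)\<^sup>2 * (a i * C * m (a i) powr (1 - 1/q0))\<^sup>2)"
          by (intro mult_left_mono ts) auto
        also have "\<dots> = D * (G i)\<^sup>2 * (a i powr (q * (1 + 4/\<nu>)) * (m (a i) powr (1 - 1/q0))\<^sup>2)"
          using a(1)[of i] by (simp add: D_def power_mult_distrib field_simps)
        also have "(m (a i) powr (1 - 1/q0))\<^sup>2 = m (a i) powr (1 + 4/\<nu>)"
          unfolding power2_eq_square powr_add[symmetric] q0(2)[symmetric] by simp
        also have "a i powr (q * (1 + 4/\<nu>)) * m (a i) powr (1 + 4/\<nu>) = b i powr (1 + 4/\<nu>)"
          unfolding b_def using a(1)[of i] m0 by (simp add: powr_mult powr_powr)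
        also have "b i powr (1 + 4/\<nu>) = b i * b i powr (4/\<nu>)"
          unfolding powr_add using b0[of i] by simp
        also have "D * (G i)\<^sup>2 * (b i * b i powr (4/\<nu>)) \<le> D * (G i)\<^sup>2 * (b i * Bs powr (4/\<nu>))"
          using D b0 bB[of i] i \<nu> by (intro mult_left_mono powr_mono2) auto
        also have "\<dots> = (Y i)\<^sup>2 * b i"
        proof -
          have "(Bs powr (2/\<nu>))\<^sup>2 = Bs powr (4/\<nu>)"
            unfolding power2_eq_square powr_add[symmetric] by simp
          then show ?thesis using D by (simp add: Y_def power_mult_distrib mult_ac)
        qed
        finally show "b (Suc i) ^ 3 \<le> (Y i)\<^sup>2 * b i" .
      qed
      have shift: "(\<Sum>i<M. b (Suc i)) = Bs - b 0"
        unfolding Bs_def using sum.atMost_shift[of b M] by simp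
      have "(\<Sum>i<M. b (Suc i)) \<le> (\<Sum>i<M. b i / 4 + 2 * Y i)"
        by (intro sum_mono step) simp
      also have "\<dots> = (\<Sum>i<M. b i) / 4 + 2 * (sqrt D * Bs powr (2/\<nu>) * (\<Sum>i<M. G i))"
        by (simp add: sum.distrib sum_divide_distrib sum_distrib_left Y_def)
      also have "\<dots> \<le> Bs / 4 + 2 * (sqrt D * Bs powr (2/\<nu>) * Es)"
      proof (intro add_mono divide_right_mono mult_left_mono)
        show "(\<Sum>i<M. b i) \<le> Bs" unfolding Bs_def using b0 by (intro sum_mono2) auto
        show "(\<Sum>i<M. G i) \<le> Es" unfolding G_def a_def Es_def by (rule sum_shells_le[OF v \<alpha>])
      qed (use D in auto)
      finally have rec: "Bs - b 0 \<le> Bs / 4 + 2 * (sqrt D * Bs powr (2/\<nu>) * Es)" unfolding shift .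
      have layers: "P \<le> \<alpha> powr q * W + 2 powr q * Bs"
      proof -
        have "P \<le> (\<integral>x. \<alpha> powr q + (\<Sum>i\<le>M. (2 * a i) powr q * indicator {x. a i \<le> v x} x) \<partial>V)"
          unfolding P_def
        proof (intro integral_mono)
          show "integrable V (\<lambda>x. (max 0 (v x)) powr q)"
            by (rule integrable_C1M_compose[OF v], rule continuous_on_powr') (use q in \<open>auto intro!: continuous_intros\<close>)
          show "integrable V (\<lambda>x. \<alpha> powr q + (\<Sum>i\<le>M. (2 * a i) powr q * indicator {x. a i \<le> v x} x))"
            by (intro Bochner_Integration.integrable_add[OF integrable_const] Bochner_Integration.integrable_sum
                integrable_mult_right integrable_superlevel v)
          show "(max 0 (v x)) powr q \<le> \<alpha> powr q + (\<Sum>i\<le>M. (2 * a i) powr q * indicator {x. a i \<le> v x} x)" for x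
            using dyadic_layers[OF \<alpha> q top[of x]] unfolding a_def by (simp add: indicator_def)
        qed
        also have "\<dots> = \<alpha> powr q * W + (\<Sum>i\<le>M. (2 * a i) powr q * m (a i))"
        proof -
          have i: "integrable V (\<lambda>x. (2 * a i) powr q * indicator {x. a i \<le> v x} x)" for i
            by (intro integrable_mult_right integrable_superlevel v)
          have "(\<integral>x. \<alpha> powr q + (\<Sum>i\<le>M. (2 * a i) powr q * indicator {x. a i \<le> v x} x) \<partial>V) =
             (\<integral>x. \<alpha> powr q \<partial>V) + (\<integral>x. (\<Sum>i\<le>M. (2 * a i) powr q * indicator {x. a i \<le> v x} x) \<partial>V)"
            by (rule Bochner_Integration.integral_add[OF integrable_const Bochner_Integration.integrable_sum[OF i]])
          also have "(\<integral>x. (\<Sum>i\<le>M. (2 * a i) powr q * indicator {x. a i \<le> v x} x) \<partial>V) = (\<Sum>i\<le>M. (2 * a i) powr q * m (a i))"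
            by (subst Bochner_Integration.integral_sum[OF i]) (simp add: m_def)
          finally show ?thesis by (simp add: W_def mult.commute)
        qed
        also have "(\<Sum>i\<le>M. (2 * a i) powr q * m (a i)) = 2 powr q * Bs"
          unfolding Bs_def b_def sum_distrib_left using a(1) by (intro sum.cong) (auto simp: powr_mult)
        finally show ?thesis .
      qed
      define Q where "Q = P / 2 powr q"
      have Q: "0 < Q" using P by (simp add: Q_def)
      have q2: "P / 2 powr (q + 2) = Q / 4" by (simp add: Q_def powr_add powr_numeral)
      have PQ: "P = 2 powr q * Q" by (simp add: Q_def)
      have \<alpha>Q: "\<alpha> powr q * W \<le> Q / 4" using \<alpha>q unfolding q2 .
      then have "2 powr q * Q \<le> Q / 4 + 2 powr q * Bs" using layers unfolding PQ by linarith
      moreover have "Q / 4 \<le> 2 powr q * (Q / 4)"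
      proof -
        have "1 \<le> (2 :: real) powr q" using q by (intro ge_one_powr_ge_zero) auto
        then have "1 * (Q / 4) \<le> 2 powr q * (Q / 4)" using Q by (intro mult_right_mono) auto
        then show ?thesis by simp
      qed
      ultimately have "2 powr q * Q \<le> 2 powr q * (Q / 4 + Bs)" by (simp add: distrib_left)
      then have QB: "3/4 * Q \<le> Bs" by simp
      have "b 0 \<le> \<alpha> powr q * W"
      proof -
        have "m (a 0) \<le> W" unfolding m_def W_def using superlevel_sets[OF v] by (intro finite_measure_mono) auto
        then show ?thesis unfolding b_def a_def by (simp add: mult_left_mono)
      qed
      then have "b 0 \<le> Q / 4" using \<alpha>Q by linarith
      then have "5/12 * Bs \<le> 2 * (sqrt D * Bs powr (2/\<nu>) * Es)" using rec QB by linarith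
      moreover have "0 \<le> sqrt D * Bs powr (2/\<nu>) * Es" using D Es0 by simp
      ultimately have le: "Bs \<le> 5 * sqrt D * Es * Bs powr (2/\<nu>)" by (simp add: mult_ac)
      have Bs: "0 < Bs" using QB Q by linarith
      have "Bs powr (1 - 2/\<nu>) * Bs powr (2/\<nu>) = Bs" unfolding powr_add[symmetric] using Bs by simp
      then have "Bs powr (1 - 2/\<nu>) * Bs powr (2/\<nu>) \<le> (5 * sqrt D * Es) * Bs powr (2/\<nu>)" using le by simp
      then have Bk: "Bs powr (1 - 2/\<nu>) \<le> 5 * sqrt D * Es" using Bs by simp
      have "P \<le> 2 powr q * (2 * Bs)" unfolding PQ using QB Q by (intro mult_left_mono) auto
      also have "\<dots> = 2 powr (q + 1) * Bs" by (simp add: powr_add)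
      finally have "P powr (1 - 2/\<nu>) \<le> (2 powr (q + 1) * Bs) powr (1 - 2/\<nu>)"
        using P \<kappa> by (intro powr_mono2) auto
      also have "\<dots> = (2 powr (q + 1)) powr (1 - 2/\<nu>) * Bs powr (1 - 2/\<nu>)"
        using Bs by (intro powr_mult)
      also have "\<dots> \<le> (2 powr (q + 1)) powr (1 - 2/\<nu>) * (5 * sqrt D * Es)"
        by (intro mult_left_mono Bk) simp
      finally show ?thesis unfolding C1_def P_def Es_def by (simp add: mult.assoc)
    qed
  qed
  show ?thesis
    using C1 main unfolding q_def by blast
qed

end

section \<open>From first to second order: the critical estimate for sums of eigenfunctions\<close>

lemma continuous_abs_powr: "0 < s \<Longrightarrow> continuous_on UNIV (\<lambda>t :: real. k * \<bar>t\<bar> powr s)"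
  by (intro continuous_on_mult continuous_on_const continuous_on_powr') (auto intro!: continuous_intros)

lemma has_real_derivative_signed_powr:
  assumes s: "0 < s"
  shows "((\<lambda>t. t * \<bar>t\<bar> powr s) has_real_derivative (s + 1) * \<bar>t\<bar> powr s) (at t)"
proof -
  consider "t < 0" | "t > 0" | "t = 0" by linarith
  then show ?thesis
  proof cases
    case 1
    have "((\<lambda>t. t * (- t) powr s) has_real_derivative (s + 1) * \<bar>t\<bar> powr s) (at t)"
      using 1 by (auto intro!: derivative_eq_intros simp: powr_diff field_simps)
    then show ?thesis
      by (rule has_field_derivative_transform_within_open[of _ _ _ "{..<0}"]) (use 1 in auto)
  next
    case 2
    have "((\<lambda>t. t * t powr s) has_real_derivative (s + 1) * \<bar>t\<bar> powr s) (at t)"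
      using 2 by (auto intro!: derivative_eq_intros simp: powr_diff field_simps)
    then show ?thesis
      by (rule has_field_derivative_transform_within_open[of _ _ _ "{0<..}"]) (use 2 in auto)
  next
    case 3
    have "isCont (\<lambda>h :: real. \<bar>h\<bar> powr s) 0"
      using continuous_abs_powr[OF s, of 1] by (simp add: continuous_on_eq_continuous_at)
    then have "((\<lambda>h :: real. \<bar>h\<bar> powr s) \<longlongrightarrow> 0) (at 0)" using s by (simp add: isCont_def)
    then have "((\<lambda>h :: real. h * \<bar>h\<bar> powr s / h) \<longlongrightarrow> 0) (at 0)"
      by (rule Lim_transform_eventually) (auto simp: eventually_at_filter)
    then show ?thesis using 3 s by (simp add: DERIV_def)
  qed
qed

context laplace_spectrum
begin

lemma energy_minus:
  assumes "C1M v" shows "energy (\<lambda>x. - v x) = energy v"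
proof -
  have "((\<lambda>t. - t) has_real_derivative -1) (at t)" for t :: real by (auto intro!: derivative_eq_intros)
  from energy_density_compose[OF assms this continuous_on_const]
  have "energy_density (\<lambda>x. - v x) = energy_density v" by auto
  then show ?thesis unfolding energy_def by simp
qed

lemma norm_spectral_sum_le:
  assumes J: "finite J" and F: "F \<in> L2_space V"
  shows "norm (\<Sum>j\<in>J. c j * (of_real (r j) * cnj (coef F j))) \<le>
    sqrt (\<Sum>j\<in>J. (r j)\<^sup>2 * (norm (c j))\<^sup>2) * sqrt (\<integral>x. (norm (F x))\<^sup>2 \<partial>V)"
proof -
  have "norm (\<Sum>j\<in>J. c j * (of_real (r j) * cnj (coef F j))) \<le> (\<Sum>j\<in>J. (\<bar>r j\<bar> * norm (c j)) * norm (coef F j))"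
    by (rule order_trans[OF norm_sum]) (simp add: norm_mult mult_ac)
  also have "\<dots> \<le> sqrt (\<Sum>j\<in>J. (\<bar>r j\<bar> * norm (c j))\<^sup>2) * sqrt (\<Sum>j\<in>J. (norm (coef F j))\<^sup>2)"
    by (rule sum_mult_le_sqrt)
  also have "\<dots> \<le> sqrt (\<Sum>j\<in>J. (\<bar>r j\<bar> * norm (c j))\<^sup>2) * sqrt (\<integral>x. (norm (F x))\<^sup>2 \<partial>V)"
    by (intro mult_left_mono real_sqrt_le_mono bessel J F real_sqrt_ge_zero sum_nonneg) auto
  finally show ?thesis by (simp add: power_mult_distrib)
qed

text \<open>Put \<open>P = \<integral> |u|\<^bsup>q0\<^esup>\<close>. The exponent \<open>\<gamma> = 2/(\<nu>-4)\<close> is chosen such that both \<open>|v|\<^sup>q\<close> for \<open>v = u |u|\<^bsup>\<gamma>\<^esup>\<close> and \<open>f\<^sup>2\<close> for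
  \<open>f = u |u|\<^bsup>2\<gamma>\<^esup>\<close> equal \<open>|u|\<^bsup>q0\<^esup>\<close>. The energy of \<open>v\<close> is at most a constant times \<open>\<integral> \<langle>\<nabla> u, \<nabla> f\<rangle> = - \<integral> f \<Delta> u \<le> \<parallel>\<Delta> u\<parallel> sqrt P\<close>,
  similarly \<open>\<integral> v\<^sup>2 = \<integral> u f \<le> \<parallel>u\<parallel> sqrt P\<close>,
  and the Sobolev inequality for \<open>v\<close> bounds \<open>P\<^bsup>1 - 2/\<nu>\<^esup>\<close> by the two; dividing by \<open>sqrt P\<close> leaves the power
  \<open>1/2 - 2/\<nu> = 1/q0\<close>. The first order inequality concerns the positive part, so it is applied to \<open>v\<close> and to \<open>- v\<close>.\<close>

lemma critical_sobolev_real: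
  assumes fin: "\<And>L. finite {j. lam j \<le> L}" and \<nu>: "4 < \<nu>"
    and B: "bernstein (2 * \<nu> / (\<nu> - 4)) C" and C: "0 < C"
  shows "\<exists>C2>0. \<forall>J c. finite J \<longrightarrow>
    (\<integral>x. \<bar>Re (psum J c x)\<bar> powr (2 * \<nu> / (\<nu> - 4)) \<partial>V) powr ((\<nu> - 4) / (2 * \<nu>)) \<le>
      C2 * (sqrt (\<Sum>j\<in>J. (lam j) ^ 4 * (norm (c j))\<^sup>2) + sqrt (\<Sum>j\<in>J. (norm (c j))\<^sup>2))"
proof -
  define q where "q = 2 * \<nu> / (\<nu> - 2)"
  define q0 where "q0 = 2 * \<nu> / (\<nu> - 4)"
  define \<gamma> where "\<gamma> = 2 / (\<nu> - 4)"
  define \<kappa> where "\<kappa> = 1 - 2/\<nu>"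
  have q: "0 < q" and q0: "0 < q0" and \<gamma>: "0 < \<gamma>" and \<kappa>: "0 < \<kappa>" "\<kappa> \<le> 1" using \<nu> by (auto simp: q_def q0_def \<gamma>_def \<kappa>_def)
  have qs: "(1 + \<gamma>) * q = q0" "2 * (1 + 2 * \<gamma>) = q0" "\<kappa> - 1/2 = (\<nu> - 4) / (2 * \<nu>)"
    using \<nu> by (auto simp: q_def q0_def \<gamma>_def \<kappa>_def divide_simps) (auto simp: algebra_simps)?
  obtain C1 where C1: "0 < C1" and sob: "\<And>v. C1M v \<Longrightarrow>
    (\<integral>x. (max 0 (v x)) powr q \<partial>V) powr \<kappa> \<le> C1 * (4 * energy v + (\<integral>x. (v x)\<^sup>2 \<partial>V))"
    using sobolev_positive_part[OF fin \<nu> B C] unfolding q_def \<kappa>_def by blast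
  define C2 where "C2 = 8 * C1 * (\<gamma> + 1)\<^sup>2"
  have C2: "0 < C2" using C1 \<gamma> by (simp add: C2_def)
  have "(\<integral>x. \<bar>Re (psum J c x)\<bar> powr q0 \<partial>V) powr ((\<nu> - 4) / (2 * \<nu>)) \<le>
      C2 * (sqrt (\<Sum>j\<in>J. (lam j) ^ 4 * (norm (c j))\<^sup>2) + sqrt (\<Sum>j\<in>J. (norm (c j))\<^sup>2))"
    if J: "finite J" for J c
  proof -
    define w where "w = psum J c"
    define u where "u x = Re (w x)" for x
    define v where "v x = u x * \<bar>u x\<bar> powr \<gamma>" for x
    define f where "f x = u x * \<bar>u x\<bar> powr (2 * \<gamma>)" for x
    define F where "F x = complex_of_real (f x)" for x
    define U where "U = complex_of_real \<circ> u"
    define P where "P = (\<integral>x. \<bar>u x\<bar> powr q0 \<partial>V)"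
    define a2 where "a2 = sqrt (\<Sum>j\<in>J. (lam j) ^ 4 * (norm (c j))\<^sup>2)"
    define a0 where "a0 = sqrt (\<Sum>j\<in>J. (norm (c j))\<^sup>2)"
    have a: "0 \<le> a2" "0 \<le> a0" unfolding a2_def a0_def using lam_nonneg by (auto intro!: sum_nonneg)
    have w: "C1M w" unfolding w_def by (rule psum_C1M)
    have u: "C1M u" unfolding u_def[abs_def] by (rule C1M_bounded_linear[OF bounded_linear_Re w])
    have \<gamma>2: "0 < 2 * \<gamma>" using \<gamma> by simp
    have v: "C1M v" unfolding v_def[abs_def]
      by (rule C1M_real_compose[OF u has_real_derivative_signed_powr[OF \<gamma>] continuous_abs_powr[OF \<gamma>]])
    have f: "C1M f" unfolding f_def[abs_def]
      by (rule C1M_real_compose[OF u has_real_derivative_signed_powr[OF \<gamma>2] continuous_abs_powr[OF \<gamma>2]])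
    have F: "C1M F" unfolding F_def[abs_def] by (rule C1M_of_real[OF f])
    have U: "C1M U" unfolding U_def o_def by (rule C1M_of_real[OF u])
    have cw: "C1M (\<lambda>x. cnj (w x))" by (rule C1M_bounded_linear[OF bounded_linear_cnj w])
    have cF: "(\<lambda>x. cnj (F x)) = F" by (auto simp: F_def)
    have FL: "F \<in> L2_space V" by (rule L2_continuous[OF C1M_continuous[OF F]])
    have P0: "0 \<le> P" unfolding P_def by (intro Bochner_Integration.integral_nonneg) simp
    have PF: "(\<integral>x. (norm (F x))\<^sup>2 \<partial>V) = P"
    proof -
      have "(norm (F x))\<^sup>2 = \<bar>u x\<bar> powr q0" for x
      proof -
        have "norm (F x) = \<bar>f x\<bar>" by (simp only: F_def norm_of_real)
        then have "norm (F x) = \<bar>u x\<bar> powr (1 + 2 * \<gamma>)" by (simp add: f_def abs_mult powr_add)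
        then show ?thesis unfolding power2_eq_square by (simp add: powr_add[symmetric] qs(2)[symmetric])
      qed
      then show ?thesis by (simp add: P_def)
    qed
    have gF: "grad_form F U x = of_real ((2 * \<gamma> + 1) * \<bar>u x\<bar> powr (2 * \<gamma>) * energy_density u x)" for x
    proof -
      have "grad_form F U x = of_real ((2 * \<gamma> + 1) * \<bar>u x\<bar> powr (2 * \<gamma>)) * grad_form (\<lambda>x. of_real (u x)) U x"
        unfolding F_def[abs_def] f_def[abs_def]
        by (rule grad_form_real_compose_left[OF u U has_real_derivative_signed_powr[OF \<gamma>2] continuous_abs_powr[OF \<gamma>2]])
      moreover have "grad_form (\<lambda>x. of_real (u x)) U x = of_real (energy_density u x)"
        using grad_form_cnj[OF U U, of x] unfolding U_def o_def energy_density_def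
        by (simp add: complex_eq_iff)
      ultimately show ?thesis by simp
    qed
    have re: "Re (grad_form w F x) = (2 * \<gamma> + 1) * \<bar>u x\<bar> powr (2 * \<gamma>) * energy_density u x" for x
    proof -
      \<comment> \<open>\<open>F\<close> is real, so only the real part of \<open>w\<close> contributes\<close>
      have Uw: "(\<lambda>x. w x + cnj (w x)) = (\<lambda>x. 2 * U x)" by (auto simp: U_def u_def complex_add_cnj)
      have "grad_form w F x + grad_form (\<lambda>x. cnj (w x)) F x = grad_form (\<lambda>x. 2 * U x) F x"
        unfolding Uw[symmetric] by (rule grad_form_add_left[OF w cw F, symmetric])
      also have "\<dots> = 2 * grad_form F U x"
        by (simp add: grad_form_cmult_left[OF U F] grad_form_commute[OF U F])
      also have "grad_form (\<lambda>x. cnj (w x)) F x = cnj (grad_form w F x)"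
        using grad_form_cnj[OF w F, of x] by (simp only: cF)
      finally have "2 * Re (grad_form w F x) = 2 * Re (grad_form F U x)"
        by (simp add: complex_eq_iff)
      then show ?thesis unfolding gF by simp
    qed
    have i3: "integrable V (grad_form w F)" by (intro integrable_continuous continuous_grad_form w F)
    have ev: "energy v \<le> (\<gamma> + 1)\<^sup>2 * (a2 * sqrt P)"
    proof -
      have "energy_density v x = ((\<gamma> + 1) * \<bar>u x\<bar> powr \<gamma>)\<^sup>2 * energy_density u x" for x
        unfolding v_def[abs_def]
        by (rule energy_density_compose[OF u has_real_derivative_signed_powr[OF \<gamma>] continuous_abs_powr[OF \<gamma>]])
      then have "energy v = (\<integral>x. ((\<gamma> + 1) * \<bar>u x\<bar> powr \<gamma>)\<^sup>2 * energy_density u x \<partial>V)"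
        unfolding energy_def by (intro Bochner_Integration.integral_cong refl)
      also have "\<dots> \<le> (\<integral>x. (\<gamma> + 1)\<^sup>2 * Re (grad_form w F x) \<partial>V)"
      proof (intro integral_mono)
        show "integrable V (\<lambda>x. ((\<gamma> + 1) * \<bar>u x\<bar> powr \<gamma>)\<^sup>2 * energy_density u x)"
        proof -
          have "continuous_on UNIV (\<lambda>x. (\<gamma> + 1) * \<bar>u x\<bar> powr \<gamma>)"
            by (rule continuous_on_compose2[OF continuous_abs_powr[OF \<gamma>] C1M_continuous[OF u]]) simp
          then show ?thesis
            by (intro integrable_continuous continuous_on_mult[OF continuous_on_power] continuous_energy_density u)
        qed
        show "integrable V (\<lambda>x. (\<gamma> + 1)\<^sup>2 * Re (grad_form w F x))" using i3 by simp
        show "((\<gamma> + 1) * \<bar>u x\<bar> powr \<gamma>)\<^sup>2 * energy_density u x \<le> (\<gamma> + 1)\<^sup>2 * Re (grad_form w F x)" for x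
        proof -
          have "(\<bar>u x\<bar> powr \<gamma>)\<^sup>2 = \<bar>u x\<bar> powr (2 * \<gamma>)"
            unfolding power2_eq_square powr_add[symmetric] by simp
          then have "((\<gamma> + 1) * \<bar>u x\<bar> powr \<gamma>)\<^sup>2 * energy_density u x = (\<gamma> + 1)\<^sup>2 * (1 * \<bar>u x\<bar> powr (2 * \<gamma>) * energy_density u x)"
            by (simp add: power_mult_distrib)
          also have "\<dots> \<le> (\<gamma> + 1)\<^sup>2 * ((2 * \<gamma> + 1) * \<bar>u x\<bar> powr (2 * \<gamma>) * energy_density u x)"
            using \<gamma> energy_density_nonneg[OF u, of x] by (intro mult_left_mono mult_right_mono) auto
          finally show ?thesis unfolding re .
        qed
      qed
      also have "\<dots> = (\<gamma> + 1)\<^sup>2 * Re (\<integral>x. grad_form w F x \<partial>V)"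
        using i3 by (simp add: integral_Re)
      also have "Re (\<integral>x. grad_form w F x \<partial>V) \<le> a2 * sqrt P"
      proof -
        have "(\<integral>x. grad_form w F x \<partial>V) = (\<Sum>j\<in>J. c j * (of_real ((lam j)\<^sup>2) * cnj (coef F j)))"
          using integral_grad_psum_cnj[OF J F, of c] by (simp only: w_def cF)
        then have "Re (\<integral>x. grad_form w F x \<partial>V) \<le> norm (\<Sum>j\<in>J. c j * (of_real ((lam j)\<^sup>2) * cnj (coef F j)))"
          by (simp only: complex_Re_le_cmod)
        also have "\<dots> \<le> a2 * sqrt P"
          using norm_spectral_sum_le[OF J FL, of c "\<lambda>j. (lam j)\<^sup>2"] unfolding PF a2_def by simp
        finally show ?thesis .
      qed
      finally show ?thesis by (simp add: mult_left_mono)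
    qed
    have mv: "(\<integral>x. (v x)\<^sup>2 \<partial>V) \<le> a0 * sqrt P"
    proof -
      have "(v x)\<^sup>2 = Re (w x * cnj (F x))" for x
      proof -
        have "(\<bar>u x\<bar> powr \<gamma>)\<^sup>2 = \<bar>u x\<bar> powr (2 * \<gamma>)"
          unfolding power2_eq_square powr_add[symmetric] by simp
        then show ?thesis by (simp add: v_def F_def f_def u_def power_mult_distrib power2_eq_square)
      qed
      moreover have "integrable V (\<lambda>x. w x * cnj (F x))"
        unfolding w_def by (rule L2_mult_integrable[OF psum_L2 L2_cnj[OF FL]])
      ultimately have "(\<integral>x. (v x)\<^sup>2 \<partial>V) = Re (L2_inner V w F)"
        unfolding L2_inner_def by (simp only: integral_Re)
      also have "\<dots> \<le> norm (L2_inner V w F)" by (rule complex_Re_le_cmod)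
      also have "L2_inner V w F = (\<Sum>j\<in>J. c j * (of_real 1 * cnj (coef F j)))"
      proof -
        have "L2_inner V w F = cnj (L2_inner V F w)" by (rule L2_inner_commute)
        also have "L2_inner V F w = (\<Sum>j\<in>J. cnj (c j) * coef F j)"
          unfolding w_def by (rule inner_psum[OF J FL])
        finally show ?thesis by simp
      qed
      also have "norm \<dots> \<le> a0 * sqrt P"
        using norm_spectral_sum_le[OF J FL, of c "\<lambda>j. 1"] unfolding PF a0_def by simp
      finally show ?thesis .
    qed
    define E where "E = C1 * (4 * energy v + (\<integral>x. (v x)\<^sup>2 \<partial>V))"
    have pos: "(\<integral>x. (max 0 (v x)) powr q \<partial>V) powr \<kappa> \<le> E" unfolding E_def by (rule sob[OF v])
    have neg: "(\<integral>x. (max 0 (- v x)) powr q \<partial>V) powr \<kappa> \<le> E"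
    proof -
      have "C1M (\<lambda>x. - v x)" using C1M_mult[OF C1M_const[of "-1"] v] by simp
      from sob[OF this] show ?thesis unfolding E_def energy_minus[OF v] by simp
    qed
    have Psum: "P = (\<integral>x. (max 0 (v x)) powr q \<partial>V) + (\<integral>x. (max 0 (- v x)) powr q \<partial>V)"
    proof -
      have c: "continuous_on UNIV (\<lambda>t :: real. (max 0 t) powr q)"
        by (rule continuous_on_powr') (use q in \<open>auto intro!: continuous_intros\<close>)
      have cm: "continuous_on UNIV (\<lambda>t :: real. (max 0 (- t)) powr q)"
        by (rule continuous_on_compose2[OF c]) (auto intro!: continuous_intros)
      have "\<bar>u x\<bar> powr q0 = (max 0 (v x)) powr q + (max 0 (- v x)) powr q" for x
      proof -
        have "\<bar>v x\<bar> = \<bar>u x\<bar> powr (1 + \<gamma>)" by (simp add: v_def abs_mult powr_add)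
        then have "\<bar>u x\<bar> powr q0 = \<bar>v x\<bar> powr q" by (simp add: powr_powr qs(1))
        then show ?thesis using q by (cases "0 \<le> v x") (auto simp: max_def abs_if)
      qed
      then show ?thesis unfolding P_def
        using integrable_C1M_compose[OF v c] integrable_C1M_compose[OF v cm] by simp
    qed
    have Pk: "P powr \<kappa> \<le> 2 * E"
    proof -
      \<comment> \<open>the larger of the two parts is at least half of \<open>P\<close>, and \<open>2 powr \<kappa> \<le> 2\<close>\<close>
      define P1 P2 where "P1 = (\<integral>x. (max 0 (v x)) powr q \<partial>V)" and "P2 = (\<integral>x. (max 0 (- v x)) powr q \<partial>V)"
      have nn: "0 \<le> P1" "0 \<le> P2" unfolding P1_def P2_def by (intro Bochner_Integration.integral_nonneg; simp)+
      have "P powr \<kappa> \<le> (2 * max P1 P2) powr \<kappa>"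
        using Psum nn \<kappa> unfolding P1_def[symmetric] P2_def[symmetric] by (intro powr_mono2) auto
      also have "\<dots> = 2 powr \<kappa> * (max P1 P2) powr \<kappa>" using nn by (intro powr_mult)
      also have "\<dots> \<le> 2 * E"
      proof (rule mult_mono)
        show "2 powr \<kappa> \<le> (2 :: real)" using powr_mono[of \<kappa> 1 2] \<kappa> by simp
        show "(max P1 P2) powr \<kappa> \<le> E" using pos neg unfolding P1_def P2_def by (simp add: max_def)
      qed auto
      finally show ?thesis .
    qed
    have E: "2 * E \<le> C2 * (a2 + a0) * sqrt P"
    proof -
      have g1: "1 \<le> (\<gamma> + 1)\<^sup>2" using \<gamma> by simp
      have "4 * energy v + (\<integral>x. (v x)\<^sup>2 \<partial>V) \<le> 4 * ((\<gamma> + 1)\<^sup>2 * (a2 * sqrt P)) + 4 * ((\<gamma> + 1)\<^sup>2 * (a0 * sqrt P))"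
      proof (intro add_mono mult_left_mono ev)
        have "1 * (a0 * sqrt P) \<le> (4 * (\<gamma> + 1)\<^sup>2) * (a0 * sqrt P)" using g1 a P0 by (intro mult_right_mono) auto
        then show "(\<integral>x. (v x)\<^sup>2 \<partial>V) \<le> 4 * ((\<gamma> + 1)\<^sup>2 * (a0 * sqrt P))" using mv by (simp add: mult.assoc)
      qed simp
      then have "C1 * (4 * energy v + (\<integral>x. (v x)\<^sup>2 \<partial>V)) \<le> C1 * (4 * ((\<gamma> + 1)\<^sup>2 * (a2 * sqrt P)) + 4 * ((\<gamma> + 1)\<^sup>2 * (a0 * sqrt P)))"
        using C1 by (intro mult_left_mono) auto
      then have "2 * E \<le> 2 * (C1 * (4 * ((\<gamma> + 1)\<^sup>2 * (a2 * sqrt P)) + 4 * ((\<gamma> + 1)\<^sup>2 * (a0 * sqrt P))))"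
        unfolding E_def by simp
      also have "\<dots> = C2 * (a2 + a0) * sqrt P" by (simp add: C2_def algebra_simps)
      finally show ?thesis .
    qed
    have "P powr ((\<nu> - 4) / (2 * \<nu>)) \<le> C2 * (a2 + a0)"
    proof (cases "P = 0")
      case True
      then show ?thesis using C2 a by simp
    next
      case False
      then have P: "0 < P" using P0 by simp
      have "P powr (\<kappa> - 1/2) * sqrt P = P powr \<kappa>"
        using P by (simp add: powr_half_sqrt[symmetric] flip: powr_add)
      then have "P powr (\<kappa> - 1/2) * sqrt P \<le> C2 * (a2 + a0) * sqrt P" using Pk E by linarith
      then show ?thesis unfolding qs(3) using P by simp
    qed
    then show ?thesis unfolding P_def u_def w_def a2_def a0_def .
  qed
  then show ?thesis unfolding q0_def using C2 by blast
qed

text \<open>The imaginary part of a sum is the real part of the sum with coefficients \<open>- \<i> c j\<close>.\<close>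

lemma critical_sobolev:
  assumes fin: "\<And>L. finite {j. lam j \<le> L}" and \<nu>: "4 < \<nu>"
    and B: "bernstein (2 * \<nu> / (\<nu> - 4)) C" and C: "0 < C"
  obtains C2 where "0 < C2" "\<And>J c. finite J \<Longrightarrow> Lp_norm V (ereal (2 * \<nu> / (\<nu> - 4))) (psum J c) \<le>
      ennreal (C2 * (sqrt (\<Sum>j\<in>J. (lam j) ^ 4 * (norm (c j))\<^sup>2) + sqrt (\<Sum>j\<in>J. (norm (c j))\<^sup>2)))"
proof -
  define q0 where "q0 = 2 * \<nu> / (\<nu> - 4)"
  have q0: "1 \<le> q0" "0 < q0" using \<nu> by (auto simp: q0_def field_simps)
  have inv: "(\<nu> - 4) / (2 * \<nu>) = 1 / q0" by (simp add: q0_def)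
  define N where "N J c = sqrt (\<Sum>j\<in>J. (lam j) ^ 4 * (norm (c j :: complex))\<^sup>2) + sqrt (\<Sum>j\<in>J. (norm (c j))\<^sup>2)" for J c
  obtain C2 where C2: "0 < C2" and re: "\<And>J c. finite J \<Longrightarrow> (\<integral>x. \<bar>Re (psum J c x)\<bar> powr q0 \<partial>V) powr (1/q0) \<le> C2 * N J c"
    using critical_sobolev_real[OF fin \<nu> B C] unfolding q0_def[symmetric] inv N_def by blast
  have N0: "0 \<le> N J c" for J c unfolding N_def using lam_nonneg by (auto intro!: add_nonneg_nonneg sum_nonneg)
  have Lre: "Lp_norm V (ereal q0) (\<lambda>x. of_real (Re (psum J c x))) \<le> ennreal (C2 * N J c)" if J: "finite J" for J c
  proof -
    have cont: "continuous_on UNIV (\<lambda>x. \<bar>Re (psum J c x)\<bar> powr q0)"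
      using continuous_on_compose2[OF continuous_abs_powr[OF q0(2), of 1]
          C1M_continuous[OF C1M_bounded_linear[OF bounded_linear_Re psum_C1M[of J c]]]] by simp
    have "(\<integral>\<^sup>+x. ennreal (norm (complex_of_real (Re (psum J c x))) powr q0) \<partial>V) = ennreal (\<integral>x. \<bar>Re (psum J c x)\<bar> powr q0 \<partial>V)"
      using nn_integral_eq_integral[OF integrable_continuous[OF cont]] by simp
    also have "\<dots> \<le> ennreal ((C2 * N J c) powr q0)"
    proof (rule ennreal_leI)
      have nn: "0 \<le> (\<integral>x. \<bar>Re (psum J c x)\<bar> powr q0 \<partial>V)" by (intro Bochner_Integration.integral_nonneg) simp
      then have "(\<integral>x. \<bar>Re (psum J c x)\<bar> powr q0 \<partial>V) = ((\<integral>x. \<bar>Re (psum J c x)\<bar> powr q0 \<partial>V) powr (1/q0)) powr q0"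
        using q0 by (simp add: powr_powr)
      also have "\<dots> \<le> (C2 * N J c) powr q0" using q0 by (intro powr_mono2 re[OF J]) auto
      finally show "(\<integral>x. \<bar>Re (psum J c x)\<bar> powr q0 \<partial>V) \<le> (C2 * N J c) powr q0" .
    qed
    finally show ?thesis using q0 C2 N0[of J c] by (simp add: Lp_norm_le_iff)
  qed
  have "Lp_norm V (ereal q0) (psum J c) \<le> ennreal ((2 * C2) * N J c)" if J: "finite J" for J c
  proof -
    have p1: "1 \<le> ereal q0" using q0 by (simp add: one_ereal_def)
    let ?r = "\<lambda>x. complex_of_real (Re (psum J c x))" and ?c = "\<lambda>j. (- \<i>) * c j"
    let ?i = "\<lambda>x. complex_of_real (Re (psum J ?c x))"
    have mr: "(\<lambda>x. complex_of_real (Re (psum J d x))) \<in> borel_measurable V" for d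
      by (rule borel_measurable_C1M[OF C1M_of_real[OF C1M_bounded_linear[OF bounded_linear_Re psum_C1M]]])
    have mi: "(\<lambda>x. \<i> * ?i x) \<in> borel_measurable V"
      by (rule borel_measurable_C1M[OF C1M_mult[OF C1M_const C1M_of_real[OF C1M_bounded_linear[OF bounded_linear_Re psum_C1M]]]])
    have "psum J c = (\<lambda>x. ?r x + \<i> * ?i x)"
      unfolding psum_scale by (auto simp: complex_eq_iff)
    then have "Lp_norm V (ereal q0) (psum J c) \<le> Lp_norm V (ereal q0) ?r + Lp_norm V (ereal q0) (\<lambda>x. \<i> * ?i x)"
      using Lp_norm_triangle[OF p1 mr[of c] mi] by simp
    also have "\<dots> \<le> ennreal (C2 * N J c) + ennreal (norm \<i> * (C2 * N J ?c))"
      using C2 N0 by (intro add_mono Lre[OF J] Lp_norm_cmult_le p1 mr) auto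
    also have "\<dots> = ennreal (C2 * N J c) + ennreal (C2 * N J c)"
      by (simp add: N_def norm_mult)
    also have "\<dots> = ennreal ((2 * C2) * N J c)" using C2 N0[of J c] by (simp flip: ennreal_plus)
    finally show ?thesis .
  qed
  then show ?thesis using that[of "2 * C2"] C2 unfolding q0_def N_def by simp
qed

text \<open>Above \<open>2 \<mu>\<close> both norms on the right of the Sobolev inequality are at most a constant times the residual \<open>o(\<mu>)\<close>, and here
  \<open>\<sigma> = 3/2 > 1\<close>.\<close>

lemma high_frequencies_smallo_critical:
  assumes fin: "\<And>L. finite {j. lam j \<le> L}" and n: "5 \<le> n" and p: "p = ereal (2 * real n / (real n - 4))"
    and win: "shrinking_window_bound V lam e n p"
    and \<mu>: "filterlim \<mu> at_top sequentially" and lap: "\<And>k. has_L2_laplacian A g V (\<psi> k) (D k)"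
    and one: "\<And>k. (\<integral>x. (norm (\<psi> k x))\<^sup>2 \<partial>V) = 1"
    and res: "is_smallo (\<lambda>k. Lp_norm V 2 (\<lambda>x. D k x + of_real ((\<mu> k)\<^sup>2) * \<psi> k x)) \<mu>"
  shows "is_smallo (\<lambda>k. Lp_norm V p (\<lambda>x. \<psi> k x - psum {j. lam j < 2 * \<mu> k} (coef (\<psi> k)) x))
    (\<lambda>k. \<mu> k powr sogge_exponent p n)"
  unfolding is_smallo_def
proof (intro allI impI)
  fix \<epsilon> :: real assume \<epsilon>: "0 < \<epsilon>"
  let ?\<sigma> = "sogge_exponent p n"
  have n4: "4 < real n" using n by simp
  have q1: "1 < 2 * real n / (real n - 4)" "2 < 2 * real n / (real n - 4)" using n4 by (auto simp: field_simps)
  have p1: "1 \<le> p" and p2: "2 < p" using q1 by (simp_all add: p one_ereal_def)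
  have inv: "inv_exponent p = (real n - 4) / (2 * real n)" by (simp add: p inv_exponent_def)
  have \<sigma>: "?\<sigma> = 3/2"
  proof -
    have u: "real n * (1/2 - inv_exponent p) = 2" "(real n - 1) / 2 * (1/2 - inv_exponent p) = (real n - 1) / real n"
      unfolding inv using n4 by (auto simp: field_simps)
    have "?\<sigma> = max (2 - 1/2) ((real n - 1) / real n)"
      using n by (subst sogge_exponent_alternatives[OF p2]) (simp_all only: u)
    moreover have "(real n - 1) / real n \<le> 3/2" using n4 by (simp add: field_simps)
    ultimately show ?thesis by simp
  qed
  obtain \<delta> \<Lambda> where \<delta>: "0 < \<delta>" "\<delta> < 1" and \<Lambda>: "1 \<le> \<Lambda>" and W: "window_bound p ?\<sigma> 1 \<delta> \<Lambda>"
    by (rule window_bound_of_shrinking[OF fin p1 win zero_less_one])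
  obtain C where C: "0 < C" and B: "\<And>N J c. 1 \<le> N \<Longrightarrow> J \<subseteq> {j. lam j \<le> N} \<Longrightarrow>
    Lp_norm V p (psum J c) \<le> ennreal (C * N\<^sup>2 * sqrt (\<Sum>j\<in>J. (norm (c j))\<^sup>2))"
    by (rule bernstein_of_window_bound[OF fin p1 W[unfolded \<sigma>] \<delta> \<Lambda>]) blast
  have "bernstein (2 * real n / (real n - 4)) C" unfolding bernstein_def p[symmetric] using B by blast
  then obtain C2 where C2: "0 < C2" and sob: "\<And>J c. finite J \<Longrightarrow> Lp_norm V p (psum J c) \<le>
      ennreal (C2 * (sqrt (\<Sum>j\<in>J. (lam j) ^ 4 * (norm (c j))\<^sup>2) + sqrt (\<Sum>j\<in>J. (norm (c j))\<^sup>2)))"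
    unfolding p by (rule critical_sobolev[OF fin n4 _ C]) blast
  define \<eta> where "\<eta> = \<epsilon> / (4 * C2)"
  have \<eta>: "0 < \<eta>" "C2 * (4 * \<eta>) = \<epsilon>" using \<epsilon> C2 by (auto simp: \<eta>_def)
  have "\<forall>\<^sub>F k in sequentially. \<mu> k > 1" using \<mu> unfolding filterlim_at_top_dense by (rule spec)
  moreover have "\<forall>\<^sub>F k in sequentially. Lp_norm V 2 (\<lambda>x. D k x + of_real ((\<mu> k)\<^sup>2) * \<psi> k x) \<le> ennreal (\<eta> * \<mu> k)"
    using res \<eta> unfolding is_smallo_def by simp
  ultimately show "\<forall>\<^sub>F k in sequentially. Lp_norm V p (\<lambda>x. \<psi> k x - psum {j. lam j < 2 * \<mu> k} (coef (\<psi> k)) x) \<le> ennreal (\<epsilon> * \<mu> k powr ?\<sigma>)"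
  proof eventually_elim
    case (elim k)
    let ?m = "\<mu> k" and ?c = "coef (\<psi> k)"
    have m: "1 \<le> ?m" using elim by simp
    have r: "0 \<le> \<eta> * ?m" using \<eta> m by simp
    note qc = quasimode_coef[OF lap one elim(2) r]
    have \<psi>: "\<psi> k \<in> L2_space V" using lap[of k] by (simp add: has_L2_laplacian_def)
    show ?case
    proof (rule Lp_norm_tail_le[OF p1 \<psi>])
      show "finite {j. lam j < 2 * ?m}" by (rule finite_subset[OF _ fin[of "2 * ?m"]]) auto
      show "0 \<le> \<epsilon> * ?m powr ?\<sigma>" using \<epsilon> by simp
      fix J assume J: "finite J" "J \<inter> {j. lam j < 2 * ?m} = {}"
      then have Jl: "2 * ?m \<le> lam j" if "j \<in> J" for j using that by fastforce
      have high: "(\<Sum>j\<in>J. (lam j) ^ 4 * (norm (?c j))\<^sup>2) \<le> 2 * (\<eta> * ?m)\<^sup>2"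
        by (rule quasimode_high_mass[OF _ J(1) Jl qc(2)[OF J(1)]]) (use m in auto)
      have low: "(\<Sum>j\<in>J. (norm (?c j))\<^sup>2) \<le> (\<Sum>j\<in>J. (lam j) ^ 4 * (norm (?c j))\<^sup>2)"
      proof (rule sum_mono)
        fix j assume "j \<in> J"
        then have "1 \<le> (lam j) ^ 4" using Jl[of j] m by (intro one_le_power) auto
        then have "1 * (norm (?c j))\<^sup>2 \<le> (lam j) ^ 4 * (norm (?c j))\<^sup>2" by (intro mult_right_mono) auto
        then show "(norm (?c j))\<^sup>2 \<le> (lam j) ^ 4 * (norm (?c j))\<^sup>2" by simp
      qed
      have "2 * (\<eta> * ?m)\<^sup>2 \<le> (2 * (\<eta> * ?m))\<^sup>2" by (simp add: power_mult_distrib)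
      then have "(\<Sum>j\<in>J. (lam j) ^ 4 * (norm (?c j))\<^sup>2) \<le> (2 * (\<eta> * ?m))\<^sup>2" using high by (rule order_trans[rotated])
      moreover from low this have "(\<Sum>j\<in>J. (norm (?c j))\<^sup>2) \<le> (2 * (\<eta> * ?m))\<^sup>2" by (rule order_trans)
      ultimately have "sqrt (\<Sum>j\<in>J. (lam j) ^ 4 * (norm (?c j))\<^sup>2) \<le> 2 * (\<eta> * ?m)"
        "sqrt (\<Sum>j\<in>J. (norm (?c j))\<^sup>2) \<le> 2 * (\<eta> * ?m)"
        using r by (simp_all only: real_le_lsqrt mult_nonneg_nonneg zero_le_numeral)
      then have "C2 * (sqrt (\<Sum>j\<in>J. (lam j) ^ 4 * (norm (?c j))\<^sup>2) + sqrt (\<Sum>j\<in>J. (norm (?c j))\<^sup>2)) \<le> C2 * (4 * (\<eta> * ?m))"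
        using C2 by (intro mult_left_mono) auto
      also have "\<dots> = \<epsilon> * ?m powr 1" using \<eta>(2) m by (simp add: mult.assoc[symmetric])
      also have "\<dots> \<le> \<epsilon> * ?m powr ?\<sigma>" unfolding \<sigma> using \<epsilon> m by (intro mult_left_mono powr_mono) auto
      finally show "Lp_norm V p (psum J ?c) \<le> ennreal (\<epsilon> * ?m powr ?\<sigma>)"
        using sob[OF J(1), of ?c] by (meson ennreal_leI order_trans)
    qed
  qed
qed

section \<open>The equivalences\<close>

lemma smallo_of_low_and_high:
  assumes p1: "1 \<le> p" and \<psi>: "\<And>k. \<psi> k \<in> L2_space V"
    and "is_smallo (\<lambda>k. Lp_norm V p (psum {j. lam j < 2 * \<mu> k} (coef (\<psi> k)))) r"
    and "is_smallo (\<lambda>k. Lp_norm V p (\<lambda>x. \<psi> k x - psum {j. lam j < 2 * \<mu> k} (coef (\<psi> k)) x)) r"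
  shows "is_smallo (\<lambda>k. Lp_norm V p (\<psi> k)) r"
proof (rule is_smallo_mono[OF is_smallo_add[OF assms(3,4)]])
  fix k
  let ?w = "psum {j. lam j < 2 * \<mu> k} (coef (\<psi> k))"
  have "Lp_norm V p (\<lambda>x. ?w x + (\<psi> k x - ?w x)) \<le> Lp_norm V p ?w + Lp_norm V p (\<lambda>x. \<psi> k x - ?w x)"
    by (rule Lp_norm_triangle[OF p1]) (auto intro!: L2_borel L2_diff \<psi>)
  then show "Lp_norm V p (\<psi> k) \<le> Lp_norm V p ?w + Lp_norm V p (\<lambda>x. \<psi> k x - ?w x)" by simp
qed

lemma strong_quasimode_bound_of_window:
  assumes fin: "\<And>L. finite {j. lam j \<le> L}" and p: "2 < p" and n: "2 \<le> CARD('n)"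
    and win: "shrinking_window_bound V lam e CARD('n) p"
  shows "strong_quasimode_bound A g V lam e p"
  unfolding strong_quasimode_bound_def
proof (intro allI impI)
  fix \<mu> \<psi> D
  assume \<mu>: "filterlim \<mu> at_top sequentially" and lap: "\<forall>k. has_L2_laplacian A g V (\<psi> k) (D k)"
    and one: "\<forall>k. (\<integral>x. (norm (\<psi> k x))\<^sup>2 \<partial>V) = 1"
    and s: "is_smallo (\<lambda>k. Lp_norm V 2 (\<lambda>x. D k x + of_real ((\<mu> k)\<^sup>2) * \<psi> k x)
             + ennreal (\<mu> k powr (2 - real CARD('n) * (1/2 - inv_exponent p)))
               * Lp_norm V p (spectral_proj V lam e {2 * \<mu> k ..} (\<psi> k))) \<mu>"
  let ?\<sigma> = "sogge_exponent p CARD('n)" and ?s = "real CARD('n) * (1/2 - inv_exponent p)"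
  have p1: "1 \<le> p" using p by (cases p) auto
  have \<psi>: "\<psi> k \<in> L2_space V" for k using lap by (simp add: has_L2_laplacian_def)
  have proj: "Lp_norm V p (spectral_proj V lam e {2 * \<mu> k..} (\<psi> k)) = Lp_norm V p (\<lambda>x. \<psi> k x - psum {j. lam j < 2 * \<mu> k} (coef (\<psi> k)) x)" for k
  proof -
    have eq: "{j. lam j \<notin> {2 * \<mu> k..}} = {j. lam j < 2 * \<mu> k}" by auto
    have "finite {j. lam j \<notin> {2 * \<mu> k..}}" by (rule finite_subset[OF _ fin[of "2 * \<mu> k"]]) auto
    from spectral_proj_cofinite[OF this \<psi>] show ?thesis unfolding eq .
  qed
  have "is_smallo (\<lambda>k. Lp_norm V p (psum {j. lam j < 2 * \<mu> k} (coef (\<psi> k)))) (\<lambda>k. \<mu> k powr ?\<sigma>)"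
    by (rule low_frequencies_smallo[OF fin p n win \<mu> lap[rule_format] one[rule_format] is_smallo_mono[OF s]]) simp
  moreover have "is_smallo (\<lambda>k. Lp_norm V p (\<lambda>x. \<psi> k x - psum {j. lam j < 2 * \<mu> k} (coef (\<psi> k)) x)) (\<lambda>k. \<mu> k powr ?\<sigma>)"
    unfolding is_smallo_def
  proof (intro allI impI)
    fix \<epsilon> :: real assume \<epsilon>: "0 < \<epsilon>"
    have "\<forall>\<^sub>F k in sequentially. \<mu> k > 1" using \<mu> unfolding filterlim_at_top_dense by (rule spec)
    moreover have "\<forall>\<^sub>F k in sequentially. ennreal (\<mu> k powr (2 - ?s)) * Lp_norm V p (\<lambda>x. \<psi> k x - psum {j. lam j < 2 * \<mu> k} (coef (\<psi> k)) x) \<le> ennreal (\<epsilon> * \<mu> k)"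
      using is_smallo_mono[OF s, of "\<lambda>k. ennreal (\<mu> k powr (2 - ?s)) * Lp_norm V p (spectral_proj V lam e {2 * \<mu> k ..} (\<psi> k))"] \<epsilon>
      unfolding proj is_smallo_def by simp
    ultimately show "\<forall>\<^sub>F k in sequentially. Lp_norm V p (\<lambda>x. \<psi> k x - psum {j. lam j < 2 * \<mu> k} (coef (\<psi> k)) x) \<le> ennreal (\<epsilon> * \<mu> k powr ?\<sigma>)"
    proof eventually_elim
      case (elim k)
      let ?L = "Lp_norm V p (\<lambda>x. \<psi> k x - psum {j. lam j < 2 * \<mu> k} (coef (\<psi> k)) x)" and ?m = "\<mu> k"
      have m: "0 < ?m" "1 \<le> ?m" using elim by auto
      have inv: "?m powr (?s - 2) * ?m powr (2 - ?s) = 1" unfolding powr_add[symmetric] using m by simp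
      have "?L = ennreal (?m powr (?s - 2)) * (ennreal (?m powr (2 - ?s)) * ?L)"
        using inv by (simp add: mult.assoc[symmetric] flip: ennreal_mult)
      also have "\<dots> \<le> ennreal (?m powr (?s - 2)) * ennreal (\<epsilon> * ?m)" by (intro mult_left_mono elim) simp
      also have "\<dots> = ennreal (\<epsilon> * ?m powr (?s - 1))"
      proof -
        have "?m powr (?s - 2) * ?m = ?m powr (?s - 1)"
          using powr_add[of ?m "?s - 2" 1] m by simp
        then show ?thesis using \<epsilon> m by (simp add: mult_ac flip: ennreal_mult)
      qed
      also have "\<dots> \<le> ennreal (\<epsilon> * ?m powr ?\<sigma>)"
        using sogge_exponent_ge_Sobolev[OF p n] \<epsilon> m by (intro ennreal_leI mult_left_mono powr_mono) auto
      finally show ?case .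
    qed
  qed
  ultimately show "is_smallo (\<lambda>k. Lp_norm V p (\<psi> k)) (\<lambda>k. \<mu> k powr ?\<sigma>)"
    by (rule smallo_of_low_and_high[OF p1 \<psi>])
qed

lemma quasimode_bound_of_window:
  assumes fin: "\<And>L. finite {j. lam j \<le> L}" and p: "2 < p" and n: "2 \<le> CARD('n)"
    and range: "real CARD('n) * (1/2 - inv_exponent p) < 2 \<or>
      5 \<le> CARD('n) \<and> p = ereal (2 * real CARD('n) / (real CARD('n) - 4))"
    and win: "shrinking_window_bound V lam e CARD('n) p"
  shows "quasimode_bound A g V p"
  unfolding quasimode_bound_def
proof (intro allI impI)
  fix \<mu> \<psi> D
  assume \<mu>: "filterlim \<mu> at_top sequentially" and lap: "\<forall>k. has_L2_laplacian A g V (\<psi> k) (D k)"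
    and one: "\<forall>k. (\<integral>x. (norm (\<psi> k x))\<^sup>2 \<partial>V) = 1"
    and s: "is_smallo (\<lambda>k. Lp_norm V 2 (\<lambda>x. D k x + of_real ((\<mu> k)\<^sup>2) * \<psi> k x)) \<mu>"
  have p1: "1 \<le> p" using p by (cases p) auto
  have \<psi>: "\<psi> k \<in> L2_space V" for k using lap by (simp add: has_L2_laplacian_def)
  have high: "is_smallo (\<lambda>k. Lp_norm V p (\<lambda>x. \<psi> k x - psum {j. lam j < 2 * \<mu> k} (coef (\<psi> k)) x))
      (\<lambda>k. \<mu> k powr sogge_exponent p CARD('n))"
    using range
  proof
    assume "real CARD('n) * (1/2 - inv_exponent p) < 2"
    from high_frequencies_smallo_subcritical[OF fin p n win sogge_exponent_subcritical[OF p n this] \<mu> lap[rule_format] one[rule_format] s]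
    show ?thesis .
  next
    assume "5 \<le> CARD('n) \<and> p = ereal (2 * real CARD('n) / (real CARD('n) - 4))"
    then show ?thesis
      by (intro high_frequencies_smallo_critical[OF fin _ _ win \<mu> lap[rule_format] one[rule_format] s]) auto
  qed
  show "is_smallo (\<lambda>k. Lp_norm V p (\<psi> k)) (\<lambda>k. \<mu> k powr sogge_exponent p CARD('n))"
    by (rule smallo_of_low_and_high[OF p1 \<psi>
        low_frequencies_smallo[OF fin p n win \<mu> lap[rule_format] one[rule_format] s] high])
qed

lemma window_iff_strong_quasimode:
  assumes p: "2 < p" and n: "2 \<le> CARD('n)"
  shows "shrinking_window_bound V lam e CARD('n) p \<longleftrightarrow> strong_quasimode_bound A g V lam e p"
proof -
  have p1: "1 \<le> p" using p by (cases p) auto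
  show ?thesis
  proof (cases rule: finite_or_bounded_frequencies)
    case discrete
    then show ?thesis
      using window_of_strong_quasimode_bound[OF _ p1] strong_quasimode_bound_of_window[OF _ p n] by blast
  next
    case (bounded L)
    then show ?thesis using bounded_frequencies[OF bounded p1] strong_of_quasimode_bound by blast
  qed
qed

lemma window_iff_quasimode:
  assumes p: "2 < p" and n: "2 \<le> CARD('n)"
    and range: "real CARD('n) * (1/2 - inv_exponent p) < 2 \<or>
      5 \<le> CARD('n) \<and> p = ereal (2 * real CARD('n) / (real CARD('n) - 4))"
  shows "shrinking_window_bound V lam e CARD('n) p \<longleftrightarrow> quasimode_bound A g V p"
proof
  have p1: "1 \<le> p" using p by (cases p) auto
  show "quasimode_bound A g V p" if "shrinking_window_bound V lam e CARD('n) p"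
  proof (cases rule: finite_or_bounded_frequencies)
    case discrete
    then show ?thesis using that by (rule quasimode_bound_of_window[OF _ p n range])
  next
    case (bounded L)
    then show ?thesis by (rule bounded_frequencies(2)[OF _ p1])
  qed
  show "shrinking_window_bound V lam e CARD('n) p" if "quasimode_bound A g V p"
    using strong_of_quasimode_bound[OF that] window_iff_strong_quasimode[OF p n] by blast
qed

end

text \<open>The three cases of part (a) in terms of \<open>\<theta> = n (1/2 - 1/p)\<close>: either \<open>\<theta> < 2\<close>, or \<open>\<theta> = 2\<close> and the exponent is the finite
  critical one.\<close>

lemma sobolev_range:
  assumes "2 < p" "2 \<le> n"
    and "n \<le> 3 \<or> n = 4 \<and> p < \<infinity> \<or> n \<ge> 5 \<and> p \<le> ereal (2 * real n / (real n - 4))"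
  shows "real n * (1/2 - inv_exponent p) < 2 \<or> 5 \<le> n \<and> p = ereal (2 * real n / (real n - 4))"
  using assms(1)
proof (cases rule: exponent_gt_2_cases)
  case infinite
  then have "real n \<le> 3" using assms(3) by auto
  then show ?thesis using infinite by simp
next
  case (real q)
  have iq: "0 < 1 / q" using real by simp
  consider "n \<le> 4" | "5 \<le> n" "q < 2 * real n / (real n - 4)" | "5 \<le> n" "q = 2 * real n / (real n - 4)"
    using assms(3) real by fastforce
  then show ?thesis
  proof cases
    case 1
    have "real n * (1/2 - 1/q) \<le> 4 * (1/2 - 1/q)"
      using 1 real by (intro mult_right_mono) (auto simp: field_simps)
    also have "\<dots> < 2" using iq by simp
    finally show ?thesis using real by simp
  next
    case 2
    then have "q * (real n - 4) < 2 * real n" by (simp add: pos_less_divide_eq)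
    then have "real n * (1/2 - 1/q) < 2" using real(2) by (simp add: field_simps)
    then show ?thesis using real by simp
  next
    case 3
    then show ?thesis using real by simp
  qed
qed

theorem theorem1:
  fixes A :: "('m::t2_space, 'n::finite) chart set"
    and g :: "('m, 'n) metric"
    and V :: "'m measure"
    and lam :: "nat \<Rightarrow> real"
    and e :: "nat \<Rightarrow> 'm \<Rightarrow> complex"
    and n :: nat
    and p :: ereal
  assumes "n = CARD('n)" and "n \<ge> 2"
    and "compact_riemannian_manifold A g"
    and "riemannian_volume A g V"
    and "laplace_eigenbasis A g V lam e"
  shows "((n \<le> 3 \<and> 2 < p) \<or> (n = 4 \<and> 2 < p \<and> p < \<infinity>) \<or>
          (n \<ge> 5 \<and> 2 < p \<and> p \<le> ereal (2 * real n / (real n - 4)))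
           \<longrightarrow> (shrinking_window_bound V lam e n p \<longleftrightarrow> quasimode_bound A g V p))
       \<and> ((n = 4 \<and> p = \<infinity>) \<or> (n \<ge> 5 \<and> ereal (2 * real n / (real n - 4)) < p)
           \<longrightarrow> (shrinking_window_bound V lam e n p \<longleftrightarrow> strong_quasimode_bound A g V lam e p))"
proof -
  interpret laplace_spectrum A g V lam e
    by (intro laplace_spectrum.intro closed_riemannian_manifold.intro laplace_spectrum_axioms.intro assms)
  have n2: "2 \<le> CARD('n)" using assms(1,2) by simp
  show ?thesis
  proof (intro conjI impI)
    assume a: "(n \<le> 3 \<and> 2 < p) \<or> (n = 4 \<and> 2 < p \<and> p < \<infinity>) \<or>
          (n \<ge> 5 \<and> 2 < p \<and> p \<le> ereal (2 * real n / (real n - 4)))"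
    then have p: "2 < p" by blast
    have "n \<le> 3 \<or> n = 4 \<and> p < \<infinity> \<or> n \<ge> 5 \<and> p \<le> ereal (2 * real n / (real n - 4))"
      using a by blast
    from window_iff_quasimode[OF p n2 sobolev_range[OF p n2 this[unfolded assms(1)]]]
    show "shrinking_window_bound V lam e n p \<longleftrightarrow> quasimode_bound A g V p"
      unfolding assms(1) .
  next
    assume b: "(n = 4 \<and> p = \<infinity>) \<or> (n \<ge> 5 \<and> ereal (2 * real n / (real n - 4)) < p)"
    have p: "2 < p"
    proof (cases "p = \<infinity>")
      case False
      then have n5: "5 \<le> n" and less: "ereal (2 * real n / (real n - 4)) < p" using b by auto
      have "2 \<le> 2 * real n / (real n - 4)" using n5 by (simp add: field_simps)
      then have "(2 :: ereal) \<le> ereal (2 * real n / (real n - 4))" by simp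
      then show ?thesis using less by (rule order_le_less_trans)
    qed simp
    show "shrinking_window_bound V lam e n p \<longleftrightarrow> strong_quasimode_bound A g V lam e p"
      unfolding assms(1) by (rule window_iff_strong_quasimode[OF p n2])
  qed
qed

end
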